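(* Let $q$ be an even prime power, $m\ge2$ and $\delta\ge1$ integers with $2\delta\le m$, and let $Y$ be a $(2\delta)$-code in $\mathscr Q(m,q)$ of maximal size, namely $\lvert Y\rvert=q^{(m-1)(m-2\delta+2)/2}$ if $m$ is even and $\lvert Y\rvert=q^{m(m-2\delta+1)/2}$ if $m$ is odd. Then its inner distribution satisfies, for all $s>0$, \[ a_{2s,1}+a_{2s,-1}+a_{2s+1}={n\brack s}\sum_{j=0}^{s-\delta}(-1)^jq^{j(j-1)}{s\brack j}\big(c^{s-\delta-j+1}-1\big), \] where $n=\lfloor m/2\rfloor$ and $c=q^{m(m-1)/(2n)}$.
   Context: Let $q$ be an even prime power, $V$ an $m$-dimensional $\mathbb F_q$-vector space and $\mathscr Q(m,q)$ the set of quadratic forms on $V$. For $Q$ let $S_Q(x,y)=Q(x+y)-Q(x)-Q(y)$; the radical of $Q$ is $\{x: S_Q(x,y)=0\ \forall y,\ Q(x)=0\}$ and the rank of $Q$ is its codimension. Quadratic forms $Q,Q'$ are equivalent if $Q'(x)=aQ(Lx)$ for some $a\in\mathbb F_q^*$, $L\in GL(V)$. Fix $\lambda\in\mathbb F_q$ of absolute trace $1$. A quadratic form of rank $2s\ge2$ has type $1$ if it is equivalent to the form given in coordinates of some basis by $\sum_{i=1}^s x_{2i-1}x_{2i}$, and type $-1$ if equivalent to $\sum_{i=1}^{s-1}x_{2i-1}x_{2i}+x_{2s-1}^2+x_{2s-1}x_{2s}+\lambda x_{2s}^2$; each such form has exactly one type; the zero form has rank $0$ and type $1$. $\mathscr Q_{2s+1}$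 is the set of quadratic forms of rank $2s+1$ and $\mathscr Q_{2s,\tau}$ those of rank $2s$ and type $\tau$. For $Y\subseteq\mathscr Q(m,q)$ the inner distribution is $a_{i}=\lvert\{(Q,Q')\in Y\times Y:Q-Q'\in\mathscr Q_{i}\}\rvert/\lvert Y\rvert$ for $i=2s+1$ or $i=(2s,\tau)$. $Y$ is a $d$-code if $\operatorname{rank}(Q-Q')\ge d$ for all distinct $Q,Q'\in Y$ (the stated sizes are the largest possible for $(2\delta)$-codes). ${a\brack b}=\prod_{i=0}^{b-1}\frac{q^{2a}-q^{2i}}{q^{2b}-q^{2i}}$ for integers $a$ and $b\ge0$. *)

theory Defs
  imports Complex_Main "HOL-Library.Cardinality" "HOL-Number_Theory.Prime_Powers"
begin

text \<open>With \<open>p = CHAR('a)\<close> and field size \<open>p ^ e\<close>, this is the sum of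
  \<open>x ^ (p ^ i)\<close> over \<open>i < e\<close>, the trace to the prime field.\<close>

definition absolute_trace :: "'a::{field,finite} \<Rightarrow> 'a" where
  "absolute_trace x = (\<Sum>i<multiplicity CHAR('a) CARD('a). x ^ (CHAR('a) ^ i))"

text \<open>\<open>OddRank s\<close> stands for the index \<open>2s + 1\<close> and \<open>EvenRank s \<tau>\<close> for the
  index \<open>(2s, \<tau>)\<close> with \<open>\<tau> \<in> {1, -1}\<close>.\<close>

datatype form_index = OddRank nat | EvenRank nat int

definition polar :: "('v::ab_group_add \<Rightarrow> 'a::ab_group_add) \<Rightarrow> 'v \<Rightarrow> 'v \<Rightarrow> 'a" where
  "polar Q x y = Q (x + y) - Q x - Q y"

definition quadratic_form ::
  "('a::field \<Rightarrow> 'v::ab_group_add \<Rightarrow> 'v) \<Rightarrow> ('v \<Rightarrow> 'a) \<Rightarrow> bool" where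
  "quadratic_form scale Q \<longleftrightarrow>
     (\<forall>a x. Q (scale a x) = a\<^sup>2 * Q x) \<and>
     (\<forall>y. Vector_Spaces.linear scale (*) (\<lambda>x. polar Q x y)) \<and>
     (\<forall>x. Vector_Spaces.linear scale (*) (\<lambda>y. polar Q x y))"

definition qf_radical :: "('v::ab_group_add \<Rightarrow> 'a::field) \<Rightarrow> 'v set" where
  "qf_radical Q = {x. (\<forall>y. polar Q x y = 0) \<and> Q x = 0}"

definition qf_rank ::
  "('a::field \<Rightarrow> 'v::ab_group_add \<Rightarrow> 'v) \<Rightarrow> ('v \<Rightarrow> 'a) \<Rightarrow> nat" where
  "qf_rank scale Q =
     vector_space.dim scale (UNIV :: 'v set) - vector_space.dim scale (qf_radical Q)"

definition qf_equivalent ::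
  "('a::field \<Rightarrow> 'v::ab_group_add \<Rightarrow> 'v) \<Rightarrow> ('v \<Rightarrow> 'a) \<Rightarrow> ('v \<Rightarrow> 'a) \<Rightarrow> bool" where
  "qf_equivalent scale Q Q' \<longleftrightarrow>
     (\<exists>a L. a \<noteq> 0 \<and> Vector_Spaces.linear scale scale L \<and> bij L \<and>
            (\<forall>x. Q' x = a * Q (L x)))"

text \<open>Ordered bases are indexed by \<open>1, \<dots>, dim V\<close>; values of \<open>b\<close> outside this
  range are irrelevant.\<close>

definition ordered_basis ::
  "('a::field \<Rightarrow> 'v::ab_group_add \<Rightarrow> 'v) \<Rightarrow> (nat \<Rightarrow> 'v) \<Rightarrow> bool" where
  "ordered_basis scale b \<longleftrightarrow>
     (let I = {1..vector_space.dim scale (UNIV :: 'v set)} in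
       inj_on b I \<and> \<not> module.dependent scale (b ` I) \<and> module.span scale (b ` I) = UNIV)"

definition coord ::
  "('a::field \<Rightarrow> 'v::ab_group_add \<Rightarrow> 'v) \<Rightarrow> (nat \<Rightarrow> 'v) \<Rightarrow> nat \<Rightarrow> 'v \<Rightarrow> 'a" where
  "coord scale b i x =
     module.representation scale (b ` {1..vector_space.dim scale (UNIV :: 'v set)}) x (b i)"

definition hyperbolic_form ::
  "('a::field \<Rightarrow> 'v::ab_group_add \<Rightarrow> 'v) \<Rightarrow> (nat \<Rightarrow> 'v) \<Rightarrow> nat \<Rightarrow> 'v \<Rightarrow> 'a" where
  "hyperbolic_form scale b s x =
     (\<Sum>i=1..s. coord scale b (2*i - 1) x * coord scale b (2*i) x)"

definition elliptic_form ::
  "('a::field \<Rightarrow> 'v::ab_group_add \<Rightarrow> 'v) \<Rightarrow> 'a \<Rightarrow> (nat \<Rightarrow> 'v) \<Rightarrow> nat \<Rightarrow> 'v \<Rightarrow> 'a" where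
  "elliptic_form scale lam b s x =
     (\<Sum>i=1..s-1. coord scale b (2*i - 1) x * coord scale b (2*i) x)
     + (coord scale b (2*s - 1) x)\<^sup>2 + coord scale b (2*s - 1) x * coord scale b (2*s) x
     + lam * (coord scale b (2*s) x)\<^sup>2"

text \<open>The type of a form of rank \<open>2s\<close>; only used together with that rank
  condition, which guarantees \<open>2s \<le> dim V\<close> for the coordinates above.\<close>

definition has_type ::
  "('a::field \<Rightarrow> 'v::ab_group_add \<Rightarrow> 'v) \<Rightarrow> 'a \<Rightarrow> nat \<Rightarrow> int \<Rightarrow> ('v \<Rightarrow> 'a) \<Rightarrow> bool" where
  "has_type scale lam s \<tau> Q \<longleftrightarrow>
     (if s = 0 then \<tau> = 1
      else (\<tau> = 1 \<and>
              (\<exists>b. ordered_basis scale b \<and> qf_equivalent scale Q (hyperbolic_form scale b s))) \<or>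
           (\<tau> = -1 \<and>
              (\<exists>b. ordered_basis scale b \<and> qf_equivalent scale Q (elliptic_form scale lam b s))))"

primrec form_class ::
  "('a::field \<Rightarrow> 'v::ab_group_add \<Rightarrow> 'v) \<Rightarrow> 'a \<Rightarrow> form_index \<Rightarrow> ('v \<Rightarrow> 'a) set" where
  "form_class scale lam (OddRank s) = {Q. quadratic_form scale Q \<and> qf_rank scale Q = 2*s + 1}"
| "form_class scale lam (EvenRank s \<tau>) =
     {Q. quadratic_form scale Q \<and> qf_rank scale Q = 2*s \<and> has_type scale lam s \<tau> Q}"

definition inner_distribution ::
  "('a::field \<Rightarrow> 'v::ab_group_add \<Rightarrow> 'v) \<Rightarrow> 'a \<Rightarrow> ('v \<Rightarrow> 'a) set \<Rightarrow> form_index \<Rightarrow> real" where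
  "inner_distribution scale lam Y i =
     real (card {(Q, Q'). Q \<in> Y \<and> Q' \<in> Y \<and> (\<lambda>x. Q x - Q' x) \<in> form_class scale lam i})
       / real (card Y)"

definition quadratic_code ::
  "('a::field \<Rightarrow> 'v::ab_group_add \<Rightarrow> 'v) \<Rightarrow> nat \<Rightarrow> ('v \<Rightarrow> 'a) set \<Rightarrow> bool" where
  "quadratic_code scale d Y \<longleftrightarrow>
     (\<forall>Q\<in>Y. quadratic_form scale Q) \<and>
     (\<forall>Q\<in>Y. \<forall>Q'\<in>Y. Q \<noteq> Q' \<longrightarrow> d \<le> qf_rank scale (\<lambda>x. Q x - Q' x))"

definition gauss_binomial :: "nat \<Rightarrow> int \<Rightarrow> nat \<Rightarrow> real" where
  "gauss_binomial q a b =
     (\<Prod>i<b. (real q powi (2*a) - real q ^ (2*i)) / (real q ^ (2*b) - real q ^ (2*i)))"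

end

theory Submission
  imports Defs
begin

text \<open>In even characteristic a quadratic form has rank \<open>2s\<close> or \<open>2s + 1\<close> exactly if its polar
  form, which is alternating, has rank \<open>2s\<close>. Hence the polar forms of \<open>Y\<close> are an optimal
  code of alternating matrices, and the left-hand side is its distance distribution, provided
  that every form of positive even rank has exactly one type.

  For alternating matrices write \<open>r\<close> for half the rank and \<open>[a, b]\<close> for the Gaussian binomial
  to the base \<open>q\<^sup>2\<close>. The Fourier transform of \<open>B \<mapsto> [n - r(B), n - j]\<close> is
  \<open>A \<mapsto> c\<^sup>j [n - r(A), j]\<close> (Delsarte and Goethals). Summed over all differences of codewords
  and taken at \<open>j = n - \<delta> + 1\<close>, this yields \<open>|Y| \<le> c\<^sup>j\<close>, and equality forces the transform of
  the code to vanish at all nonzero \<open>B\<close> with \<open>r(B) \<le> j\<close>. Thus all moments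
  of the distance distribution are known, and inversion of Gaussian binomials recovers it.\<close>

section \<open>Gaussian binomials\<close>

text \<open>The constant \<open>c\<close> is normalised by \<open>c ^ n\<close> being the number of
  alternating matrices of order \<open>m\<close>; both prescribed code sizes are
  \<open>c ^ (n - \<delta> + 1)\<close>. The transform is obtained without counting orbits.
  Splitting a pivot plane off \<open>A\<close> by a Schur complement changes the sum only through
  matrices \<open>B\<close> with a nonzero entry at the pivot, and these are parametrised by their
  own Schur complements. The order thus drops by two on both sides, and Pascal's rule absorbs the
  resulting powers of \<open>q\<close>. Even \<open>q\<close> enters in three ways: additive
  characters take the values 1 and -1, so the transform of a code is a square; every field element
  is a square, so the radical of a form has codimension at most 1 in that of its polar form; and the
  trace classifies the anisotropic planes. Replacing a form by its polar form could identify
  codewords, so everything counts pairs of codewords instead of matrices. A difference of rank at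
  least \<open>2 * \<delta>\<close> has polar half rank at least \<open>\<delta>\<close>, because
  the one possible extra unit of rank cannot bridge a gap of two.\<close>

definition qfact :: "real \<Rightarrow> nat \<Rightarrow> real" where
  "qfact x n = (\<Prod>i<n. x ^ Suc i - 1)"

definition qbinom :: "real \<Rightarrow> nat \<Rightarrow> nat \<Rightarrow> real" where
  "qbinom x n k = (if k \<le> n then qfact x n / (qfact x k * qfact x (n - k)) else 0)"

lemma qfact_0 [simp]: "qfact x 0 = 1"
  by (simp add: qfact_def)

lemma qfact_Suc: "qfact x (Suc n) = qfact x n * (x ^ Suc n - 1)"
  by (simp add: qfact_def)

lemma qfact_pos: "x > 1 \<Longrightarrow> qfact x n > 0"
  unfolding qfact_def by (intro prod_pos) (metis One_nat_def diff_gt_0_iff_gt one_less_power zero_less_Suc)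

lemma qbinom_eq_0: "n < k \<Longrightarrow> qbinom x n k = 0"
  by (simp add: qbinom_def)

lemma qbinom_pos: "x > 1 \<Longrightarrow> k \<le> n \<Longrightarrow> qbinom x n k > 0"
  by (simp add: qbinom_def qfact_pos)

lemma qbinom_nonneg: "x > 1 \<Longrightarrow> qbinom x n k \<ge> 0"
  using qbinom_pos[of x k n] by (cases "k \<le> n") (auto simp: qbinom_eq_0)

lemma qbinom_0 [simp]: "x > 1 \<Longrightarrow> qbinom x n 0 = 1"
  using qfact_pos[of x n] by (simp add: qbinom_def)

lemma qbinom_self [simp]: "x > 1 \<Longrightarrow> qbinom x n n = 1"
  using qfact_pos[of x n] by (simp add: qbinom_def)

lemma qbinom_symmetric: "k \<le> n \<Longrightarrow> qbinom x n (n - k) = qbinom x n k"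
  by (simp add: qbinom_def mult.commute)

lemma qbinom_Suc:
  assumes x: "x > 1" and k: "k \<le> n"
  shows "qbinom x (Suc n) (Suc k) = qbinom x n (Suc k) + x ^ (n - k) * qbinom x n k"
proof (cases "k = n")
  case True
  then show ?thesis using x by (simp add: qbinom_eq_0)
next
  case False
  then obtain r where r: "n = Suc (k + r)"
    using k by (metis add_Suc_right le_imp_less_or_eq less_imp_Suc_add)
  have nz: "qfact x k \<noteq> 0" "qfact x r \<noteq> 0" "x ^ Suc k - 1 \<noteq> 0" "x ^ Suc r - 1 \<noteq> 0"
    using qfact_pos[OF x] one_less_power[OF x, of "Suc k"] one_less_power[OF x, of "Suc r"]
    by (simp_all add: less_imp_neq less_imp_neq[symmetric])
  have "Suc (Suc (k + r)) - Suc k = Suc r" "Suc (k + r) - Suc k = r" "Suc (k + r) - k = Suc r"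
    by auto
  moreover have pw: "x ^ Suc (Suc (k + r)) = x ^ Suc r * x ^ Suc k"
    by (simp add: power_add)
  ultimately show ?thesis
    unfolding qbinom_def r
    using nz by (simp add: qfact_Suc[of _ "Suc (k + r)"] qfact_Suc[of _ k] qfact_Suc[of _ r] divide_simps
        del: power_Suc) (simp add: algebra_simps pw del: power_Suc)
qed

lemma qbinom_Suc':
  assumes x: "x > 1"
  shows "qbinom x (Suc n) (Suc k) = x ^ Suc k * qbinom x n (Suc k) + qbinom x n k"
proof (cases "Suc k \<le> n")
  case True
  have "qbinom x (Suc n) (Suc k) = qbinom x (Suc n) (Suc (n - Suc k))"
    using qbinom_symmetric[of "Suc k" "Suc n"] True by (simp add: Suc_diff_Suc)
  also have "\<dots> = qbinom x n (n - k) + x ^ Suc k * qbinom x n (n - Suc k)"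
    using qbinom_Suc[OF x, of "n - Suc k" n] True by (simp add: Suc_diff_Suc)
  finally show ?thesis
    using qbinom_symmetric[of k n] qbinom_symmetric[of "Suc k" n] True by simp
next
  case False
  then show ?thesis using x by (cases "k = n") (simp_all add: qbinom_eq_0)
qed

text \<open>Both sides are the multinomial coefficient of \<open>n - i\<close> with parts
  \<open>n - s\<close>, \<open>l\<close> and \<open>s - i - l\<close>. The right-hand form isolates
  a factor free of \<open>l\<close>, so that a weighted sum over \<open>l\<close> reduces to
  \<open>alternating_qbinom_sum\<close>.\<close>

lemma qbinom_absorb:
  assumes x: "x > 1" and i: "i \<le> s" and s: "s \<le> n" and l: "l \<le> s"
  shows "qbinom x (n - s + l) l * qbinom x (n - i) (n - s + l)
    = qbinom x (n - i) (n - s) * qbinom x (s - i) l"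
proof (cases "l \<le> s - i")
  case True
  then have le: "n - s + l \<le> n - i" and e: "n - i - (n - s + l) = s - i - l" "n - i - (n - s) = s - i"
    using assms by auto
  show ?thesis
    using True le i s qfact_pos[OF x, of "n - s + l"] qfact_pos[OF x, of "s - i"]
    by (simp add: qbinom_def e)
next
  case False
  then show ?thesis using assms by (simp add: qbinom_eq_0)
qed

text \<open>By the q-binomial theorem this is the product of \<open>1 - x ^ i\<close> over
  \<open>i < N\<close>, which contains the factor 0 unless \<open>N = 0\<close>. The proof lets the
  sum telescope through \<open>qbinom_Suc'\<close>.\<close>

lemma alternating_qbinom_sum:
  assumes x: "x > 1"
  shows "(\<Sum>l\<le>N. (-1) ^ l * x ^ (l * (l - 1) div 2) * qbinom x N l) = (if N = 0 then 1 else 0)"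
proof (cases N)
  case 0
  then show ?thesis using x by simp
next
  case (Suc M)
  define w where "w l = (-1) ^ l * x ^ (l * (l - 1) div 2)" for l :: nat
  have w: "w (Suc l) = - w l * x ^ l" for l
  proof -
    have "Suc l * (Suc l - 1) div 2 = l * (l - 1) div 2 + l"
    proof -
      have "Suc l * (Suc l - 1) = l * (l - 1) + l * 2" by (cases l) simp_all
      then show ?thesis by (simp only:)
    qed
    then show ?thesis unfolding w_def by (simp add: power_add)
  qed
  have step: "w (Suc l) * qbinom x N (Suc l) = w (Suc l) * x ^ Suc l * qbinom x M (Suc l) - w l * x ^ l * qbinom x M l" for l
    unfolding Suc qbinom_Suc'[OF x] w by (simp add: algebra_simps)
  have tele: "(\<Sum>l\<le>K. w (Suc l) * qbinom x N (Suc l))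
      = w (Suc K) * x ^ Suc K * qbinom x M (Suc K) - w 0 * x ^ 0 * qbinom x M 0" for K
    unfolding step by (induction K) simp_all
  have "(\<Sum>l\<le>N. w l * qbinom x N l) = w 0 * qbinom x N 0 + (\<Sum>l\<le>M. w (Suc l) * qbinom x N (Suc l))"
    unfolding Suc by (rule sum.atMost_Suc_shift)
  also have "\<dots> = 0"
    unfolding tele using x by (simp add: w_def qbinom_eq_0)
  finally show ?thesis
    using Suc by (simp add: w_def)
qed

lemma gauss_binomial_eq_qbinom:
  assumes q: "q > 1"
  shows "gauss_binomial q (int n) k = qbinom ((real q)\<^sup>2) n k"
proof -
  let ?x = "(real q)\<^sup>2"
  have x: "?x > 1" using q by simp
  have pw: "real q powi (2 * int n) = ?x ^ n" for n
    by (metis of_nat_mult of_nat_numeral power_int_of_nat power_mult)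
  have gb: "gauss_binomial q (int n) k = (\<Prod>i<k. ?x ^ n - ?x ^ i) / (\<Prod>i<k. ?x ^ k - ?x ^ i)"
    unfolding gauss_binomial_def pw by (simp add: prod_dividef power_mult)
  \<comment> \<open>Taking \<open>?x ^ i\<close> out of each factor leaves the top \<open>k\<close>
    factors of a q-factorial. The extracted powers are the same for \<open>N = n\<close> and
    \<open>N = k\<close>, so they cancel in the quotient.\<close>
  have fac: "(\<Prod>i<k. ?x ^ N - ?x ^ i) = (\<Prod>i<k. ?x ^ i) * qfact ?x N / qfact ?x (N - k)" if "k \<le> N" for N
    using that
  proof (induction k)
    case 0
    then show ?case using qfact_pos[OF x, of N] by simp
  next
    case (Suc k)
    then have N: "N - k = Suc (N - Suc k)" by simp
    have "?x ^ N - ?x ^ k = ?x ^ k * (?x ^ Suc (N - Suc k) - 1)"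
      unfolding right_diff_distrib power_add[symmetric] N[symmetric] using Suc.prems by simp
    moreover have "qfact ?x (N - k) = qfact ?x (N - Suc k) * (?x ^ Suc (N - Suc k) - 1)"
      unfolding N by (rule qfact_Suc)
    moreover have "?x ^ Suc (N - Suc k) - 1 \<noteq> 0"
      using one_less_power[OF x, of "Suc (N - Suc k)"] by simp
    ultimately show ?case
      using Suc by (simp del: power_Suc)
  qed
  have pos: "(\<Prod>i<k. ?x ^ i) > 0"
    using q by (intro prod_pos ballI zero_less_power) simp
  show ?thesis
  proof (cases "k \<le> n")
    case True
    then show ?thesis
      using gb fac[OF True] fac[OF order_refl] pos qfact_pos[OF x, of k] by (simp add: qbinom_def) (use q in simp)
  next
    case False
    then have "(\<Prod>i<k. ?x ^ n - ?x ^ i) = 0"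
      by (intro prod_zero) auto
    with False show ?thesis by (simp add: gb qbinom_eq_0)
  qed
qed

text \<open>Both sides are read as linear functionals of the moments; on the moments
  of a point mass at \<open>i\<close> the alternating sum vanishes unless \<open>i = s\<close>.\<close>

lemma qbinom_moment_inversion:
  fixes a :: "nat \<Rightarrow> real"
  assumes x: "x > 1" and s: "s \<le> n"
    and M: "\<And>j. j \<le> n \<Longrightarrow> (\<Sum>i\<le>n. a i * qbinom x (n - i) j) = M j"
  shows "a s = (\<Sum>l\<le>s. (-1) ^ l * x ^ (l * (l - 1) div 2) * qbinom x (n - s + l) l * M (n - s + l))"
proof -
  define w where "w l = (-1) ^ l * x ^ (l * (l - 1) div 2)" for l :: nat
  have inner: "(\<Sum>l\<le>s. w l * qbinom x (n - s + l) l * qbinom x (n - i) (n - s + l))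
      = (if i = s then 1 else 0)" if i: "i \<le> n" for i
  proof (cases "i \<le> s")
    case True
    have "(\<Sum>l\<le>s. w l * qbinom x (n - s + l) l * qbinom x (n - i) (n - s + l))
        = qbinom x (n - i) (n - s) * (\<Sum>l\<le>s. w l * qbinom x (s - i) l)"
      unfolding sum_distrib_left
      using qbinom_absorb[OF x True s] by (intro sum.cong) (simp_all add: mult.assoc mult.left_commute)
    also have "(\<Sum>l\<le>s. w l * qbinom x (s - i) l) = (\<Sum>l\<le>s - i. w l * qbinom x (s - i) l)"
      by (rule sum.mono_neutral_right) (auto simp: qbinom_eq_0)
    also have "\<dots> = (if s - i = 0 then 1 else 0)"
      unfolding w_def by (rule alternating_qbinom_sum[OF x])
    finally show ?thesis using True x by auto
  next
    case False
    then show ?thesis using i by (intro trans[OF sum.neutral]) (auto simp: qbinom_eq_0)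
  qed
  have "(\<Sum>l\<le>s. w l * qbinom x (n - s + l) l * M (n - s + l))
      = (\<Sum>l\<le>s. \<Sum>i\<le>n. a i * (w l * qbinom x (n - s + l) l * qbinom x (n - i) (n - s + l)))"
    using s by (intro sum.cong) (simp_all add: sum_distrib_left ac_simps flip: M)
  also have "\<dots> = (\<Sum>i\<le>n. a i * (\<Sum>l\<le>s. w l * qbinom x (n - s + l) l * qbinom x (n - i) (n - s + l)))"
    by (subst sum.swap) (simp add: sum_distrib_left)
  also have "\<dots> = (\<Sum>i\<le>n. if i = s then a i else 0)"
    using inner by (intro sum.cong) auto
  also have "\<dots> = a s" using s by simp
  finally show ?thesis by (simp add: w_def)
qed

section \<open>Alternating matrices and their half rank\<close>

text \<open>Vectors and matrices are functions on all of \<open>nat\<close> that vanish off the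
  index set. Deleting two indices then stays within the same type, and inductions over index sets
  need no reindexing.\<close>

definition vec_on :: "nat set \<Rightarrow> (nat \<Rightarrow> 'a::field) set" where
  "vec_on I = {x. \<forall>i. i \<notin> I \<longrightarrow> x i = 0}"

text \<open>The zero diagonal is a condition of its own: in characteristic 2 it does not follow from
  skew symmetry.\<close>

definition alt_on :: "nat set \<Rightarrow> (nat \<Rightarrow> nat \<Rightarrow> 'a::field) set" where
  "alt_on I = {A. (\<forall>i. A i i = 0) \<and> (\<forall>i j. A j i + A i j = 0) \<and> (\<forall>i j. i \<notin> I \<longrightarrow> A i j = 0)}"

definition bilin :: "nat set \<Rightarrow> (nat \<Rightarrow> nat \<Rightarrow> 'a::field) \<Rightarrow> (nat \<Rightarrow> 'a) \<Rightarrow> (nat \<Rightarrow> 'a) \<Rightarrow> 'a" where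
  "bilin I A x y = (\<Sum>i\<in>I. \<Sum>j\<in>I. x i * A i j * y j)"

definition null_on :: "nat set \<Rightarrow> (nat \<Rightarrow> nat \<Rightarrow> 'a::field) \<Rightarrow> (nat \<Rightarrow> 'a) set" where
  "null_on I A = {x \<in> vec_on I. \<forall>j\<in>I. (\<Sum>i\<in>I. x i * A i j) = 0}"

definition wedge :: "(nat \<Rightarrow> 'a::field) \<Rightarrow> (nat \<Rightarrow> 'a) \<Rightarrow> nat \<Rightarrow> nat \<Rightarrow> 'a" where
  "wedge u w i j = u i * w j - u j * w i"

text \<open>The Schur complement of the block on \<open>p, q\<close>, which for alternating
  \<open>A\<close> is governed by the single entry \<open>A p q\<close>. The subtracted matrix has
  rank 2 and the same rows \<open>p\<close> and \<open>q\<close> as \<open>A\<close>.\<close>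

definition schur :: "nat \<Rightarrow> nat \<Rightarrow> (nat \<Rightarrow> nat \<Rightarrow> 'a::field) \<Rightarrow> nat \<Rightarrow> nat \<Rightarrow> 'a" where
  "schur p q A i j = A i j - wedge (A p) (A q) i j / A p q"

text \<open>Reading the rank off the size of the kernel makes it invariant under every bijection of
  kernels. The description determines a number because alternating matrices have even rank, see
  \<open>half_rank_exists\<close>.\<close>

definition half_rank :: "nat set \<Rightarrow> (nat \<Rightarrow> nat \<Rightarrow> 'a::{field,finite}) \<Rightarrow> nat" where
  "half_rank I A = (THE r. 2 * r \<le> card I \<and> card (null_on I A) = CARD('a) ^ (card I - 2 * r))"

text \<open>Each pair of opposite entries is counted once. For alternating matrices the full double
  sum would be twice this value, hence 0 in characteristic 2.\<close>

definition alt_pairing :: "nat set \<Rightarrow> (nat \<Rightarrow> nat \<Rightarrow> 'a::field) \<Rightarrow> (nat \<Rightarrow> nat \<Rightarrow> 'a) \<Rightarrow> 'a" where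
  "alt_pairing I A B = (\<Sum>i\<in>I. \<Sum>j\<in>I. if i < j then A i j * B i j else 0)"

lemma CARD_field_gt_1: "CARD('a::{field,finite}) > 1"
  using card_mono[of UNIV "{0, 1 :: 'a}"] by simp

lemma alt_onD:
  assumes "A \<in> alt_on I"
  shows "A i i = 0" "A j i = - A i j" "i \<notin> I \<Longrightarrow> A i j = 0" "j \<notin> I \<Longrightarrow> A i j = 0"
proof -
  show "A i i = 0" and neg: "A j i = - A i j" and "i \<notin> I \<Longrightarrow> A i j = 0"
    using assms unfolding alt_on_def eq_neg_iff_add_eq_0 by blast+
  show "A i j = 0" if "j \<notin> I"
  proof -
    have "A j i = 0" using assms that unfolding alt_on_def by blast
    with neg show ?thesis by simp
  qed
qed

lemma alt_on_index:
  assumes "A \<in> alt_on I" "A p q \<noteq> 0"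
  shows "p \<in> I" "q \<in> I" "p \<noteq> q"
  using assms(2) alt_onD(1)[OF assms(1), of p] alt_onD(3)[OF assms(1), of p q]
    alt_onD(4)[OF assms(1), of q p] by blast+

lemma zero_alt_on [simp]: "(\<lambda>_ _. 0) \<in> alt_on I"
  by (simp add: alt_on_def)

lemma alt_on_row: "A \<in> alt_on I \<Longrightarrow> A i \<in> vec_on I"
  by (simp add: vec_on_def alt_onD(4))

lemma alt_on_mono: "I \<subseteq> J \<Longrightarrow> alt_on I \<subseteq> alt_on J"
  by (auto simp: alt_on_def)

lemma alt_on_diff:
  assumes "A \<in> alt_on I" "B \<in> alt_on I"
  shows "(\<lambda>i j. A i j - B i j) \<in> alt_on I"
proof -
  have "A j i - B j i + (A i j - B i j) = 0" for i j
    using alt_onD(2)[OF assms(1), of j i] alt_onD(2)[OF assms(2), of j i] by simp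
  then show ?thesis
    using assms unfolding alt_on_def by simp
qed

lemma finite_vec_on [simp]: "finite I \<Longrightarrow> finite (vec_on I :: (nat \<Rightarrow> 'a::{field,finite}) set)"
  using finite_set_of_finite_funs[of I "UNIV :: 'a set" 0] by (simp add: vec_on_def)

lemma finite_alt_on [simp]:
  assumes "finite I"
  shows "finite (alt_on I :: (nat \<Rightarrow> nat \<Rightarrow> 'a::{field,finite}) set)"
proof (rule finite_subset)
  show "finite {A :: nat \<Rightarrow> nat \<Rightarrow> 'a. \<forall>i. (i \<in> I \<longrightarrow> A i \<in> vec_on I) \<and> (i \<notin> I \<longrightarrow> A i = (\<lambda>_. 0))}"
    using assms by (intro finite_set_of_finite_funs) auto
qed (auto simp: alt_on_row alt_onD(3))

lemma card_vec_on:
  assumes "finite I"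
  shows "card (vec_on I :: (nat \<Rightarrow> 'a::{field,finite}) set) = CARD('a) ^ card I"
proof -
  have "bij_betw (\<lambda>x. restrict x I) (vec_on I) (I \<rightarrow>\<^sub>E (UNIV :: 'a set))"
    by (rule bij_betwI[where g = "\<lambda>f i. if i \<in> I then f i else 0"])
      (auto simp: vec_on_def PiE_def extensional_def fun_eq_iff)
  then show ?thesis
    using assms by (simp add: bij_betw_same_card card_PiE)
qed

lemma sum_remove_pair:
  fixes f :: "'i \<Rightarrow> 'b::ab_group_add"
  assumes "finite I" "p \<in> I" "q \<in> I" "p \<noteq> q"
  shows "sum f I = f p + f q + sum f (I - {p, q})"
proof -
  have "I - {p, q} = I - {p} - {q}" by auto
  then show ?thesis
    using assms sum.remove[of I p f] sum.remove[of "I - {p}" q f] by (simp add: add.assoc)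
qed

lemma card_remove_pair:
  "finite I \<Longrightarrow> p \<in> I \<Longrightarrow> q \<in> I \<Longrightarrow> p \<noteq> q \<Longrightarrow> card I = Suc (Suc (card (I - {p, q})))"
  using card_Diff_subset[of "{p, q}" I] card_mono[of I "{p, q}"] by simp

lemma schur_alt_on:
  assumes A: "A \<in> alt_on I" and a: "A p q \<noteq> 0"
  shows "schur p q A \<in> alt_on (I - {p, q})"
proof -
  note alt = alt_onD[OF A]
  have "schur p q A i i = 0" for i
    by (simp add: schur_def wedge_def alt(1))
  moreover have "schur p q A j i + schur p q A i j = 0" for i j
    using alt(2)[of i j] by (simp add: schur_def wedge_def) (simp add: field_simps a)
  moreover have "schur p q A i j = 0" if out: "i \<notin> I - {p, q}" for i j
  proof -
    consider "i \<notin> I" | "i = p" | "i = q" using out by blast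
    then show ?thesis
      using a alt(1,3) alt(2)[of p q] alt(4)[of i] by cases (simp_all add: schur_def wedge_def)
  qed
  ultimately show ?thesis by (simp add: alt_on_def)
qed

text \<open>Forgetting the entries \<open>p\<close> and \<open>q\<close> of a kernel vector loses
  nothing: columns \<open>q\<close> and \<open>p\<close> of the kernel equations determine them, and
  \<open>g\<close> below is the solution. Substituting it into the other columns gives the kernel
  equations of the Schur complement.\<close>

lemma card_null_on_schur:
  fixes A :: "nat \<Rightarrow> nat \<Rightarrow> 'a::{field,finite}"
  assumes I: "finite I" and A: "A \<in> alt_on I" and a: "A p q \<noteq> 0"
  shows "card (null_on I A) = card (null_on (I - {p, q}) (schur p q A))"
proof -
  note alt = alt_onD[OF A]
  note pq = alt_on_index[OF A a]
  let ?J = "I - {p, q}" and ?a = "A p q"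
  note split = sum_remove_pair[OF I pq]
  define g where "g y = y(p := - (\<Sum>i\<in>?J. y i * A i q) / ?a, q := (\<Sum>i\<in>?J. y i * A i p) / ?a)"
    for y :: "nat \<Rightarrow> 'a"
  have qp: "A q p = - ?a" by (rule alt(2))
  have col: "(\<Sum>i\<in>?J. y i * schur p q A i j)
      = (\<Sum>i\<in>?J. y i * A i j) - (\<Sum>i\<in>?J. y i * A i q) / ?a * A p j + (\<Sum>i\<in>?J. y i * A i p) / ?a * A q j" for y j
  proof -
    have "y i * schur p q A i j = y i * A i j - y i * A i q / ?a * A p j + y i * A i p / ?a * A q j" for i
      using alt(2)[of i p] alt(2)[of i q] by (simp add: schur_def wedge_def) (simp add: field_simps a)
    then show ?thesis
      by (simp add: sum.distrib sum_subtractf flip: sum_distrib_right sum_divide_distrib)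
  qed
  have "bij_betw (\<lambda>x i. if i \<in> {p, q} then 0 else x i) (null_on I A) (null_on ?J (schur p q A))"
  proof (rule bij_betw_byWitness[where f' = g]; safe?)
    fix x assume x: "x \<in> null_on I A"
    let ?y = "\<lambda>i. if i \<in> {p, q} then 0 else x i"
    have y: "(\<Sum>i\<in>?J. ?y i * A i j) = (\<Sum>i\<in>?J. x i * A i j)" for j
      by (intro sum.cong) auto
    have eq: "x p * A p j + x q * A q j + (\<Sum>i\<in>?J. x i * A i j) = 0" if "j \<in> I" for j
      using x that split[of "\<lambda>i. x i * A i j"] by (simp add: null_on_def)
    have xq: "x q = (\<Sum>i\<in>?J. x i * A i p) / ?a" and xp: "x p = - (\<Sum>i\<in>?J. x i * A i q) / ?a"
      using eq[of p] eq[of q] pq a qp alt(1) by (auto simp: field_simps add_eq_0_iff)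
    show "g ?y = x"
      unfolding g_def y xp[symmetric] xq[symmetric] by auto
    have "(\<Sum>i\<in>?J. ?y i * schur p q A i j) = 0" if "j \<in> ?J" for j
      unfolding col y xq[symmetric] using eq[of j] that xp by (simp add: algebra_simps)
    then show "?y \<in> null_on ?J (schur p q A)"
      using x by (auto simp: null_on_def vec_on_def)
  next
    fix y assume y: "y \<in> null_on ?J (schur p q A)"
    then have y0: "y p = 0" "y q = 0" and yI: "\<And>i. i \<notin> I \<Longrightarrow> y i = 0"
      by (auto simp: null_on_def vec_on_def)
    show "(\<lambda>i. if i \<in> {p, q} then 0 else g y i) = y"
      using y0 by (auto simp: g_def)
    have gJ: "(\<Sum>i\<in>?J. g y i * A i j) = (\<Sum>i\<in>?J. y i * A i j)" for j
      by (intro sum.cong) (auto simp: g_def)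
    have gp: "g y p = - (\<Sum>i\<in>?J. y i * A i q) / ?a" and gq: "g y q = (\<Sum>i\<in>?J. y i * A i p) / ?a"
      using pq by (simp_all add: g_def)
    have "(\<Sum>i\<in>I. g y i * A i j) = 0" if "j \<in> I" for j
    proof -
      have e: "(\<Sum>i\<in>I. g y i * A i j) = (\<Sum>i\<in>?J. y i * schur p q A i j)"
        unfolding split[of "\<lambda>i. g y i * A i j"] gJ col gp gq by (simp add: algebra_simps)
      show ?thesis
      proof (cases "j \<in> ?J")
        case True
        then show ?thesis using e y by (simp add: null_on_def)
      next
        case False
        then have "schur p q A i j = 0" for i
          by (rule alt_onD(4)[OF schur_alt_on[OF A a]])
        then show ?thesis using e by simp
      qed
    qed
    then show "g y \<in> null_on I A"
      using yI pq by (auto simp: null_on_def vec_on_def g_def)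
  qed
  then show ?thesis by (rule bij_betw_same_card)
qed

lemma null_on_zero: "null_on I (\<lambda>_ _. 0) = vec_on I"
  by (auto simp: null_on_def)

lemma half_rank_unique:
  fixes A :: "nat \<Rightarrow> nat \<Rightarrow> 'a::{field,finite}"
  assumes "2 * r \<le> card I" "card (null_on I A) = CARD('a) ^ (card I - 2 * r)"
  shows "half_rank I A = r"
  unfolding half_rank_def
proof (rule the_equality)
  fix s assume s: "2 * s \<le> card I \<and> card (null_on I A) = CARD('a) ^ (card I - 2 * s)"
  then have "card I - 2 * s = card I - 2 * r"
    using assms(2) CARD_field_gt_1[where 'a = 'a] by (metis power_inject_exp)
  then show "s = r" using s assms(1) by linarith
qed (use assms in blast)

text \<open>Each Schur complement removes two indices and keeps the size of the kernel, so the
  process reaches the zero matrix after an even number of deletions.\<close>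

lemma half_rank_exists:
  fixes A :: "nat \<Rightarrow> nat \<Rightarrow> 'a::{field,finite}"
  assumes "finite I" "A \<in> alt_on I"
  shows "\<exists>r. 2 * r \<le> card I \<and> card (null_on I A) = CARD('a) ^ (card I - 2 * r)"
  using assms
proof (induction "card I" arbitrary: I A rule: less_induct)
  case less
  show ?case
  proof (cases "A = (\<lambda>_ _. 0)")
    case True
    then show ?thesis using less.prems by (intro exI[of _ 0]) (simp add: null_on_zero card_vec_on)
  next
    case False
    then obtain p q where a: "A p q \<noteq> 0" by (auto simp: fun_eq_iff)
    note pq = alt_on_index[OF less.prems(2) a]
    have c: "card I = Suc (Suc (card (I - {p, q})))"
      using less.prems pq by (intro card_remove_pair)
    obtain r where "2 * r \<le> card (I - {p, q})"
      "card (null_on (I - {p, q}) (schur p q A)) = CARD('a) ^ (card (I - {p, q}) - 2 * r)"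
      using less.hyps[of "I - {p, q}" "schur p q A"] less.prems schur_alt_on[OF less.prems(2) a] c by auto
    then show ?thesis
      using card_null_on_schur[OF less.prems a] c by (intro exI[of _ "Suc r"]) simp
  qed
qed

lemma half_rank:
  fixes A :: "nat \<Rightarrow> nat \<Rightarrow> 'a::{field,finite}"
  assumes "finite I" "A \<in> alt_on I"
  shows "2 * half_rank I A \<le> card I"
    and "card (null_on I A) = CARD('a) ^ (card I - 2 * half_rank I A)"
  using half_rank_exists[OF assms] half_rank_unique by metis+

lemma half_rank_zero [simp]:
  "finite I \<Longrightarrow> half_rank I (\<lambda>_ _. 0 :: 'a::{field,finite}) = 0"
  by (rule half_rank_unique) (simp_all add: null_on_zero card_vec_on)

lemma half_rank_schur:
  assumes "finite I" "A \<in> alt_on I" "A p q \<noteq> 0"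
  shows "half_rank I A = Suc (half_rank (I - {p, q}) (schur p q A))"
proof -
  note pq = alt_on_index[OF assms(2,3)]
  note half_rank[OF _ schur_alt_on[OF assms(2,3)]]
  then show ?thesis
    using assms card_null_on_schur[OF assms] card_remove_pair[OF assms(1) pq]
    by (intro half_rank_unique) simp_all
qed

lemma half_rank_eq_0_iff:
  assumes "finite I" "A \<in> alt_on I"
  shows "half_rank I A = 0 \<longleftrightarrow> A = (\<lambda>_ _. 0)"
proof
  assume "half_rank I A = 0"
  then have "A p q = 0" for p q
    using half_rank_schur[OF assms, of p q] by auto
  then show "A = (\<lambda>_ _. 0)" by blast
qed (use assms in simp)

text \<open>A pivot in \<open>J\<close> is also a pivot in \<open>I\<close>, so both half ranks
  descend together along the same Schur complements.\<close>

lemma half_rank_superset: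
  assumes "finite I" "J \<subseteq> I" "A \<in> alt_on J"
  shows "half_rank I A = half_rank J A"
  using assms
proof (induction "card J" arbitrary: I J A rule: less_induct)
  case less
  have J: "finite J" using less.prems finite_subset by blast
  have AI: "A \<in> alt_on I" using less.prems alt_on_mono by blast
  show ?case
  proof (cases "A = (\<lambda>_ _. 0)")
    case False
    then obtain p q where a: "A p q \<noteq> 0" by (auto simp: fun_eq_iff)
    have "card J = Suc (Suc (card (J - {p, q})))"
      using J alt_on_index[OF less.prems(3) a] by (intro card_remove_pair)
    then have "half_rank (I - {p, q}) (schur p q A) = half_rank (J - {p, q}) (schur p q A)"
      using less.prems schur_alt_on[OF less.prems(3) a] by (intro less.hyps) auto
    then show ?thesis
      using half_rank_schur[OF less.prems(1) AI a] half_rank_schur[OF J less.prems(3) a] by simp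
  qed (use less.prems J in simp)
qed

section \<open>Congruence and the pairing of alternating matrices\<close>

text \<open>The congruent matrix \<open>M B M^T\<close>, that is, the Gram matrix of
  \<open>B\<close> on the rows of \<open>M\<close>.\<close>

definition pull :: "nat set \<Rightarrow> (nat \<Rightarrow> nat \<Rightarrow> 'a::field) \<Rightarrow> (nat \<Rightarrow> nat \<Rightarrow> 'a) \<Rightarrow> nat \<Rightarrow> nat \<Rightarrow> 'a" where
  "pull I M B i j = (if i \<in> I \<and> j \<in> I then bilin I B (M i) (M j) else 0)"

definition lincomb :: "nat set \<Rightarrow> (nat \<Rightarrow> nat \<Rightarrow> 'a::field) \<Rightarrow> (nat \<Rightarrow> 'a) \<Rightarrow> nat \<Rightarrow> 'a" where
  "lincomb I M x k = (\<Sum>i\<in>I. x i * M i k)"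

definition unit_vec :: "nat \<Rightarrow> nat \<Rightarrow> 'a::field" where
  "unit_vec i j = (if j = i then 1 else 0)"

lemma unit_vec_in [simp]: "unit_vec i \<in> vec_on I \<longleftrightarrow> i \<in> I"
  by (auto simp: unit_vec_def vec_on_def)

lemma sum_times_unit_vec [simp]:
  "finite I \<Longrightarrow> (\<Sum>j\<in>I. f j * unit_vec i j) = (if i \<in> I then f i else 0)"
  "finite I \<Longrightarrow> (\<Sum>j\<in>I. unit_vec i j * f j) = (if i \<in> I then f i else 0)"
proof -
  have "f j * unit_vec i j = (if j = i then f j else 0)" "unit_vec i j * f j = (if j = i then f j else 0)" for j
    by (simp_all add: unit_vec_def)
  then show "finite I \<Longrightarrow> (\<Sum>j\<in>I. f j * unit_vec i j) = (if i \<in> I then f i else 0)"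
    "finite I \<Longrightarrow> (\<Sum>j\<in>I. unit_vec i j * f j) = (if i \<in> I then f i else 0)"
    by (simp_all add: sum.delta)
qed

lemma bilin_alt: "bilin I A x y = (\<Sum>j\<in>I. (\<Sum>i\<in>I. x i * A i j) * y j)"
  unfolding bilin_def by (subst sum.swap) (simp add: sum_distrib_right)

lemma bilin_unit_right: "finite I \<Longrightarrow> j \<in> I \<Longrightarrow> bilin I A x (unit_vec j) = (\<Sum>i\<in>I. x i * A i j)"
  by (simp add: bilin_alt)

lemma bilin_unit_vec: "finite I \<Longrightarrow> i \<in> I \<Longrightarrow> j \<in> I \<Longrightarrow> bilin I A (unit_vec i) (unit_vec j) = A i j"
  by (simp add: bilin_unit_right)

lemma null_on_bilin:
  assumes "finite I"
  shows "null_on I A = {x \<in> vec_on I. \<forall>y\<in>vec_on I. bilin I A x y = 0}"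
proof -
  have "(\<Sum>i\<in>I. x i * A i j) = 0" if "\<forall>y\<in>vec_on I. bilin I A x y = 0" "j \<in> I" for x j
    using that bilin_unit_right[OF assms, of j A x] by simp
  then show ?thesis
    by (auto simp: null_on_def bilin_alt)
qed

lemma bilin_swap:
  assumes "A \<in> alt_on I"
  shows "bilin I A y x + bilin I A x y = 0"
proof -
  have "bilin I A y x = (\<Sum>i\<in>I. \<Sum>j\<in>I. - (x i * A i j * y j))"
    unfolding bilin_def
    by (subst sum.swap, intro sum.cong refl, subst alt_onD(2)[OF assms]) (simp add: ac_simps)
  then show ?thesis by (simp add: bilin_def sum_negf)
qed

lemma alt_sum_lt:
  fixes f :: "nat \<Rightarrow> nat \<Rightarrow> 'a::ab_group_add"
  assumes "finite I" "\<And>i. f i i = 0"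
  shows "(\<Sum>i\<in>I. \<Sum>j\<in>I. f i j) = (\<Sum>i\<in>I. \<Sum>j\<in>I. if i < j then f i j + f j i else 0)"
proof -
  have "(\<Sum>i\<in>I. \<Sum>j\<in>I. f i j)
      = (\<Sum>i\<in>I. \<Sum>j\<in>I. (if i < j then f i j else 0) + (if j < i then f i j else 0))"
    using assms(2) by (intro sum.cong refl) (metis add.left_neutral add.right_neutral less_asym linorder_neqE_nat)
  also have "\<dots> = (\<Sum>i\<in>I. \<Sum>j\<in>I. if i < j then f i j else 0) + (\<Sum>i\<in>I. \<Sum>j\<in>I. if j < i then f i j else 0)"
    by (simp add: sum.distrib)
  also have "(\<Sum>i\<in>I. \<Sum>j\<in>I. if j < i then f i j else 0) = (\<Sum>i\<in>I. \<Sum>j\<in>I. if i < j then f j i else 0)"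
    by (rule sum.swap)
  finally show ?thesis
    by (simp flip: sum.distrib) (intro sum.cong refl, auto)
qed

lemma bilin_self:
  assumes "finite I" "A \<in> alt_on I"
  shows "bilin I A x x = 0"
proof -
  have "x i * A i j * x j + x j * A j i * x i = 0" for i j
    by (subst alt_onD(2)[OF assms(2), of j i]) simp
  note pair = this
  show ?thesis
    unfolding bilin_def
    by (subst alt_sum_lt[OF assms(1)]) (simp_all add: alt_onD(1)[OF assms(2)] pair cong: if_cong)
qed

lemma pull_alt_on:
  assumes "finite I" "B \<in> alt_on I"
  shows "pull I M B \<in> alt_on I"
  using bilin_swap[OF assms(2)] bilin_self[OF assms] by (auto simp: alt_on_def pull_def)

lemma lincomb_in:
  "(\<And>i. i \<in> I \<Longrightarrow> M i \<in> vec_on I) \<Longrightarrow> lincomb I M x \<in> vec_on I"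
  by (auto simp: lincomb_def vec_on_def intro!: sum.neutral)

lemma bilin_row: "bilin I A x y = (\<Sum>i\<in>I. x i * (\<Sum>j\<in>I. A i j * y j))"
  by (simp add: bilin_def sum_distrib_left mult.assoc)

lemma bilin_lincomb_left: "bilin I B (lincomb I M x) y = (\<Sum>i\<in>I. x i * bilin I B (M i) y)"
proof -
  have "bilin I B (lincomb I M x) y = (\<Sum>k\<in>I. \<Sum>i\<in>I. x i * (M i k * (\<Sum>l\<in>I. B k l * y l)))"
    unfolding bilin_row lincomb_def by (simp only: sum_distrib_right mult.assoc)
  also have "\<dots> = (\<Sum>i\<in>I. x i * bilin I B (M i) y)"
    unfolding bilin_row by (subst sum.swap) (simp only: sum_distrib_left)
  finally show ?thesis .
qed

lemma bilin_lincomb_right: "bilin I B x (lincomb I M y) = (\<Sum>j\<in>I. bilin I B x (M j) * y j)"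
proof -
  have "bilin I B x (lincomb I M y) = (\<Sum>k\<in>I. \<Sum>j\<in>I. (\<Sum>i\<in>I. x i * B i k) * M j k * y j)"
    unfolding bilin_alt lincomb_def sum_distrib_left
    by (intro sum.cong refl) (simp only: ac_simps)
  also have "\<dots> = (\<Sum>j\<in>I. bilin I B x (M j) * y j)"
    unfolding bilin_alt by (subst sum.swap) (simp only: sum_distrib_right)
  finally show ?thesis .
qed

lemma bilin_pull: "bilin I (pull I M B) x y = bilin I B (lincomb I M x) (lincomb I M y)"
proof -
  have "bilin I (pull I M B) x y = (\<Sum>i\<in>I. x i * (\<Sum>j\<in>I. bilin I B (M i) (M j) * y j))"
    unfolding bilin_row pull_def by (intro sum.cong refl arg_cong2[where f = "(*)"]) simp
  then show ?thesis
    by (subst bilin_lincomb_left) (simp only: bilin_lincomb_right)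
qed

lemma lincomb_bij:
  fixes M :: "nat \<Rightarrow> nat \<Rightarrow> 'a::{field,finite}"
  assumes "finite I" "\<And>i. i \<in> I \<Longrightarrow> M i \<in> vec_on I" "inj_on (lincomb I M) (vec_on I)"
  shows "bij_betw (lincomb I M) (vec_on I) (vec_on I)"
  using assms lincomb_in[of I M]
  by (intro bij_betw_imageI endo_inj_surj) auto

lemma half_rank_pull:
  fixes M :: "nat \<Rightarrow> nat \<Rightarrow> 'a::{field,finite}"
  assumes I: "finite I" and M: "\<And>i. i \<in> I \<Longrightarrow> M i \<in> vec_on I"
    and inj: "inj_on (lincomb I M) (vec_on I)"
  shows "half_rank I (pull I M B) = half_rank I B"
proof -
  note bij = lincomb_bij[OF assms]
  have ball: "(\<forall>y\<in>vec_on I. P (lincomb I M y)) \<longleftrightarrow> (\<forall>y\<in>vec_on I. P y)" for P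
    using bij unfolding bij_betw_def by (metis image_iff imageI)
  have "bij_betw (lincomb I M) {x \<in> vec_on I. \<forall>y\<in>vec_on I. bilin I B (lincomb I M x) y = 0}
      {x \<in> vec_on I. \<forall>y\<in>vec_on I. bilin I B x y = 0}"
    using bij unfolding bij_betw_def by (auto simp: inj_on_def)
  then have "card (null_on I (pull I M B)) = card (null_on I B)"
    unfolding null_on_bilin[OF I] bilin_pull ball[of "\<lambda>y. bilin I B (lincomb I M _) y = 0"]
    by (rule bij_betw_same_card)
  then show ?thesis by (simp add: half_rank_def)
qed

text \<open>As the rows of \<open>M\<close> generate everything, the moved matrix determines
  \<open>B\<close> on all pairs of vectors, in particular on unit vectors. Finiteness turns
  injectivity into bijectivity, so \<open>M\<close> never has to be inverted.\<close>

lemma pull_bij: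
  fixes M :: "nat \<Rightarrow> nat \<Rightarrow> 'a::{field,finite}"
  assumes I: "finite I" and M: "\<And>i. i \<in> I \<Longrightarrow> M i \<in> vec_on I"
    and inj: "inj_on (lincomb I M) (vec_on I)"
  shows "bij_betw (pull I M) (alt_on I) (alt_on I)"
proof -
  note bij = lincomb_bij[OF assms]
  have "inj_on (pull I M) (alt_on I)"
  proof (rule inj_onI)
    fix B C :: "nat \<Rightarrow> nat \<Rightarrow> 'a"
    assume B: "B \<in> alt_on I" and C: "C \<in> alt_on I" and eq: "pull I M B = pull I M C"
    have bil: "bilin I B x y = bilin I C x y" if "x \<in> vec_on I" "y \<in> vec_on I" for x y
    proof -
      have "x \<in> lincomb I M ` vec_on I" "y \<in> lincomb I M ` vec_on I"
        using that by (simp_all only: bij_betw_imp_surj_on[OF bij])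
      then obtain x' y' where "x = lincomb I M x'" "y = lincomb I M y'"
        by (elim imageE)
      then show ?thesis
        using bilin_pull[of I M B x' y'] bilin_pull[of I M C x' y'] by (simp add: eq)
    qed
    have "B i j = C i j" if "i \<in> I" "j \<in> I" for i j
      using bil[of "unit_vec i" "unit_vec j"] that by (simp add: bilin_unit_vec[OF I])
    moreover have "B i j = C i j" if "\<not> (i \<in> I \<and> j \<in> I)" for i j
      using that alt_onD(3)[OF B, of i j] alt_onD(4)[OF B, of j i]
        alt_onD(3)[OF C, of i j] alt_onD(4)[OF C, of j i] by auto
    ultimately show "B = C" by blast
  qed
  then show ?thesis
    using pull_alt_on[OF I] I by (intro bij_betw_imageI endo_inj_surj) auto
qed

lemma alt_pairing_commute: "alt_pairing I A B = alt_pairing I B A"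
  by (simp add: alt_pairing_def mult.commute cong: if_cong)

lemma alt_pairing_zero [simp]: "alt_pairing I (\<lambda>_ _. 0) B = 0" "alt_pairing I A (\<lambda>_ _. 0) = 0"
  by (simp_all add: alt_pairing_def cong: if_cong)

lemma alt_pairing_add: "alt_pairing I (\<lambda>i j. A i j + B i j) C = alt_pairing I A C + alt_pairing I B C"
  unfolding alt_pairing_def sum.distrib[symmetric] by (intro sum.cong refl) (simp add: distrib_right)

lemma alt_pairing_scale: "alt_pairing I (\<lambda>i j. c * A i j) C = c * alt_pairing I A C"
  unfolding alt_pairing_def by (simp add: sum_distrib_left mult.assoc if_distrib cong: if_cong)

lemma alt_pairing_diff: "alt_pairing I (\<lambda>i j. A i j - B i j) C = alt_pairing I A C - alt_pairing I B C"
  using alt_pairing_add[of I "\<lambda>i j. A i j - B i j" B C] by simp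

lemma alt_pairing_superset:
  assumes "finite I" "J \<subseteq> I" "A \<in> alt_on J"
  shows "alt_pairing I A B = alt_pairing J A B"
proof -
  have "alt_pairing I A B = (\<Sum>i\<in>J. \<Sum>j\<in>I. if i < j then A i j * B i j else 0)"
    unfolding alt_pairing_def using assms
    by (intro sum.mono_neutral_right) (auto simp: alt_onD(3) intro!: sum.neutral)
  also have "\<dots> = alt_pairing J A B"
    unfolding alt_pairing_def using assms
    by (intro sum.cong refl sum.mono_neutral_right) (auto simp: alt_onD(4))
  finally show ?thesis .
qed

lemma alt_pairing_cong:
  "(\<And>i j. i \<in> I \<Longrightarrow> j \<in> I \<Longrightarrow> B i j = C i j) \<Longrightarrow> alt_pairing I A B = alt_pairing I A C"
  unfolding alt_pairing_def by (intro sum.cong refl) simp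

text \<open>The terms \<open>(i, j)\<close> and \<open>(j, i)\<close> of the bilinear form combine
  into one term of the pairing. This is what turns the rank 2 correction of a Schur complement into
  a value of \<open>B\<close> at two rows of \<open>A\<close>.\<close>

lemma alt_pairing_wedge:
  assumes "finite I" "A \<in> alt_on I"
  shows "alt_pairing I (wedge u w) A = bilin I A u w"
proof -
  have "u i * A i j * w j + u j * A j i * w i = wedge u w i j * A i j" for i j
    by (subst alt_onD(2)[OF assms(2), of j i]) (simp add: wedge_def algebra_simps)
  then show ?thesis
    unfolding bilin_def alt_pairing_def
    by (subst alt_sum_lt[OF assms(1)]) (simp_all add: alt_onD(1)[OF assms(2)] cong: if_cong)
qed

lemma alt_pairing_schur:
  fixes A :: "nat \<Rightarrow> nat \<Rightarrow> 'a::field"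
  assumes I: "finite I" and A: "A \<in> alt_on I" and B: "B \<in> alt_on I" and a: "A p q \<noteq> 0"
  shows "alt_pairing I A B = alt_pairing I (schur p q A) B + bilin I B (A p) (\<lambda>j. A q j / A p q)"
proof -
  have "alt_pairing I A B = alt_pairing I (\<lambda>i j. schur p q A i j + (1 / A p q) * wedge (A p) (A q) i j) B"
    by (simp add: schur_def)
  also have "\<dots> = alt_pairing I (schur p q A) B + (1 / A p q) * bilin I B (A p) (A q)"
    unfolding alt_pairing_add alt_pairing_scale alt_pairing_wedge[OF I B] ..
  also have "(1 / A p q) * bilin I B (A p) (A q) = bilin I B (A p) (\<lambda>j. A q j / A p q)"
    by (simp add: bilin_def sum_distrib_left sum_divide_distrib)
  finally show ?thesis .
qed

text \<open>Moving \<open>B\<close> by the congruence whose rows \<open>p, q\<close> are those of \<open>A\<close> turns the pairing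
  with \<open>A\<close> into the pairing with its Schur complement plus a single coordinate.\<close>

lemma sum_alt_on_schur:
  fixes A :: "nat \<Rightarrow> nat \<Rightarrow> 'a::{field,finite}" and F :: "nat \<Rightarrow> 'a \<Rightarrow> 'b::comm_monoid_add"
  assumes I: "finite I" and A: "A \<in> alt_on I" and a: "A p q \<noteq> 0"
  shows "(\<Sum>B\<in>alt_on I. F (half_rank I B) (alt_pairing I A B))
    = (\<Sum>B\<in>alt_on I. F (half_rank I B) (alt_pairing I (schur p q A) B + B p q))"
proof -
  note pq = alt_on_index[OF A a]
  note split = sum_remove_pair[OF I pq]
  let ?w = "\<lambda>j. A q j / A p q"
  \<comment> \<open>Dividing the second row by the pivot makes the entry \<open>p, q\<close> of the
    moved matrix exactly the correction term of \<open>alt_pairing_schur\<close>, with no scalar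
    left over.\<close>
  define M where "M = unit_vec(p := A p, q := ?w)"
  have M_in: "M i \<in> vec_on I" if "i \<in> I" for i
    using that alt_onD(4)[OF A] by (auto simp: M_def vec_on_def unit_vec_def)
  have Mp: "M p = A p" "M q = ?w" and M_other: "i \<noteq> p \<Longrightarrow> i \<noteq> q \<Longrightarrow> M i = unit_vec i" for i
    using pq by (simp_all add: M_def)
  have lin: "lincomb I M x k = x p * A p k + x q * ?w k + (if k \<in> I - {p, q} then x k else 0)" for x k
  proof -
    have "(\<Sum>i\<in>I - {p, q}. x i * M i k) = (\<Sum>i\<in>I - {p, q}. x i * unit_vec k i)"
      by (intro sum.cong refl) (auto simp: M_other unit_vec_def)
    also have "\<dots> = (if k \<in> I - {p, q} then x k else 0)"
      using I by (intro sum_times_unit_vec) simp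
    finally show ?thesis
      unfolding lincomb_def split[of "\<lambda>i. x i * M i k"] Mp by simp
  qed
  have inj: "inj_on (lincomb I M) (vec_on I)"
  proof (rule inj_onI)
    fix x y assume x: "x \<in> vec_on I" and y: "y \<in> vec_on I" and eq: "lincomb I M x = lincomb I M y"
    \<comment> \<open>Since the diagonal of \<open>A\<close> vanishes, coordinate \<open>q\<close>
      of the image involves only \<open>x p\<close>, and coordinate \<open>p\<close> only
      \<open>x q\<close>.\<close>
    have qp: "A q p = - A p q" by (rule alt_onD(2)[OF A])
    have "x p = y p"
      using fun_cong[OF eq, of q] a alt_onD(1)[OF A] by (simp add: lin)
    moreover have "x q = y q"
      using fun_cong[OF eq, of p] a alt_onD(1)[OF A] by (simp add: lin qp)
    ultimately have "x k = y k" if "k \<in> I - {p, q}" for k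
      using fun_cong[OF eq, of k] that by (simp add: lin)
    then have "x k = y k" for k
      using \<open>x p = y p\<close> \<open>x q = y q\<close> x y by (cases "k \<in> I - {p, q}") (auto simp: vec_on_def)
    then show "x = y" by blast
  qed
  have pair: "alt_pairing I A B = alt_pairing I (schur p q A) (pull I M B) + pull I M B p q"
    if B: "B \<in> alt_on I" for B
  proof -
    \<comment> \<open>The Schur complement is supported off \<open>p\<close> and \<open>q\<close>,
      where the rows of \<open>M\<close> are unit vectors. The entries of \<open>B\<close> that it
      meets are therefore unchanged by the congruence.\<close>
    have "alt_pairing I (schur p q A) (pull I M B) = alt_pairing (I - {p, q}) (schur p q A) (pull I M B)"
      using I schur_alt_on[OF A a] by (intro alt_pairing_superset) auto
    also have "\<dots> = alt_pairing (I - {p, q}) (schur p q A) B"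
      using I by (intro alt_pairing_cong) (simp add: pull_def M_other bilin_unit_vec)
    also have "\<dots> = alt_pairing I (schur p q A) B"
      using I schur_alt_on[OF A a] by (intro alt_pairing_superset[symmetric]) auto
    finally show ?thesis
      using alt_pairing_schur[OF I A B a] pq by (simp add: pull_def Mp)
  qed
  have "(\<Sum>B\<in>alt_on I. F (half_rank I B) (alt_pairing I A B))
      = (\<Sum>B\<in>alt_on I. F (half_rank I (pull I M B)) (alt_pairing I (schur p q A) (pull I M B) + pull I M B p q))"
    by (intro sum.cong refl) (simp add: pair half_rank_pull[OF I M_in inj])
  also have "\<dots> = (\<Sum>B\<in>alt_on I. F (half_rank I B) (alt_pairing I (schur p q A) B + B p q))"
    by (rule sum.reindex_bij_betw[OF pull_bij[OF I M_in inj]])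
  finally show ?thesis .
qed

section \<open>Character sums over alternating matrices\<close>

text \<open>The inverse of passing to the Schur complement: \<open>b\<close> is the pivot,
  \<open>u\<close> and \<open>w\<close> are the remaining parts of rows \<open>p\<close> and
  \<open>q\<close>, and \<open>C\<close> is the complement. The entries \<open>b\<close> and
  \<open>- b\<close> put back the pivot block.\<close>

definition assemble :: "nat \<Rightarrow> nat \<Rightarrow> 'a::field \<Rightarrow> (nat \<Rightarrow> 'a) \<Rightarrow> (nat \<Rightarrow> 'a) \<Rightarrow> (nat \<Rightarrow> nat \<Rightarrow> 'a) \<Rightarrow> nat \<Rightarrow> nat \<Rightarrow> 'a" where
  "assemble p q b u w C i j = C i j + wedge (u(q := b)) (w(p := - b)) i j / b"

lemma assemble_entries:
  assumes "p \<noteq> q" "b \<noteq> 0" "u \<in> vec_on (I - {p, q})" "w \<in> vec_on (I - {p, q})"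
    and "C \<in> alt_on (I - {p, q})"
  shows "assemble p q b u w C p = u(q := b)" "assemble p q b u w C q = w(p := - b)"
    and "assemble p q b u w C p q = b" "schur p q (assemble p q b u w C) = C"
proof -
  have z: "u p = 0" "w q = 0" "C p j = 0" "C q j = 0" for j
    using assms(3,4) alt_onD(3)[OF assms(5)] by (auto simp: vec_on_def)
  show p: "assemble p q b u w C p = u(q := b)" and q: "assemble p q b u w C q = w(p := - b)"
    using assms(1,2) z by (auto simp: assemble_def wedge_def fun_eq_iff)
  show pq: "assemble p q b u w C p q = b"
    unfolding p by simp
  show "schur p q (assemble p q b u w C) = C"
    by (simp add: schur_def p q pq fun_eq_iff) (simp add: assemble_def)
qed

lemma assemble_alt_on:
  assumes "p \<in> I" "q \<in> I" "b \<noteq> 0" "u \<in> vec_on (I - {p, q})" "w \<in> vec_on (I - {p, q})"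
    and C: "C \<in> alt_on (I - {p, q})"
  shows "assemble p q b u w C \<in> alt_on I"
proof -
  have "assemble p q b u w C j i + assemble p q b u w C i j = 0" for i j
  proof -
    have "wedge x y j i = - wedge x y i j" for x y :: "nat \<Rightarrow> 'a"
      by (simp add: wedge_def)
    then show ?thesis
      using alt_onD(2)[OF C, of j i] by (simp add: assemble_def)
  qed
  moreover have "assemble p q b u w C i i = 0" for i
    using alt_onD(1)[OF C] by (simp add: assemble_def wedge_def)
  moreover have "assemble p q b u w C i j = 0" if "i \<notin> I" for i j
  proof -
    have "i \<noteq> p" "i \<noteq> q" using that assms by auto
    then show ?thesis
      using that assms(4,5) alt_onD(3)[OF C, of i] by (simp add: assemble_def wedge_def vec_on_def)
  qed
  ultimately show ?thesis by (simp add: alt_on_def)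
qed

lemma sum_alt_on_nonzero_entry:
  fixes h :: "(nat \<Rightarrow> nat \<Rightarrow> 'a::field) \<Rightarrow> 'b::comm_monoid_add"
  assumes pq: "p \<in> I" "q \<in> I" "p \<noteq> q"
  shows "(\<Sum>B | B \<in> alt_on I \<and> B p q \<noteq> 0. h B)
    = (\<Sum>(b, u, w, C) \<in> (UNIV - {0}) \<times> vec_on (I - {p, q}) \<times> vec_on (I - {p, q}) \<times> alt_on (I - {p, q}).
        h (assemble p q b u w C))"
proof -
  have rebuild: "assemble p q (B p q) ((B p)(q := 0)) ((B q)(p := 0)) (schur p q B) = B"
    if "B \<in> alt_on I" for B :: "nat \<Rightarrow> nat \<Rightarrow> 'a"
  proof -
    have "(B q)(p := - B p q) = B q"
      by (metis alt_onD(2)[OF that] fun_upd_triv)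
    then show ?thesis
      unfolding assemble_def schur_def by simp
  qed
  show ?thesis
  proof (rule sum.reindex_bij_witness[where i = "\<lambda>(b, u, w, C). assemble p q b u w C"
        and j = "\<lambda>B. (B p q, (B p)(q := 0), (B q)(p := 0), schur p q B)"], goal_cases)
    case (1 B)
    then show ?case using rebuild by simp
  next
    case (2 B)
    then have B: "B \<in> alt_on I" "B p q \<noteq> 0" by auto
    then show ?case
      using schur_alt_on[OF B] alt_onD(1)[OF B(1)] alt_onD(4)[OF B(1)] by (auto simp: vec_on_def)
  next
    case (3 t)
    obtain b u w C where t: "t = (b, u, w, C)" by (cases t)
    then have H: "b \<noteq> 0" "u \<in> vec_on (I - {p, q})" "w \<in> vec_on (I - {p, q})" "C \<in> alt_on (I - {p, q})"
      using 3 by auto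
    have "u q = 0" "w p = 0" using H by (auto simp: vec_on_def)
    then show ?case
      unfolding t by (simp add: assemble_entries[OF pq(3) H]) (simp add: fun_upd_idem)
  next
    case (4 t)
    obtain b u w C where t: "t = (b, u, w, C)" by (cases t)
    then have H: "b \<noteq> 0" "u \<in> vec_on (I - {p, q})" "w \<in> vec_on (I - {p, q})" "C \<in> alt_on (I - {p, q})"
      using 4 by auto
    then show ?case
      unfolding t using assemble_alt_on[OF pq(1,2) H] assemble_entries(3)[OF pq(3) H] by simp
  next
    case (5 B)
    then show ?case using rebuild by simp
  qed
qed

text \<open>Values 1 and -1 suffice because the additive group of a field of even order has exponent
  2. They give \<open>\<chi> (x - y) = \<chi> x * \<chi> y\<close>, so sums over pairs of codewords
  become squares without any conjugation.\<close>

locale sign_character =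
  fixes \<chi> :: "'a::{field,finite} \<Rightarrow> real"
  assumes add: "\<chi> (x + y) = \<chi> x * \<chi> y"
    and sign: "\<chi> x = 1 \<or> \<chi> x = - 1"
    and nontrivial: "\<exists>z. \<chi> z \<noteq> 1"
begin

lemma zero [simp]: "\<chi> 0 = 1"
  using add[of 0 0] sign[of 0] by auto

lemma minus [simp]: "\<chi> (- x) = \<chi> x"
  using add[of x "- x"] sign[of x] by auto

lemma diff: "\<chi> (x - y) = \<chi> x * \<chi> y"
  using add[of x "- y"] by simp

text \<open>The permutation \<open>g\<close> multiplies the sum by \<open>\<chi> z\<close>. This one
  argument serves for the field, for vectors and for matrices.\<close>

lemma sum_vanish:
  assumes "bij_betw g S S" "\<And>x. x \<in> S \<Longrightarrow> f (g x) = f x + z" "\<chi> z \<noteq> 1"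
  shows "(\<Sum>x\<in>S. \<chi> (f x)) = 0"
proof -
  have "(\<Sum>x\<in>S. \<chi> (f x)) = (\<Sum>x\<in>S. \<chi> (f (g x)))"
    by (rule sum.reindex_bij_betw[OF assms(1), symmetric])
  also have "\<dots> = (\<Sum>x\<in>S. \<chi> (f x)) * \<chi> z"
    by (simp add: assms(2) add sum_distrib_right)
  finally show ?thesis using assms(3) by simp
qed

lemma sum_UNIV: "(\<Sum>x\<in>UNIV. \<chi> x) = 0"
proof -
  obtain z where "\<chi> z \<noteq> 1" using nontrivial by blast
  moreover have "bij (\<lambda>x. x + z)"
    by (rule bij_betw_byWitness[where f' = "\<lambda>x. x - z"]) auto
  ultimately show ?thesis
    using sum_vanish[of "\<lambda>x. x + z" UNIV "\<lambda>x. x" z] by simp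
qed

lemma sum_nonzero_diff: "(\<Sum>x\<in>UNIV - {0}. \<chi> x - 1) = - real CARD('a)"
proof -
  have "(\<Sum>x\<in>UNIV - {0}. \<chi> x - 1) = (\<Sum>x\<in>UNIV. \<chi> x - 1)"
    by (rule sum.mono_neutral_left) auto
  then show ?thesis by (simp add: sum_subtractf sum_UNIV)
qed

lemma sum_vec_on:
  assumes I: "finite I"
  shows "(\<Sum>y\<in>vec_on I. \<chi> (\<Sum>j\<in>I. u j * y j)) = (if \<forall>j\<in>I. u j = 0 then real CARD('a) ^ card I else 0)"
proof (cases "\<forall>j\<in>I. u j = 0")
  case True
  then show ?thesis by (simp add: card_vec_on[OF I])
next
  case False
  then obtain k where k: "k \<in> I" "u k \<noteq> 0" by blast
  obtain z where z: "\<chi> z \<noteq> 1" using nontrivial by blast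
  define g where "g y = y(k := y k + z / u k)" for y :: "nat \<Rightarrow> 'a"
  have "bij_betw g (vec_on I) (vec_on I)"
    using k by (intro bij_betw_byWitness[where f' = "\<lambda>y. y(k := y k - z / u k)"]) (auto simp: g_def vec_on_def)
  moreover have "(\<Sum>j\<in>I. u j * g y j) = (\<Sum>j\<in>I. u j * y j) + z" for y
  proof -
    have "u j * g y j = u j * y j + z * unit_vec k j" for j
      using k by (simp add: g_def unit_vec_def distrib_left)
    then show ?thesis using k I by (simp add: sum.distrib)
  qed
  ultimately have "(\<Sum>y\<in>vec_on I. \<chi> (\<Sum>j\<in>I. u j * y j)) = 0"
    using z sum_vanish[of g "vec_on I" "\<lambda>y. \<Sum>j\<in>I. u j * y j" z] by blast
  with False show ?thesis by simp
qed

text \<open>For fixed \<open>x\<close> the inner sum runs over the values of a linear functional of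
  \<open>y\<close>, so it vanishes unless \<open>x\<close> lies in the left kernel. The scalar
  \<open>t\<close> does not change that kernel.\<close>

lemma sum_bilin:
  assumes I: "finite I" and t: "t \<noteq> 0"
  shows "(\<Sum>x\<in>vec_on I. \<Sum>y\<in>vec_on I. \<chi> (t * bilin I A x y))
    = real CARD('a) ^ card I * real (card (null_on I A))"
proof -
  have "(\<Sum>y\<in>vec_on I. \<chi> (t * bilin I A x y))
      = (if \<forall>j\<in>I. (\<Sum>i\<in>I. x i * A i j) = 0 then real CARD('a) ^ card I else 0)" for x
  proof -
    have "t * bilin I A x y = (\<Sum>j\<in>I. t * (\<Sum>i\<in>I. x i * A i j) * y j)" for y
      by (subst bilin_alt, subst sum_distrib_left) (simp only: mult.assoc)
    then show ?thesis
      using sum_vec_on[OF I, of "\<lambda>j. t * (\<Sum>i\<in>I. x i * A i j)"] t by simp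
  qed
  then have "(\<Sum>x\<in>vec_on I. \<Sum>y\<in>vec_on I. \<chi> (t * bilin I A x y))
      = (\<Sum>x\<in>null_on I A. real CARD('a) ^ card I)"
    unfolding null_on_def by (simp only: sum.inter_filter[OF finite_vec_on[OF I]])
  then show ?thesis by simp
qed

text \<open>Orthogonality rests on the pairing being nondegenerate: if \<open>B p q\<close> is
  nonzero, the multiple \<open>E\<close> of the elementary alternating matrix at \<open>p, q\<close>
  is scaled to pair with \<open>B\<close> to \<open>z\<close>.\<close>

lemma sum_alt_on:
  assumes I: "finite I" and B: "B \<in> alt_on I"
  shows "(\<Sum>A\<in>alt_on I. \<chi> (alt_pairing I A B))
    = (if B = (\<lambda>_ _. 0) then real (card (alt_on I :: (nat \<Rightarrow> nat \<Rightarrow> 'a) set)) else 0)"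
proof (cases "B = (\<lambda>_ _. 0)")
  case False
  then obtain p q where b: "B p q \<noteq> 0" by (auto simp: fun_eq_iff)
  note pq = alt_on_index[OF B b]
  obtain z where z: "\<chi> z \<noteq> 1" using nontrivial by blast
  define E :: "nat \<Rightarrow> nat \<Rightarrow> 'a" where "E = (\<lambda>i j. z / B p q * wedge (unit_vec p) (unit_vec q) i j)"
  have E: "E \<in> alt_on I"
    using pq by (auto simp: alt_on_def E_def wedge_def unit_vec_def)
  have mE: "(\<lambda>i j. - E i j) \<in> alt_on I"
    using alt_on_diff[OF zero_alt_on E] by simp
  have "bij_betw (\<lambda>A i j. A i j + E i j) (alt_on I) (alt_on I)"
    using alt_on_diff[OF _ E] alt_on_diff[OF _ mE]
    by (intro bij_betw_byWitness[where f' = "\<lambda>A i j. A i j - E i j"]) auto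
  moreover have "alt_pairing I (\<lambda>i j. A i j + E i j) B = alt_pairing I A B + z" for A
    unfolding alt_pairing_add E_def alt_pairing_scale alt_pairing_wedge[OF I B]
    using b pq by (simp add: bilin_unit_vec[OF I])
  ultimately have "(\<Sum>A\<in>alt_on I. \<chi> (alt_pairing I A B)) = 0"
    using z sum_vanish[of "\<lambda>A i j. A i j + E i j" "alt_on I" "\<lambda>A. alt_pairing I A B" z] by blast
  with False show ?thesis by simp
qed simp

text \<open>The two sums differ only where \<open>B p q\<close> is nonzero. There \<open>B\<close>
  is assembled from \<open>(b, u, w, C)\<close>: its half rank exceeds that of \<open>C\<close> by
  one, and pairing with \<open>A\<close> gives the pairing with \<open>C\<close> plus
  \<open>bilin J A u w / b\<close>. Summing over \<open>u\<close> and \<open>w\<close> yields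
  \<open>CARD('a) ^ card J\<close> times the size of the kernel of \<open>A\<close>; summing
  \<open>\<chi> b - 1\<close> over \<open>b\<close> yields \<open>- CARD('a)\<close>. Their product
  is the coefficient in the statement.\<close>

lemma sum_alt_on_shift:
  fixes g :: "nat \<Rightarrow> real"
  assumes I: "finite I" and pq: "p \<in> I" "q \<in> I" "p \<noteq> q" and J: "J = I - {p, q}" and A: "A \<in> alt_on J"
  shows "(\<Sum>B\<in>alt_on I. g (half_rank I B) * \<chi> (alt_pairing I A B + B p q))
    = (\<Sum>B\<in>alt_on I. g (half_rank I B) * \<chi> (alt_pairing I A B))
      - real CARD('a) ^ (2 * card J - 2 * half_rank J A + 1)
        * (\<Sum>C\<in>alt_on J. g (Suc (half_rank J C)) * \<chi> (alt_pairing J A C))"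
proof -
  have JI: "J \<subseteq> I" and finJ: "finite J" using I J by auto
  have AI: "A \<in> alt_on I" using A alt_on_mono[OF JI] by blast
  have Apq: "A p j = 0" "A j p = 0" "A q j = 0" "A j q = 0" for j
    using alt_onD(3,4)[OF A] J by auto
  let ?h = "\<lambda>B. g (half_rank I B) * \<chi> (alt_pairing I A B) * (\<chi> (B p q) - 1)"
  let ?K = "\<lambda>C. g (Suc (half_rank J C)) * \<chi> (alt_pairing J A C)"
  have weight: "?h (assemble p q b u w C) = ?K C * ((\<chi> b - 1) * \<chi> (1 / b * bilin J A u w))"
    if b: "b \<noteq> 0" and u: "u \<in> vec_on J" and w: "w \<in> vec_on J" and C: "C \<in> alt_on J" for b u w C
  proof -
    note e = assemble_entries[OF pq(3) b u[unfolded J] w[unfolded J] C[unfolded J]]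
    note alt = assemble_alt_on[OF pq(1,2) b u[unfolded J] w[unfolded J] C[unfolded J]]
    have "half_rank I (assemble p q b u w C) = Suc (half_rank J C)"
      using half_rank_schur[OF I alt, of p q] b e J by simp
    moreover have "alt_pairing I A (assemble p q b u w C) = alt_pairing J A C + 1 / b * bilin J A u w"
    proof -
      have "alt_pairing I A (assemble p q b u w C)
          = alt_pairing I (\<lambda>i j. C i j + 1 / b * wedge (u(q := b)) (w(p := - b)) i j) A"
        by (subst alt_pairing_commute, rule arg_cong[where f = "\<lambda>B. alt_pairing I B A"])
          (simp add: assemble_def fun_eq_iff)
      also have "\<dots> = alt_pairing I C A + 1 / b * bilin I A (u(q := b)) (w(p := - b))"
        by (simp only: alt_pairing_add alt_pairing_scale alt_pairing_wedge[OF I AI])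
      \<comment> \<open>Rows and columns \<open>p, q\<close> of \<open>A\<close> are zero, so the
        overwritten entries are invisible to \<open>A\<close>.\<close>
      also have "bilin I A (u(q := b)) (w(p := - b)) = bilin J A u w"
      proof -
        have "(\<Sum>j\<in>I. A i j * (w(p := - b)) j) = (\<Sum>j\<in>J. A i j * w j)" for i
          using pq by (simp add: sum_remove_pair[OF I pq] Apq J) 
        then show ?thesis
          unfolding bilin_row using pq by (simp add: sum_remove_pair[OF I pq] Apq J)
      qed
      also have "alt_pairing I C A = alt_pairing J A C"
        using alt_pairing_superset[OF I JI C] by (simp add: alt_pairing_commute)
      finally show ?thesis .
    qed
    ultimately show ?thesis
      by (simp add: e(3) add)
  qed
  have "(\<Sum>B\<in>alt_on I. ?h B) = (\<Sum>B | B \<in> alt_on I \<and> B p q \<noteq> 0. ?h B)"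
    using I by (intro sum.mono_neutral_right) auto
  also have "\<dots> = (\<Sum>(b, u, w, C) \<in> (UNIV - {0}) \<times> vec_on J \<times> vec_on J \<times> alt_on J.
      ?K C * ((\<chi> b - 1) * \<chi> (1 / b * bilin J A u w)))"
    unfolding sum_alt_on_nonzero_entry[OF pq] J[symmetric]
    by (intro sum.cong refl) (simp add: weight split_beta mem_Times_iff)
  also have "\<dots> = (\<Sum>b\<in>UNIV - {0}. (\<chi> b - 1) * (\<Sum>C\<in>alt_on J. ?K C)
      * (\<Sum>u\<in>vec_on J. \<Sum>w\<in>vec_on J. \<chi> (1 / b * bilin J A u w)))"
    unfolding sum.cartesian_product[symmetric] sum_distrib_right[symmetric] sum_distrib_left[symmetric]
    by (subst sum_distrib_left) (intro sum.cong refl, simp only: ac_simps)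
  also have "\<dots> = (\<Sum>b\<in>UNIV - {0}. (\<chi> b - 1) * (\<Sum>C\<in>alt_on J. ?K C)
      * (real CARD('a) ^ card J * real (card (null_on J A))))"
    by (intro sum.cong refl, subst sum_bilin[OF finJ]) simp_all
  also have "\<dots> = (\<Sum>b\<in>UNIV - {0}. \<chi> b - 1) * ((\<Sum>C\<in>alt_on J. ?K C)
      * (real CARD('a) ^ card J * real (card (null_on J A))))"
    by (simp only: sum_distrib_right mult.assoc)
  also have "\<dots> = - (real CARD('a) ^ (2 * card J - 2 * half_rank J A + 1) * (\<Sum>C\<in>alt_on J. ?K C))"
  proof -
    have "2 * card J - 2 * half_rank J A + 1 = Suc (card J + (card J - 2 * half_rank J A))"
      using half_rank(1)[OF finJ A] by simp
    then show ?thesis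
      by (simp add: sum_nonzero_diff half_rank(2)[OF finJ A] power_add)
  qed
  finally show ?thesis
    by (simp add: add algebra_simps sum_subtractf)
qed

lemma sum_alt_on_recursion:
  fixes g :: "nat \<Rightarrow> real"
  assumes I: "finite I" and A: "A \<in> alt_on I" and a: "A p q \<noteq> 0"
  defines "J \<equiv> I - {p, q}" and "A' \<equiv> schur p q A"
  shows "(\<Sum>B\<in>alt_on I. g (half_rank I B) * \<chi> (alt_pairing I A B))
    = (\<Sum>B\<in>alt_on I. g (half_rank I B) * \<chi> (alt_pairing I A' B))
      - real CARD('a) ^ (2 * card J - 2 * half_rank J A' + 1)
        * (\<Sum>C\<in>alt_on J. g (Suc (half_rank J C)) * \<chi> (alt_pairing J A' C))"
  using sum_alt_on_schur[OF I A a, of "\<lambda>r v. g r * \<chi> v"]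
    sum_alt_on_shift[OF I alt_on_index[OF A a] refl schur_alt_on[OF A a], of g]
  by (simp add: J_def A'_def)

text \<open>The recursion determines the transform up to its value at \<open>0\<close>; that value follows
  by summing over all \<open>A\<close> for the parameters \<open>j\<close> and \<open>n - j\<close>, which exchanges the two
  unknown values.\<close>

theorem qbinom_transform:
  fixes A :: "nat \<Rightarrow> nat \<Rightarrow> 'a"
  assumes "finite I" "A \<in> alt_on I" "j \<le> card I div 2"
  shows "(\<Sum>B\<in>alt_on I. qbinom (real CARD('a) ^ 2) (card I div 2 - half_rank I B) (card I div 2 - j)
        * \<chi> (alt_pairing I A B))
    = real CARD('a) ^ ((2 * card I - 2 * (card I div 2) - 1) * j)
        * qbinom (real CARD('a) ^ 2) (card I div 2 - half_rank I A) j"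
  using assms
proof (induction "card I" arbitrary: I A j rule: less_induct)
  case less
  note I = less.prems(1)
  define n where "n = card I div 2"
  define e where "e = 2 * card I - 2 * n - 1"
  let ?q = "real CARD('a)"
  define Q where "Q = ?q ^ 2"
  define c where "c = ?q ^ e"
  define S where "S k A = (\<Sum>B\<in>alt_on I. qbinom Q (n - half_rank I B) (n - k) * \<chi> (alt_pairing I A B))"
    for k and A :: "nat \<Rightarrow> nat \<Rightarrow> 'a"
  have q: "?q > 1" using CARD_field_gt_1[where 'a = 'a] by simp
  have Q: "Q > 1" unfolding Q_def using q by (intro one_less_power) auto
  have hr_le: "half_rank I B \<le> n" if "B \<in> alt_on I" for B :: "nat \<Rightarrow> nat \<Rightarrow> 'a"
    using half_rank(1)[OF I that] by (simp add: n_def)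
  \<comment> \<open>For \<open>k = 0\<close> the weight is the indicator of the zero matrix.\<close>
  have S0: "S 0 A = 1" if "A \<in> alt_on I" for A
  proof -
    have single: "qbinom Q (n - half_rank I B) n = (if B = (\<lambda>_ _. 0) then 1 else 0)" if "B \<in> alt_on I" for B :: "nat \<Rightarrow> nat \<Rightarrow> 'a"
      using half_rank_eq_0_iff[OF I that] hr_le[OF that] I Q
      by (auto simp: qbinom_eq_0)
    have "S 0 A = (\<Sum>B\<in>(alt_on I :: (nat \<Rightarrow> nat \<Rightarrow> 'a) set). if B = (\<lambda>_ _. 0) then 1 else 0)"
      unfolding S_def by (intro sum.cong refl) (simp add: single)
    then show ?thesis using I by (simp add: sum.delta)
  qed
  \<comment> \<open>The inner induction is on the half rank of \<open>A\<close> with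
    \<open>I\<close> fixed. Each Schur step invokes the outer hypothesis on
    \<open>I - {p, q}\<close>, where \<open>n\<close> and \<open>k\<close> both drop by one; this is
    why \<open>k = 0\<close> is treated apart.\<close>
  have rec: "S k A = S k (\<lambda>_ _. 0) - c ^ k * (qbinom Q n k - qbinom Q (n - half_rank I A) k)"
    if "A \<in> alt_on I" "k \<le> n" for A k
    using that
  proof (induction "half_rank I A" arbitrary: A)
    case 0
    then have "A = (\<lambda>_ _. 0)" using half_rank_eq_0_iff[OF I 0(2)] by simp
    then show ?case using I by simp
  next
    case (Suc r)
    show ?case
    proof (cases k)
      case 0
      then show ?thesis using S0 Suc.prems Q by simp
    next
      case (Suc k')
      obtain p q where a: "A p q \<noteq> 0"
        using half_rank_eq_0_iff[OF I Suc.prems(1)] \<open>Suc r = half_rank I A\<close> by (metis nat.distinct(1))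
      define J where "J = I - {p, q}"
      define A' where "A' = schur p q A"
      have A'J: "A' \<in> alt_on J" using schur_alt_on[OF Suc.prems(1) a] by (simp add: J_def A'_def)
      have J: "finite J" "J \<subseteq> I" using I by (auto simp: J_def)
      have A'I: "A' \<in> alt_on I" using A'J alt_on_mono[OF J(2)] by blast
      have cI: "card I = Suc (Suc (card J))"
        using card_remove_pair[OF I alt_on_index[OF Suc.prems(1) a]] by (simp add: J_def)
      then have n: "n = Suc (card J div 2)" by (simp add: n_def)
      have r: "half_rank J A' = r"
        using half_rank_schur[OF I Suc.prems(1) a] Suc.hyps(2) by (simp add: J_def A'_def)
      then have rI: "half_rank I A' = r" using half_rank_superset[OF I J(2) A'J] by simp
      have rn: "r < n" using hr_le[OF Suc.prems(1)] Suc.hyps(2) by simp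
      have k'n: "k' \<le> card J div 2" using \<open>k \<le> n\<close> Suc n by simp
      have IH: "(\<Sum>C\<in>alt_on J. qbinom Q (n - Suc (half_rank J C)) (n - k) * \<chi> (alt_pairing J A' C))
          = ?q ^ ((2 * card J - 2 * (card J div 2) - 1) * k') * qbinom Q (n - Suc r) k'"
        using less.hyps[OF _ J(1) A'J k'n] cI by (simp add: n Suc r Q_def)
      have "S k A = S k A' - ?q ^ (2 * card J - 2 * r + 1)
          * (?q ^ ((2 * card J - 2 * (card J div 2) - 1) * k') * qbinom Q (n - Suc r) k')"
        using sum_alt_on_recursion[OF I Suc.prems(1) a, of "\<lambda>i. qbinom Q (n - i) (n - k)"]
        unfolding S_def J_def[symmetric] A'_def[symmetric] r IH .
      also have "S k A' = S k (\<lambda>_ _. 0) - c ^ k * (qbinom Q n k - qbinom Q (n - r) k)"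
        using Suc.hyps(1)[OF rI[symmetric] A'I \<open>k \<le> n\<close>] by (simp add: rI)
      also have "?q ^ (2 * card J - 2 * r + 1) * (?q ^ ((2 * card J - 2 * (card J div 2) - 1) * k') * qbinom Q (n - Suc r) k')
          = c ^ k * (qbinom Q (n - r) k - qbinom Q (n - Suc r) k)"
      proof (cases "k' \<le> n - Suc r")
        case True
        \<comment> \<open>Pascal's rule identifies the correction term with the difference of two
          consecutive claimed values; only the exponents of \<open>q\<close> remain to be
          matched.\<close>
        have pascal: "qbinom Q (n - r) k = qbinom Q (n - Suc r) k + Q ^ (n - Suc r - k') * qbinom Q (n - Suc r) k'"
          using qbinom_Suc[OF Q True] rn by (simp add: Suc Suc_diff_Suc)
        have expo: "2 * card J - 2 * r + 1 + (2 * card J - 2 * (card J div 2) - 1) * k'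
            = e * k + 2 * (n - Suc r - k')"
        proof -
          define t u X where "t = card J div 2" and "u = card J mod 2" and "X = 2 * card J - 2 * t - 1"
          have u: "card J = 2 * t + u" by (simp add: t_def u_def)
          have nt: "n = Suc t" using n by (simp add: t_def)
          have e: "e = 2 * t + 2 * u + 1" using cI nt u by (simp add: e_def)
          \<comment> \<open>Going from \<open>J\<close> to \<open>I\<close> raises the exponent by
            2. For empty \<open>J\<close> the subtraction in \<open>X\<close> is cut off at 0 and
            \<open>X + 2 = e\<close> fails, but then \<open>k' = 0\<close>.\<close>
          have "X * k' + 2 * k' = e * k'"
          proof (cases "k' = 0")
            case False
            then have "t > 0" using True nt by simp
            then have "X + 2 = e" using u e by (simp add: X_def)
            then show ?thesis by (simp flip: add_mult_distrib)
          qed simp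
          moreover have "2 * card J - 2 * r + 1 = e + 2 * (n - Suc r)"
            using u e nt rn by simp
          moreover have "2 * (n - Suc r) = 2 * (n - Suc r - k') + 2 * k'"
            using True by simp
          moreover have "e * k = e * k' + e" by (simp add: Suc)
          ultimately show ?thesis unfolding t_def[symmetric] X_def[symmetric] by linarith
        qed
        show ?thesis
          unfolding pascal mult.assoc[symmetric] power_add[symmetric] expo c_def add_diff_cancel_left'
          unfolding power_add power_mult Q_def by (simp only: mult.assoc)
      next
        case False
        then have "n - r < k" using Suc by simp
        with False show ?thesis by (simp add: qbinom_eq_0)
      qed
      finally show ?thesis
        using Suc.hyps(2) by (simp add: algebra_simps)
    qed
  qed
  define K where "K = real (card (alt_on I :: (nat \<Rightarrow> nat \<Rightarrow> 'a) set))"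
  have tot: "(\<Sum>A\<in>alt_on I. S k A) = K * qbinom Q n k" if "k \<le> n" for k
  proof -
    have "(\<Sum>A\<in>alt_on I. S k A) = (\<Sum>B\<in>alt_on I. qbinom Q (n - half_rank I B) (n - k) *
        (\<Sum>A\<in>alt_on I. \<chi> (alt_pairing I A B)))"
      unfolding S_def by (subst sum.swap) (simp add: sum_distrib_left)
    also have "\<dots> = (\<Sum>B\<in>(alt_on I :: (nat \<Rightarrow> nat \<Rightarrow> 'a) set). if B = (\<lambda>_ _. 0) then qbinom Q n (n - k) * K else 0)"
      using I by (intro sum.cong refl) (simp add: sum_alt_on[OF I] K_def)
    also have "\<dots> = K * qbinom Q n k"
      using I qbinom_symmetric[OF that] by (simp add: sum.delta mult.commute)
    finally show ?thesis .
  qed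
  have S_zero: "S k (\<lambda>_ _. 0) = c ^ k * qbinom Q n k" if k: "k \<le> n" for k
  proof (cases "n = 0")
    case True
    then show ?thesis using k S0[OF zero_alt_on] Q by simp
  next
    case False
    then have "card I \<ge> 2" by (simp add: n_def)
    then obtain T where "T \<subseteq> I" "card T = 2" by (meson obtain_subset_with_card_n)
    then obtain p q where pq: "p \<in> I" "q \<in> I" "p \<noteq> q" by (auto simp: card_2_iff)
    \<comment> \<open>Any nonzero matrix serves here. For \<open>k = n\<close> the weight is
      constantly 1, so orthogonality gives the value 0 at \<open>E\<close> and \<open>K\<close> at
      the zero matrix; comparison with \<open>rec\<close> yields \<open>K = c ^ n\<close>.\<close>
    define E :: "nat \<Rightarrow> nat \<Rightarrow> 'a" where "E = wedge (unit_vec p) (unit_vec q)"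
    have E: "E \<in> alt_on I" "E \<noteq> (\<lambda>_ _. 0)"
      using pq by (auto simp: alt_on_def E_def wedge_def unit_vec_def fun_eq_iff)
    have "half_rank I E > 0" using half_rank_eq_0_iff[OF I E(1)] E(2) by simp
    have "S n A = (\<Sum>B\<in>alt_on I. \<chi> (alt_pairing I B A))" for A
      using Q by (simp add: S_def alt_pairing_commute)
    then have "S n E = 0" "S n (\<lambda>_ _. 0) = K"
      using sum_alt_on[OF I] E by (simp_all add: K_def)
    moreover have "S n E = S n (\<lambda>_ _. 0) - c ^ n"
      using rec[OF E(1) order_refl] \<open>half_rank I E > 0\<close> False Q by (simp add: qbinom_eq_0)
    ultimately have K: "K = c ^ n" by simp
    \<comment> \<open>\<open>y k\<close> is the error of the claimed value at the zero matrix, and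
      by \<open>rec\<close> the same error occurs at every \<open>A\<close>. Computing the total of
      \<open>S k\<close> over all \<open>A\<close> in two ways links \<open>y k\<close> to
      \<open>y (n - k)\<close>.\<close>
    define y where "y k = S k (\<lambda>_ _. 0) - c ^ k * qbinom Q n k" for k
    have dual: "K * y k + c ^ k * y (n - k) = 0" if k: "k \<le> n" for k
    proof -
      have "(\<Sum>A\<in>alt_on I. S k A) = (\<Sum>A\<in>(alt_on I :: (nat \<Rightarrow> nat \<Rightarrow> 'a) set). y k + c ^ k * qbinom Q (n - half_rank I A) k)"
        using k by (intro sum.cong refl) (subst rec, simp_all add: y_def algebra_simps)
      also have "\<dots> = K * y k + c ^ k * S (n - k) (\<lambda>_ _. 0)"
        using k by (simp add: sum.distrib K_def S_def sum_distrib_left)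
      finally have "K * qbinom Q n k = K * y k + c ^ k * S (n - k) (\<lambda>_ _. 0)"
        using tot[OF k] by simp
      moreover have "c ^ k * (c ^ (n - k) * qbinom Q n (n - k)) = K * qbinom Q n k"
        using k by (simp add: K qbinom_symmetric mult.assoc[symmetric] power_add[symmetric])
      ultimately show ?thesis by (simp add: y_def algebra_simps)
    qed
    have c1: "c > 1"
      unfolding c_def using q False by (intro one_less_power) (auto simp: e_def n_def)
    have PR: "c ^ k * c ^ (n - k) = K" using k by (simp add: K power_add[symmetric])
    have "c ^ k * (K * y (n - k) + c ^ (n - k) * y k) = c ^ k * K * y (n - k) + c ^ k * c ^ (n - k) * y k"
      by (simp only: distrib_left mult.assoc)
    then have eq: "c ^ k * K * y (n - k) + K * y k = 0"
      using dual[of "n - k"] k unfolding PR by simp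
    \<comment> \<open>Eliminating \<open>y k\<close> from the relations for \<open>k\<close> and
      \<open>n - k\<close> leaves \<open>y (n - k)\<close> with a coefficient that is nonzero
      because \<open>K > 1\<close>.\<close>
    have "(K - 1) * (c ^ k * y (n - k))
        = (c ^ k * K * y (n - k) + K * y k) - (K * y k + c ^ k * y (n - k))"
      by (simp only: algebra_simps)
    moreover have "K > 1" unfolding K using c1 False by (intro one_less_power) auto
    ultimately have zero': "c ^ k * y (n - k) = 0"
      unfolding eq dual[OF k] by simp
    have "K * y k = 0"
      using dual[OF k] by (simp only: zero' add_0_right)
    then show ?thesis using \<open>K > 1\<close> by (simp add: y_def)
  qed
  have "S j A = c ^ j * qbinom Q (n - half_rank I A) j"
    using rec[OF less.prems(2)] S_zero less.prems(3) by (simp add: n_def algebra_simps)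
  then show ?case
    by (simp add: S_def Q_def n_def c_def e_def power_mult)
qed

text \<open>Apply \<open>qbinom_transform\<close> to each difference \<open>f y - f y'\<close>; the
  character splits into a product, and the sum over pairs becomes a square. The weights on the right
  are nonnegative, which is what makes linear programming possible. Summing over indices
  \<open>y\<close> instead of matrices spares any injectivity of \<open>f\<close>.\<close>

lemma qbinom_moment_expansion:
  fixes f :: "'y \<Rightarrow> nat \<Rightarrow> nat \<Rightarrow> 'a" and I :: "nat set"
  defines "n \<equiv> card I div 2" and "Q \<equiv> real CARD('a) ^ 2"
    and "c \<equiv> real CARD('a) ^ (2 * card I - 2 * (card I div 2) - 1)"
  assumes I: "finite I" and f: "\<And>y. y \<in> Y \<Longrightarrow> f y \<in> alt_on I" and j: "j \<le> n"
  shows "c ^ j * (\<Sum>y\<in>Y. \<Sum>y'\<in>Y. qbinom Q (n - half_rank I (\<lambda>i j. f y i j - f y' i j)) j)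
    = (\<Sum>B\<in>alt_on I. qbinom Q (n - half_rank I B) (n - j) * (\<Sum>y\<in>Y. \<chi> (alt_pairing I (f y) B))\<^sup>2)"
proof -
  have "c ^ j * qbinom Q (n - half_rank I (\<lambda>i j. f y i j - f y' i j)) j
      = (\<Sum>B\<in>alt_on I. qbinom Q (n - half_rank I B) (n - j)
          * (\<chi> (alt_pairing I (f y) B) * \<chi> (alt_pairing I (f y') B)))"
    if "y \<in> Y" "y' \<in> Y" for y y'
    using qbinom_transform[OF I alt_on_diff[OF f[OF that(1)] f[OF that(2)]], of j] j
    by (simp add: alt_pairing_diff diff n_def Q_def c_def power_mult)
  then have "c ^ j * (\<Sum>y\<in>Y. \<Sum>y'\<in>Y. qbinom Q (n - half_rank I (\<lambda>i j. f y i j - f y' i j)) j)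
      = (\<Sum>y\<in>Y. \<Sum>y'\<in>Y. \<Sum>B\<in>alt_on I. qbinom Q (n - half_rank I B) (n - j)
          * (\<chi> (alt_pairing I (f y) B) * \<chi> (alt_pairing I (f y') B)))"
    by (simp add: sum_distrib_left)
  also have "\<dots> = (\<Sum>y\<in>Y. \<Sum>B\<in>alt_on I. \<Sum>y'\<in>Y. qbinom Q (n - half_rank I B) (n - j)
          * (\<chi> (alt_pairing I (f y) B) * \<chi> (alt_pairing I (f y') B)))"
    by (intro sum.cong refl sum.swap)
  also have "\<dots> = (\<Sum>B\<in>alt_on I. \<Sum>y\<in>Y. \<Sum>y'\<in>Y. qbinom Q (n - half_rank I B) (n - j)
          * (\<chi> (alt_pairing I (f y) B) * \<chi> (alt_pairing I (f y') B)))"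
    by (rule sum.swap)
  also have "\<dots> = (\<Sum>B\<in>alt_on I. qbinom Q (n - half_rank I B) (n - j) * (\<Sum>y\<in>Y. \<chi> (alt_pairing I (f y) B))\<^sup>2)"
    unfolding power2_eq_square sum_product by (simp only: sum_distrib_left)
  finally show ?thesis .
qed

text \<open>Equality in the linear programming bound forces the character sums of \<open>f\<close> to vanish
  at every nonzero \<open>B\<close> of half rank at most \<open>n - \<delta> + 1\<close>.\<close>

theorem optimal_code_moments:
  fixes f :: "'y \<Rightarrow> nat \<Rightarrow> nat \<Rightarrow> 'a" and I :: "nat set"
  defines "n \<equiv> card I div 2" and "Q \<equiv> real CARD('a) ^ 2"
    and "c \<equiv> real CARD('a) ^ (2 * card I - 2 * (card I div 2) - 1)"
  assumes I: "finite I" and f: "\<And>y. y \<in> Y \<Longrightarrow> f y \<in> alt_on I"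
    and \<delta>: "1 \<le> \<delta>" "\<delta> \<le> n"
    and code: "\<And>y y'. y \<in> Y \<Longrightarrow> y' \<in> Y \<Longrightarrow> y \<noteq> y' \<Longrightarrow> \<delta> \<le> half_rank I (\<lambda>i j. f y i j - f y' i j)"
    and size: "real (card Y) = c ^ (n - \<delta> + 1)"
    and j: "j \<le> n"
  shows "(\<Sum>y\<in>Y. \<Sum>y'\<in>Y. qbinom Q (n - half_rank I (\<lambda>i j. f y i j - f y' i j)) j)
    = real (card Y) * (qbinom Q n j * c ^ (n - \<delta> + 1 - j))"
proof -
  define D where "D y y' = half_rank I (\<lambda>i j. f y i j - f y' i j)" for y y'
  define w where "w B = (\<Sum>y\<in>Y. \<chi> (alt_pairing I (f y) B))" for B
  define k where "k = n - \<delta> + 1"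
  have k: "k \<le> n" using \<delta> by (simp add: k_def)
  have q: "real CARD('a) > 1" using CARD_field_gt_1[where 'a = 'a] by simp
  have Q: "Q > 1" unfolding Q_def using q by (intro one_less_power) auto
  have c: "c > 0" unfolding c_def using q by simp
  have finY: "finite Y" using size c by (metis card.infinite of_nat_0 less_irrefl zero_less_power)
  have D_self: "D y y = 0" for y using I by (simp add: D_def)
  \<comment> \<open>Distinct codewords satisfy \<open>n - D y y' \<le> n - \<delta> < k\<close>, so
    from \<open>i = k\<close> on only the diagonal pairs contribute.\<close>
  have top: "(\<Sum>y\<in>Y. \<Sum>y'\<in>Y. qbinom Q (n - D y y') i) = real (card Y) * qbinom Q n i" if i: "k \<le> i" for i
  proof -
    have "qbinom Q (n - D y y') i = (if y' = y then qbinom Q n i else 0)" if "y \<in> Y" "y' \<in> Y" for y y'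
      using code[OF that] i \<delta> D_self by (auto simp: D_def[symmetric] k_def intro!: qbinom_eq_0)
    then have "(\<Sum>y\<in>Y. \<Sum>y'\<in>Y. qbinom Q (n - D y y') i) = (\<Sum>y\<in>Y. \<Sum>y'\<in>Y. if y' = y then qbinom Q n i else 0)"
      by (intro sum.cong refl) auto
    then show ?thesis using finY by simp
  qed
  have exp: "c ^ i * (\<Sum>y\<in>Y. \<Sum>y'\<in>Y. qbinom Q (n - D y y') i)
      = qbinom Q n i * real (card Y) ^ 2
        + (\<Sum>B\<in>alt_on I - {\<lambda>_ _. 0}. qbinom Q (n - half_rank I B) (n - i) * (w B)\<^sup>2)"
    if i: "i \<le> n" for i
  proof -
    have "w (\<lambda>_ _. 0) = real (card Y)" by (simp add: w_def)
    moreover have "qbinom Q n (n - i) = qbinom Q n i" by (rule qbinom_symmetric[OF i])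
    ultimately show ?thesis
      using qbinom_moment_expansion[OF I f, where j = i] i I
      by (simp add: D_def w_def n_def Q_def c_def sum.remove[of "alt_on I" "\<lambda>_ _. 0"])
  qed
  \<comment> \<open>At \<open>i = k\<close> the left side of \<open>exp\<close> is
    \<open>c ^ k * (card Y * qbinom Q n k)\<close>, and \<open>c ^ k = card Y\<close> makes it equal
    to the contribution of the zero matrix. The remaining nonnegative terms therefore add up to
    0.\<close>
  have vanish: "qbinom Q (n - half_rank I B) (n - k) * (w B)\<^sup>2 = 0" if "B \<in> alt_on I - {\<lambda>_ _. 0}" for B
  proof -
    have "(\<Sum>B\<in>alt_on I - {\<lambda>_ _. 0}. qbinom Q (n - half_rank I B) (n - k) * (w B)\<^sup>2) = 0"
      using exp[OF k] top[of k] size by (simp add: k_def power2_eq_square)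
    then show ?thesis
      using that I Q by (subst (asm) sum_nonneg_eq_0_iff) (auto simp: qbinom_nonneg)
  qed
  show ?thesis
  proof (cases "j \<le> k")
    case False
    then show ?thesis using top[of j] by (simp add: D_def k_def)
  next
    case True
    \<comment> \<open>A nonzero weight at \<open>j\<close> requires half rank at most
      \<open>j\<close>, hence at most \<open>k\<close>. There the weight at \<open>k\<close> is
      positive, so \<open>vanish\<close> forces \<open>w B = 0\<close>.\<close>
    have "qbinom Q (n - half_rank I B) (n - j) * (w B)\<^sup>2 = 0" if "B \<in> alt_on I - {\<lambda>_ _. 0}" for B
    proof (cases "half_rank I B \<le> j")
      case hr: True
      then have "qbinom Q (n - half_rank I B) (n - k) > 0"
        using True by (intro qbinom_pos[OF Q]) simp
      then show ?thesis using vanish[OF that] by simp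
    next
      case False
      moreover have "half_rank I B \<le> n" using half_rank(1)[OF I, of B] that by (simp add: n_def)
      ultimately have "n - half_rank I B < n - j" by linarith
      then show ?thesis by (simp add: qbinom_eq_0)
    qed
    then have "c ^ j * (\<Sum>y\<in>Y. \<Sum>y'\<in>Y. qbinom Q (n - D y y') j) = qbinom Q n j * real (card Y) ^ 2"
      unfolding exp[OF j] by (simp add: sum.neutral)
    also have "\<dots> = qbinom Q n j * (real (card Y) * (c ^ j * c ^ (k - j)))"
      using True size by (simp only: power2_eq_square power_add[symmetric] k_def le_add_diff_inverse)
    also have "\<dots> = c ^ j * (real (card Y) * (qbinom Q n j * c ^ (k - j)))"
      by (simp only: mult_ac)
    finally show ?thesis using c by (simp add: D_def k_def)
  qed
qed

theorem optimal_code_distance_distribution: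
  fixes f :: "'y \<Rightarrow> nat \<Rightarrow> nat \<Rightarrow> 'a" and I :: "nat set"
  defines "n \<equiv> card I div 2" and "Q \<equiv> real CARD('a) ^ 2"
    and "c \<equiv> real CARD('a) ^ (2 * card I - 2 * (card I div 2) - 1)"
  assumes I: "finite I" and f: "\<And>y. y \<in> Y \<Longrightarrow> f y \<in> alt_on I"
    and \<delta>: "1 \<le> \<delta>" "\<delta> \<le> n"
    and code: "\<And>y y'. y \<in> Y \<Longrightarrow> y' \<in> Y \<Longrightarrow> y \<noteq> y' \<Longrightarrow> \<delta> \<le> half_rank I (\<lambda>i j. f y i j - f y' i j)"
    and size: "real (card Y) = c ^ (n - \<delta> + 1)"
    and s: "0 < s"
  shows "real (card {(y, y'). y \<in> Y \<and> y' \<in> Y \<and> half_rank I (\<lambda>i j. f y i j - f y' i j) = s}) / real (card Y)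
    = qbinom Q n s * (\<Sum>l | l + \<delta> \<le> s. (-1) ^ l * real CARD('a) ^ (l * (l - 1)) * qbinom Q s l * (c ^ (s - \<delta> - l + 1) - 1))"
proof -
  define D where "D y y' = half_rank I (\<lambda>i j. f y i j - f y' i j)" for y y'
  define N where "N i = card {(y, y'). y \<in> Y \<and> y' \<in> Y \<and> D y y' = i}" for i
  define a where "a i = real (N i) / real (card Y)" for i
  have q: "real CARD('a) > 1" using CARD_field_gt_1[where 'a = 'a] by simp
  have Q: "Q > 1" unfolding Q_def using q by (intro one_less_power) auto
  have c: "c > 0" unfolding c_def using q by simp
  have finY: "finite Y" using size c by (metis card.infinite of_nat_0 less_irrefl zero_less_power)
  have Ypos: "real (card Y) > 0" unfolding size using c by simp
  have D_le: "D y y' \<le> n" if "y \<in> Y" "y' \<in> Y" for y y'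
    using half_rank(1)[OF I alt_on_diff[OF f[OF that(1)] f[OF that(2)]]] by (simp add: D_def n_def)
  have N_set: "{(y, y'). y \<in> Y \<and> y' \<in> Y \<and> D y y' = i} = {t \<in> Y \<times> Y. D (fst t) (snd t) = i}" for i
    by auto
  have moments: "(\<Sum>i\<le>n. a i * qbinom Q (n - i) j) = qbinom Q n j * c ^ (n - \<delta> + 1 - j)" if j: "j \<le> n" for j
  proof -
    have "(\<Sum>i\<le>n. real (N i) * qbinom Q (n - i) j)
        = (\<Sum>i\<le>n. \<Sum>t \<in> {t \<in> Y \<times> Y. D (fst t) (snd t) = i}. qbinom Q (n - D (fst t) (snd t)) j)"
      by (intro sum.cong refl) (simp add: N_def N_set)
    also have "\<dots> = (\<Sum>t\<in>Y \<times> Y. qbinom Q (n - D (fst t) (snd t)) j)"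
      using finY D_le by (intro sum.group) auto
    also have "\<dots> = (\<Sum>y\<in>Y. \<Sum>y'\<in>Y. qbinom Q (n - D y y') j)"
      by (simp add: sum.cartesian_product split_beta)
    also have "\<dots> = real (card Y) * (qbinom Q n j * c ^ (n - \<delta> + 1 - j))"
      unfolding D_def n_def Q_def c_def
      by (rule optimal_code_moments) (use assms j in \<open>auto simp: n_def Q_def c_def\<close>)
    finally show ?thesis
      using Ypos by (simp add: a_def sum_divide_distrib[symmetric] field_simps)
  qed
  have "a s = qbinom Q n s * (\<Sum>l | l + \<delta> \<le> s. (-1) ^ l * real CARD('a) ^ (l * (l - 1)) * qbinom Q s l * (c ^ (s - \<delta> - l + 1) - 1))"
  proof (cases "s \<le> n")
    case False
    then have "{(y, y'). y \<in> Y \<and> y' \<in> Y \<and> D y y' = s} = {}"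
      using D_le by force
    then have "N s = 0" by (simp only: N_def card.empty)
    then show ?thesis using False by (simp add: a_def qbinom_eq_0)
  next
    case True
    define v where "v l = (-1) ^ l * Q ^ (l * (l - 1) div 2) * qbinom Q s l" for l :: nat
    have even: "Q ^ (l * (l - 1) div 2) = real CARD('a) ^ (l * (l - 1))" for l :: nat
    proof -
      have "2 dvd l * (l - 1)" by (cases l) simp_all
      then show ?thesis
        unfolding Q_def power_mult[symmetric] by (simp only: dvd_mult_div_cancel)
    qed
    have "a s = (\<Sum>l\<le>s. (-1) ^ l * Q ^ (l * (l - 1) div 2) * qbinom Q (n - s + l) l
        * (qbinom Q n (n - s + l) * c ^ (n - \<delta> + 1 - (n - s + l))))"
      by (rule qbinom_moment_inversion[OF Q True]) (rule moments)
    also have "\<dots> = (\<Sum>l\<le>s. qbinom Q n s * (v l * c ^ (s + 1 - (\<delta> + l))))"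
    proof (intro sum.cong refl)
      fix l assume "l \<in> {..s}"
      then have "qbinom Q (n - s + l) l * qbinom Q n (n - s + l) = qbinom Q n s * qbinom Q s l"
        using qbinom_absorb[OF Q, of 0 s n l] True qbinom_symmetric[OF True] by simp
      moreover have "n - \<delta> + 1 - (n - s + l) = s + 1 - (\<delta> + l)"
        using True \<delta> by simp
      ultimately show "(-1) ^ l * Q ^ (l * (l - 1) div 2) * qbinom Q (n - s + l) l
          * (qbinom Q n (n - s + l) * c ^ (n - \<delta> + 1 - (n - s + l)))
        = qbinom Q n s * (v l * c ^ (s + 1 - (\<delta> + l)))"
        by (simp add: v_def mult.assoc[symmetric])
    qed
    \<comment> \<open>The sum of all \<open>v l\<close> is 0 because \<open>s > 0\<close>;
      subtracting it creates the \<open>- 1\<close>. The terms with \<open>l + \<delta> > s\<close>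
      then drop out, since the truncated exponent of \<open>c\<close> is 0 there.\<close>
    also have "\<dots> = qbinom Q n s * ((\<Sum>l\<le>s. v l * c ^ (s + 1 - (\<delta> + l))) - (\<Sum>l\<le>s. v l))"
      using alternating_qbinom_sum[OF Q, of s] s by (simp add: v_def sum_distrib_left)
    also have "(\<Sum>l\<le>s. v l * c ^ (s + 1 - (\<delta> + l))) - (\<Sum>l\<le>s. v l) = (\<Sum>l\<le>s. v l * (c ^ (s + 1 - (\<delta> + l)) - 1))"
      by (simp add: sum_subtractf right_diff_distrib)
    also have "\<dots> = (\<Sum>l | l + \<delta> \<le> s. v l * (c ^ (s + 1 - (\<delta> + l)) - 1))"
      by (rule sum.mono_neutral_right) auto
    also have "\<dots> = (\<Sum>l | l + \<delta> \<le> s. (-1) ^ l * real CARD('a) ^ (l * (l - 1)) * qbinom Q s l * (c ^ (s - \<delta> - l + 1) - 1))"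
    proof (intro sum.cong refl)
      fix l assume "l \<in> {l. l + \<delta> \<le> s}"
      then have "s + 1 - (\<delta> + l) = s - \<delta> - l + 1" by simp
      then show "v l * (c ^ (s + 1 - (\<delta> + l)) - 1)
          = (-1) ^ l * real CARD('a) ^ (l * (l - 1)) * qbinom Q s l * (c ^ (s - \<delta> - l + 1) - 1)"
        by (simp only: v_def even)
    qed
    finally show ?thesis .
  qed
  then show ?thesis by (simp add: a_def N_def D_def)
qed

end

section \<open>Finite fields of even order\<close>

lemma power_CARD:
  fixes x :: "'a::{field,finite}"
  shows "x ^ CARD('a) = x"
proof (cases "x = 0")
  case False
  have inj: "inj_on ((*) x) (UNIV - {0})" using False by (simp add: inj_on_def)
  have "(*) x ` (UNIV - {0}) = UNIV - {0}"
    using False by (intro endo_inj_surj inj) auto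
  then have "(\<Prod>y\<in>UNIV - {0}. y) = (\<Prod>y\<in>UNIV - {0}. x * y)"
    using prod.reindex[OF inj, of "\<lambda>y. y"] by simp
  then have "x ^ (CARD('a) - 1) = 1"
    by (simp add: prod.distrib)
  then show ?thesis
    using CARD_field_gt_1[where 'a = 'a] by (simp add: power_eq_if)
qed (simp add: power_0_left)

locale even_field =
  fixes lam :: "'a::{field,finite}"
  assumes primepow_CARD: "primepow CARD('a)" and even_CARD: "even CARD('a)"
    and trace_lam: "absolute_trace lam = 1"
begin

lemma CARD_eq: "\<exists>e. CARD('a) = 2 ^ e"
proof -
  obtain p k where p: "prime p" "k > 0" "CARD('a) = p ^ k"
    using primepow_CARD by (auto simp: primepow_def)
  then have "2 dvd p" using even_CARD by (simp add: prime_dvd_power)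
  then have "p = 2" using p(1) primes_dvd_imp_eq two_is_prime_nat by blast
  with p show ?thesis by blast
qed

text \<open>Adding 1 permutes the field, so comparing the sums over all elements shows that
  \<open>CARD('a)\<close>, a power of 2, is 0 in the field.\<close>

lemma two_eq_0: "(2 :: 'a) = 0"
proof -
  have "(\<Sum>x\<in>UNIV. x + 1) = (\<Sum>x\<in>UNIV. x :: 'a)"
    by (rule sum.reindex_bij_witness[of _ "\<lambda>x. x - 1" "\<lambda>x. x + 1"]) auto
  then have "of_nat CARD('a) = (0 :: 'a)" by (simp add: sum.distrib)
  then show ?thesis using CARD_eq by auto
qed

lemma add_self [simp]: "x + x = (0 :: 'a)"
  using two_eq_0 by (metis mult_2 mult_zero_left)

lemma minus_eq [simp]: "- x = (x :: 'a)"
  by (simp add: minus_unique)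

lemma add_eq_0: "x + y = 0 \<longleftrightarrow> x = (y :: 'a)"
  by (simp add: add_eq_0_iff2)

lemma square_add: "(x + y)\<^sup>2 = x\<^sup>2 + (y :: 'a)\<^sup>2"
  by (simp add: power2_sum two_eq_0)

lemma square_surj: "\<exists>t. t\<^sup>2 = (x :: 'a)"
proof -
  have "inj (\<lambda>t :: 'a. t\<^sup>2)"
  proof (rule injI)
    fix s t :: 'a assume "s\<^sup>2 = t\<^sup>2"
    then have "(s + t)\<^sup>2 = 0" by (simp add: square_add)
    then show "s = t" by (simp add: add_eq_0)
  qed
  then have "surj (\<lambda>t :: 'a. t\<^sup>2)" by (rule finite_UNIV_inj_surj[OF finite])
  then show ?thesis by (metis surjD)
qed

abbreviation "tr \<equiv> absolute_trace :: 'a \<Rightarrow> 'a"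

lemma trace_sum: "\<exists>e. CARD('a) = 2 ^ e \<and> tr = (\<lambda>x. \<Sum>i<e. x ^ (2 ^ i))"
proof -
  obtain e where e: "CARD('a) = 2 ^ e" using CARD_eq by blast
  have "CHAR('a) dvd 2" using two_eq_0 by (simp flip: of_nat_eq_0_iff_char_dvd)
  then have "CHAR('a) = 2"
    by (metis CHAR_not_1' One_nat_def prime_nat_iff two_is_prime_nat)
  then have "tr = (\<lambda>x. \<Sum>i<e. x ^ (2 ^ i))"
    using e by (simp add: absolute_trace_def fun_eq_iff)
  with e show ?thesis by blast
qed

lemma trace_add: "tr (x + y) = tr x + tr y"
proof -
  obtain e where e: "tr = (\<lambda>x. \<Sum>i<e. x ^ (2 ^ i))" using trace_sum by blast
  have "(x + y) ^ (2 ^ i) = x ^ (2 ^ i) + y ^ (2 ^ i)" for i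
    by (induction i) (simp_all add: power_mult square_add mult.commute[of 2])
  then show ?thesis by (simp only: e sum.distrib)
qed

lemma trace_square: "tr (x\<^sup>2) = tr x"
proof -
  obtain e where e: "CARD('a) = 2 ^ e" "tr = (\<lambda>x. \<Sum>i<e. x ^ (2 ^ i))" using trace_sum by blast
  have "tr (x\<^sup>2) = (\<Sum>i<e. x ^ (2 ^ Suc i))"
    by (simp add: e(2) power_mult)
  moreover have "x ^ (2 ^ e) = x" using power_CARD[of x] by (simp add: e(1))
  moreover have "(\<Sum>i<Suc e. x ^ (2 ^ i)) = x + (\<Sum>i<e. x ^ (2 ^ Suc i))"
    by (subst sum.lessThan_Suc_shift) simp
  ultimately show ?thesis by (simp add: e(2) add.commute)
qed

lemma trace_values: "tr x = 0 \<or> tr x = 1"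
proof -
  obtain e where e: "tr = (\<lambda>x. \<Sum>i<e. x ^ (2 ^ i))" using trace_sum by blast
  have sq: "(\<Sum>i<n. f i)\<^sup>2 = (\<Sum>i<n. (f i)\<^sup>2)" for n and f :: "nat \<Rightarrow> 'a"
    by (induction n) (simp_all add: square_add)
  have "(tr x)\<^sup>2 = tr (x\<^sup>2)"
    by (simp add: e sq power_mult[symmetric] mult.commute)
  then have "tr x * tr x = tr x"
    by (subst (asm) trace_square) (simp only: power2_eq_square)
  then show ?thesis by simp
qed

text \<open>The map \<open>t \<mapsto> t^2 + t\<close> is two-to-one and its values have trace 0.
  Adding \<open>lam\<close> exchanges the elements of trace 0 and 1, so trace 0 also covers exactly
  half of the field, and counting gives equality.\<close>

lemma artin_schreier:
  assumes "tr x = 0"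
  shows "\<exists>t. x = t\<^sup>2 + t"
proof -
  define f where "f t = t\<^sup>2 + t" for t :: 'a
  let ?K = "{x. tr x = 0}"
  have fK: "range f \<subseteq> ?K" by (auto simp: f_def trace_add trace_square)
  have fib: "{t. f t = f s} = {s, s + 1}" for s
  proof -
    have "f t = f s \<longleftrightarrow> t = s \<or> t = s + 1" for t
    proof -
      have "f t = f s \<longleftrightarrow> f t + f s = 0" by (simp add: add_eq_0)
      also have "f t + f s = (t + s) * (t + s + 1)"
        by (simp add: f_def algebra_simps power2_eq_square) (simp add: two_eq_0)
      finally show ?thesis by (simp add: add_eq_0 add.assoc)
    qed
    then show ?thesis by auto
  qed
  have "(\<Sum>y\<in>range f. \<Sum>t\<in>{t \<in> UNIV. f t = y}. 1) = (\<Sum>t\<in>(UNIV :: 'a set). 1 :: nat)"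
    by (rule sum.group) auto
  then have "CARD('a) = (\<Sum>y\<in>range f. card {t. f t = y})"
    by (simp only: card_eq_sum[symmetric] UNIV_I simp_thms)
  also have "\<dots> = (\<Sum>y\<in>range f. 2)"
  proof (intro sum.cong refl)
    fix y assume "y \<in> range f"
    then obtain s where "y = f s" by blast
    then show "card {t. f t = y} = 2" by (simp only: fib) simp
  qed
  finally have range: "CARD('a) = 2 * card (range f)" by simp
  have "bij_betw (\<lambda>x. x + lam) ?K (- ?K)"
  proof (rule bij_betwI[where g = "\<lambda>x. x + lam"])
    show "(\<lambda>x. x + lam) \<in> - ?K \<rightarrow> ?K"
    proof
      fix x assume "x \<in> - ?K"
      then show "x + lam \<in> ?K" using trace_values[of x] by (simp add: trace_add trace_lam)
    qed
  qed (auto simp: trace_add trace_lam add.assoc)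
  then have "card ?K = card (- ?K)" by (rule bij_betw_same_card)
  then have "CARD('a) = 2 * card ?K"
    using card_Diff_subset[of ?K UNIV] card_mono[of UNIV ?K] by (simp add: Compl_eq_Diff_UNIV)
  then have "range f = ?K"
    using range fK by (intro card_subset_eq) simp_all
  then show ?thesis using assms by (auto simp: f_def)
qed

definition sgn_tr :: "'a \<Rightarrow> real" where
  "sgn_tr x = (if tr x = 0 then 1 else - 1)"

lemma sgn_tr_square [simp]: "sgn_tr (x\<^sup>2) = sgn_tr x"
  by (simp add: sgn_tr_def trace_square)

lemma sgn_tr_lam [simp]: "sgn_tr lam = - 1"
  by (simp add: sgn_tr_def trace_lam)

sublocale sign_character sgn_tr
proof
  show "sgn_tr (x + y) = sgn_tr x * sgn_tr y" for x y
    using trace_values[of x] trace_values[of y] by (auto simp: sgn_tr_def trace_add)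
  show "\<exists>z. sgn_tr z \<noteq> 1"
    by (rule exI[of _ lam]) simp
qed (simp add: sgn_tr_def)

end

section \<open>Character sums of orthogonal sums of binary forms\<close>

context sign_character
begin

lemma sum_linear: "(\<Sum>x\<in>UNIV. \<chi> (t * x)) = (if t = 0 then real CARD('a) else 0)"
proof (cases "t = 0")
  case False
  then have "bij ((*) t)"
    by (intro bij_betw_byWitness[where f' = "\<lambda>x. x / t"]) auto
  then have "(\<Sum>x\<in>UNIV. \<chi> (t * x)) = (\<Sum>x\<in>UNIV. \<chi> x)"
    by (rule sum.reindex_bij_betw)
  with False show ?thesis by (simp add: sum_UNIV)
qed simp

lemma sum_hyperbolic: "t \<noteq> 0 \<Longrightarrow> (\<Sum>u\<in>UNIV. \<Sum>w\<in>UNIV. \<chi> (t * (u * w))) = real CARD('a)"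
  using sum_linear[of "t * _"] by (simp add: mult.assoc[symmetric] sum.delta)

lemma sum_vec_on_remove_pair:
  fixes F :: "'a \<Rightarrow> 'a \<Rightarrow> real"
  assumes I: "finite I" and pq: "p \<in> I" "q \<in> I" "p \<noteq> q"
    and G: "\<And>y u w. G (y(p := u, q := w)) = G y"
  shows "(\<Sum>y\<in>vec_on I. F (y p) (y q) * G y)
    = (\<Sum>u\<in>UNIV. \<Sum>w\<in>UNIV. F u w) * (\<Sum>y\<in>vec_on (I - {p, q}). G y)"
proof -
  have "(\<Sum>y\<in>vec_on I. F (y p) (y q) * G y)
      = (\<Sum>(u, w, y) \<in> UNIV \<times> UNIV \<times> vec_on (I - {p, q}). F u w * G y)"
  proof (rule sum.reindex_bij_witness[where i = "\<lambda>(u, w, y). y(p := u, q := w)"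
        and j = "\<lambda>y. (y p, y q, y(p := 0, q := 0))"], goal_cases)
    case (3 t)
    then show ?case using pq by (auto simp: vec_on_def fun_eq_iff)
  qed (use pq in \<open>auto simp: vec_on_def G fun_eq_iff\<close>)
  also have "\<dots> = (\<Sum>u\<in>UNIV. \<Sum>w\<in>UNIV. F u w) * (\<Sum>y\<in>vec_on (I - {p, q}). G y)"
    by (simp add: sum.cartesian_product[symmetric] sum_distrib_left[symmetric] sum_distrib_right[symmetric])
  finally show ?thesis .
qed

text \<open>The pairs of coordinates are independent, so the sum factors over the planes; each
  coordinate outside them contributes a factor \<open>CARD('a)\<close>.\<close>

lemma sum_vec_on_binary_forms:
  fixes \<phi> :: "nat \<Rightarrow> 'a \<Rightarrow> 'a \<Rightarrow> 'a"
  assumes "finite I" "{1..2 * s} \<subseteq> I"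
  shows "(\<Sum>y\<in>vec_on I. \<chi> (\<Sum>i=1..s. \<phi> i (y (2 * i - 1)) (y (2 * i))))
    = (\<Prod>i=1..s. \<Sum>u\<in>UNIV. \<Sum>w\<in>UNIV. \<chi> (\<phi> i u w)) * real CARD('a) ^ (card I - 2 * s)"
  using assms
proof (induction s arbitrary: I)
  case 0
  then show ?case by (simp add: card_vec_on)
next
  case (Suc s)
  let ?p = "2 * s + 1" and ?q = "2 * s + 2"
  let ?J = "I - {?p, ?q}"
  let ?G = "\<lambda>y. \<chi> (\<Sum>i=1..s. \<phi> i (y (2 * i - 1)) (y (2 * i)))"
  have pq: "?p \<in> I" "?q \<in> I" "?p \<noteq> ?q" using Suc.prems(2) by auto
  have G: "?G (y(?p := u, ?q := w)) = ?G y" for y u w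
    by (intro arg_cong[where f = \<chi>] sum.cong refl) auto
  have "(\<Sum>y\<in>vec_on I. \<chi> (\<Sum>i=1..Suc s. \<phi> i (y (2 * i - 1)) (y (2 * i))))
      = (\<Sum>y\<in>vec_on I. \<chi> (\<phi> (Suc s) (y ?p) (y ?q)) * ?G y)"
    by (intro sum.cong refl) (simp add: add mult.commute)
  also have "\<dots> = (\<Sum>u\<in>UNIV. \<Sum>w\<in>UNIV. \<chi> (\<phi> (Suc s) u w)) * (\<Sum>y\<in>vec_on ?J. ?G y)"
    by (rule sum_vec_on_remove_pair[OF Suc.prems(1) pq, where F = "\<lambda>u w. \<chi> (\<phi> (Suc s) u w)", OF G])
  also have "(\<Sum>y\<in>vec_on ?J. ?G y)
      = (\<Prod>i=1..s. \<Sum>u\<in>UNIV. \<Sum>w\<in>UNIV. \<chi> (\<phi> i u w)) * real CARD('a) ^ (card ?J - 2 * s)"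
    using Suc.prems by (intro Suc.IH) auto
  also have "card ?J - 2 * s = card I - 2 * Suc s"
    using card_remove_pair[OF Suc.prems(1) pq] by simp
  finally show ?case by (simp add: mult_ac)
qed

end

text \<open>As the trace does not distinguish \<open>u^2\<close> from \<open>u\<close>, the sum over
  \<open>u\<close> is a sum of the linear character of \<open>(1 + w) * u\<close> and survives only
  for \<open>w = 1\<close>. The sign is the value at \<open>lam\<close>, which has trace 1.\<close>

lemma (in even_field) sum_elliptic:
  "(\<Sum>u\<in>UNIV. \<Sum>w\<in>UNIV. sgn_tr (u\<^sup>2 + u * w + lam * w\<^sup>2)) = - real CARD('a)"
proof -
  have "(\<Sum>u\<in>UNIV. sgn_tr (u\<^sup>2 + u * w + lam * w\<^sup>2))
      = (if w = 1 then - real CARD('a) else 0)" for w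
  proof -
    have "sgn_tr (u\<^sup>2 + u * w + lam * w\<^sup>2) = sgn_tr ((1 + w) * u) * sgn_tr (lam * w\<^sup>2)" for u
    proof -
      have "(1 + w) * u = u + u * w" by (simp add: algebra_simps)
      then show ?thesis by (simp only: add sgn_tr_square)
    qed
    then have "(\<Sum>u\<in>UNIV. sgn_tr (u\<^sup>2 + u * w + lam * w\<^sup>2))
        = (\<Sum>u\<in>UNIV. sgn_tr ((1 + w) * u)) * sgn_tr (lam * w\<^sup>2)"
      by (simp add: sum_distrib_right)
    then show ?thesis
      by (auto simp: sum_linear add_eq_0)
  qed
  then show ?thesis by (subst sum.swap) (simp add: sum.delta)
qed

section \<open>Quadratic forms in even characteristic\<close>

text \<open>Positive dimension is what guarantees a finite basis: an infinite basis would have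
  cardinality 0, and so would give \<open>dim\<close> the value 0.\<close>

locale finite_vector_space = vector_space scale
  for scale :: "'a::{field,finite} \<Rightarrow> 'v::ab_group_add \<Rightarrow> 'v" +
  assumes dim_pos: "0 < dim (UNIV :: 'v set)"
begin

definition comb :: "nat set \<Rightarrow> (nat \<Rightarrow> 'v) \<Rightarrow> (nat \<Rightarrow> 'a) \<Rightarrow> 'v" where
  "comb J b x = (\<Sum>i\<in>J. scale (x i) (b i))"

definition indices :: "nat set" where
  "indices = {1..dim (UNIV :: 'v set)}"

lemma finite_indices [simp]: "finite indices"
  and card_indices [simp]: "card indices = dim (UNIV :: 'v set)"
  by (simp_all add: indices_def)

lemma comb_diff: "comb J b (\<lambda>i. x i - y i) = comb J b x - comb J b y"
  by (simp add: comb_def scale_left_diff_distrib sum_subtractf)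

lemma comb_unit_vec: "finite J \<Longrightarrow> i \<in> J \<Longrightarrow> comb J b (unit_vec i) = b i"
  by (simp add: comb_def unit_vec_def if_distrib[of "\<lambda>c. scale c _"] sum.delta cong: if_cong)

lemma comb_inj_on:
  assumes "finite J" "inj_on b J" "independent (b ` J)"
  shows "inj_on (comb J b) (vec_on J)"
proof (rule inj_onI)
  fix x y assume x: "x \<in> vec_on J" and y: "y \<in> vec_on J" and eq: "comb J b x = comb J b y"
  define u where "u v = x (inv_into J b v) - y (inv_into J b v)" for v
  have "(\<Sum>v\<in>b ` J. scale (u v) v) = comb J b (\<lambda>i. x i - y i)"
    unfolding comb_def using assms(2) by (simp add: sum.reindex u_def)
  then have "(\<Sum>v\<in>b ` J. scale (u v) v) = 0"
    using eq by (simp add: comb_diff)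
  then have "u (b i) = 0" if "i \<in> J" for i
    using independentD[OF assms(3), of "b ` J" u "b i"] assms(1) that by simp
  then have "x i = y i" if "i \<in> J" for i
    using that assms(2) by (simp add: u_def)
  moreover have "x i = y i" if "i \<notin> J" for i
    using that x y by (simp add: vec_on_def)
  ultimately show "x = y" by blast
qed

lemma comb_image:
  assumes "finite J" "inj_on b J"
  shows "comb J b ` vec_on J = span (b ` J)"
proof (intro equalityI subsetI)
  fix v assume "v \<in> comb J b ` vec_on J"
  then obtain x where "v = (\<Sum>i\<in>J. scale (x i) (b i))" by (auto simp: comb_def)
  then show "v \<in> span (b ` J)"
    by (simp add: span_sum span_scale span_base)
next
  fix v assume "v \<in> span (b ` J)"
  then obtain u where u: "v = (\<Sum>w\<in>b ` J. scale (u w) w)"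
    using assms(1) by (auto simp: span_finite)
  let ?x = "\<lambda>i. if i \<in> J then u (b i) else 0"
  have "v = comb J b ?x"
    unfolding u comb_def sum.reindex[OF assms(2)] by (intro sum.cong) auto
  moreover have "?x \<in> vec_on J" by (simp add: vec_on_def)
  ultimately show "v \<in> comb J b ` vec_on J" by blast
qed

lemma comb_bij_span:
  assumes "finite J" "inj_on b J" "independent (b ` J)"
  shows "bij_betw (comb J b) (vec_on J) (span (b ` J))"
  unfolding bij_betw_def using comb_inj_on[OF assms] comb_image[OF assms(1,2)] by blast

lemma ordered_basis_exists: "\<exists>b. ordered_basis scale b"
proof -
  obtain B where B: "independent B" "UNIV \<subseteq> span B" "card B = dim (UNIV :: 'v set)"
    by (rule basis_exists)
  then have "finite B" using dim_pos card_ge_0_finite by metis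
  then obtain h where "bij_betw h {1..card B} B"
    using ex_bij_betw_nat_finite_1 by blast
  then have "inj_on h indices" "h ` indices = B"
    using B by (simp_all add: bij_betw_def indices_def)
  then show ?thesis
    using B by (intro exI[of _ h]) (auto simp: ordered_basis_def indices_def)
qed

lemma ordered_basisD:
  assumes "ordered_basis scale b"
  shows "inj_on b indices" "independent (b ` indices)" "span (b ` indices) = UNIV"
    and "bij_betw (comb indices b) (vec_on indices) UNIV"
proof -
  show *: "inj_on b indices" "independent (b ` indices)" "span (b ` indices) = UNIV"
    using assms by (simp_all add: ordered_basis_def Let_def indices_def)
  show "bij_betw (comb indices b) (vec_on indices) UNIV"
    using comb_bij_span[of indices b] * by simp
qed

lemma finite_UNIV_v: "finite (UNIV :: 'v set)"
proof -
  obtain b where "ordered_basis scale b" using ordered_basis_exists by blast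
  from bij_betw_finite[OF ordered_basisD(4)[OF this]] show ?thesis
    by simp
qed

text \<open>Equalities between dimensions are proved below by counting elements and comparing powers
  of \<open>CARD('a)\<close>.\<close>

lemma card_subspace:
  assumes "subspace S"
  shows "card S = CARD('a) ^ dim S"
proof -
  obtain B where B: "B \<subseteq> S" "independent B" "S \<subseteq> span B" "card B = dim S"
    by (rule basis_exists)
  then have S: "span B = S" using assms span_minimal by blast
  have "finite B" by (rule finite_subset[OF subset_UNIV finite_UNIV_v])
  then obtain h where h: "bij_betw h {1..card B} B"
    using ex_bij_betw_nat_finite_1 by blast
  then have "bij_betw (comb {1..card B} h) (vec_on {1..card B}) S"
    using comb_bij_span[of "{1..card B}" h] B S by (simp add: bij_betw_def)
  then have "card S = card (vec_on {1..card B} :: (nat \<Rightarrow> 'a) set)"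
    by (rule bij_betw_same_card[symmetric])
  then show ?thesis by (simp add: card_vec_on B(4))
qed

lemma ordered_basisI:
  assumes bij: "bij_betw (comb indices b) (vec_on indices) UNIV"
  shows "ordered_basis scale b"
proof -
  have inj: "inj_on (comb indices b) (vec_on indices)" using bij by (simp add: bij_betw_def)
  have inj_b: "inj_on b indices"
  proof (rule inj_onI)
    fix i j assume i: "i \<in> indices" and j: "j \<in> indices" and eq: "b i = b j"
    then have "comb indices b (unit_vec i) = comb indices b (unit_vec j)"
      by (simp add: comb_unit_vec)
    then have "unit_vec i = (unit_vec j :: nat \<Rightarrow> 'a)"
      using inj i j unit_vec_in by (metis inj_onD)
    then have "unit_vec i i = (unit_vec j i :: 'a)" by simp
    then show "i = j" by (simp add: unit_vec_def split: if_splits)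
  qed
  have "independent (b ` indices)"
  proof -
    have "u v = 0" if u: "(\<Sum>v\<in>b ` indices. scale (u v) v) = 0" and v: "v \<in> b ` indices" for u v
    proof -
      let ?x = "\<lambda>i. if i \<in> indices then u (b i) else 0"
      have "comb indices b ?x = (\<Sum>i\<in>indices. scale (u (b i)) (b i))"
        unfolding comb_def by (intro sum.cong) auto
      also have "\<dots> = comb indices b (\<lambda>_. 0)"
        using u unfolding sum.reindex[OF inj_b] by (simp add: comb_def)
      finally have "?x = (\<lambda>_. 0)"
        by (rule inj_onD[OF inj]) (auto simp: vec_on_def)
      then show ?thesis using v by (auto simp: fun_eq_iff split: if_splits)
    qed
    then show ?thesis by (subst dependent_finite) auto
  qed
  moreover have "span (b ` indices) = UNIV"
  proof -
    have "comb indices b x \<in> span (b ` indices)" for x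
      unfolding comb_def by (intro span_sum span_scale span_base) blast
    then show ?thesis using bij unfolding bij_betw_def by (metis UNIV_I UNIV_eq_I image_iff)
  qed
  ultimately show ?thesis using inj_b by (simp add: ordered_basis_def indices_def)
qed

lemma coord_comb:
  assumes b: "ordered_basis scale b" and i: "i \<in> indices"
  shows "coord scale b i (comb indices b y) = y i"
proof -
  note ob = ordered_basisD[OF b]
  define x where "x = comb indices b y"
  define z where "z i = (if i \<in> indices then coord scale b i x else 0)" for i
  define y' where "y' i = (if i \<in> indices then y i else 0)" for i
  have "comb indices b z = (\<Sum>i\<in>indices. scale (representation (b ` indices) x (b i)) (b i))"
    unfolding comb_def by (intro sum.cong) (auto simp: z_def coord_def indices_def)
  also have "\<dots> = x"
    using sum_representation_eq[OF ob(2), of x "b ` indices"] ob(1,3) by (simp add: sum.reindex)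
  also have "x = comb indices b y'"
    unfolding x_def comb_def by (intro sum.cong) (auto simp: y'_def)
  finally have "z = y'"
    using ob(4) by (intro inj_onD[of "comb indices b" "vec_on indices"])
      (auto simp: bij_betw_def z_def y'_def vec_on_def)
  then have "z i = y' i" by simp
  then show ?thesis using i by (simp add: z_def y'_def x_def)
qed

lemma comb_coord:
  assumes "ordered_basis scale b"
  shows "comb indices b (\<lambda>i. coord scale b i x) = x"
proof -
  obtain y where x: "x = comb indices b y"
    using ordered_basisD(4)[OF assms] unfolding bij_betw_def by blast
  have "comb indices b (\<lambda>i. coord scale b i x) = comb indices b y"
    unfolding comb_def by (intro sum.cong refl) (simp add: x coord_comb[OF assms])
  then show ?thesis by (simp only: x)
qed

end

section \<open>The polar form, its radical and the rank\<close>

locale even_quadratic_space = even_field lam + finite_vector_space scale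
  for lam :: "'a::{field,finite}" and scale :: "'a \<Rightarrow> 'v::ab_group_add \<Rightarrow> 'v" +
  fixes Q :: "'v \<Rightarrow> 'a"
  assumes form: "quadratic_form scale Q"
begin

definition polar_radical :: "'v set" where
  "polar_radical = {x. \<forall>y. polar Q x y = 0}"

lemma Q_scale: "Q (scale a x) = a\<^sup>2 * Q x"
  using form by (simp add: quadratic_form_def)

lemma Q_0 [simp]: "Q 0 = 0"
  using Q_scale[of 0 0] by simp

lemma Q_add: "Q (x + y) = Q x + Q y + polar Q x y"
  by (simp add: polar_def two_eq_0)

lemma polar_add_left: "polar Q (x + y) z = polar Q x z + polar Q y z"
  and polar_scale_left: "polar Q (scale a x) z = a * polar Q x z"
proof -
  have "Vector_Spaces.linear scale (*) (\<lambda>x. polar Q x z)"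
    using form by (simp add: quadratic_form_def)
  then show "polar Q (x + y) z = polar Q x z + polar Q y z"
    and "polar Q (scale a x) z = a * polar Q x z"
    unfolding Vector_Spaces.linear_iff by blast+
qed

lemma polar_sym: "polar Q x y = polar Q y x"
  by (simp add: polar_def add.commute)

lemma polar_add_right: "polar Q z (x + y) = polar Q z x + polar Q z y"
  and polar_scale_right: "polar Q z (scale a x) = a * polar Q z x"
  by (simp_all only: polar_sym[of z] polar_add_left polar_scale_left)

lemma polar_0 [simp]: "polar Q 0 x = 0" "polar Q x 0 = 0"
  using polar_scale_left[of 0 0 x] polar_scale_right[of x 0 0] by simp_all

lemma polar_sum_left: "polar Q (\<Sum>i\<in>J. f i) z = (\<Sum>i\<in>J. polar Q (f i) z)"
  by (induction J rule: infinite_finite_induct) (simp_all add: polar_add_left)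

lemma v_add_self [simp]: "x + x = (0 :: 'v)"
proof -
  have "x + x = scale (1 + 1) x" by (simp only: scale_left_distrib scale_one)
  then show ?thesis by (simp only: add_self scale_zero_left)
qed

lemma polar_self [simp]: "polar Q x x = 0"
  by (simp add: polar_def)

definition gram :: "(nat \<Rightarrow> 'v) \<Rightarrow> nat \<Rightarrow> nat \<Rightarrow> 'a" where
  "gram b i j = (if i \<in> indices \<and> j \<in> indices then polar Q (b i) (b j) else 0)"

lemma gram_alt_on: "gram b \<in> alt_on indices"
proof -
  have "gram b j i + gram b i j = 0" for i j
    using polar_sym[of "b i" "b j"] by (simp add: gram_def)
  then show ?thesis by (auto simp: alt_on_def gram_def)
qed

lemma polar_comb_left: "polar Q (comb J b x) z = (\<Sum>i\<in>J. x i * polar Q (b i) z)"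
  by (simp add: comb_def polar_sum_left polar_scale_left)

lemma subspace_polar_radical: "subspace polar_radical"
  by (rule subspaceI) (auto simp: polar_radical_def polar_add_left polar_scale_left)

lemma card_polar_radical:
  assumes b: "ordered_basis scale b"
  shows "card polar_radical = card (null_on indices (gram b))"
proof -
  have bij: "bij_betw (comb indices b) (vec_on indices) UNIV" by (rule ordered_basisD(4)[OF b])
  have rad: "comb indices b x \<in> polar_radical \<longleftrightarrow> (\<forall>j\<in>indices. (\<Sum>i\<in>indices. x i * gram b i j) = 0)" for x
  proof -
    have gr: "polar Q (comb indices b x) (b j) = (\<Sum>i\<in>indices. x i * gram b i j)" if "j \<in> indices" for j
      unfolding polar_comb_left using that by (intro sum.cong) (auto simp: gram_def)
    have "polar Q (comb indices b x) y = 0" if z: "\<forall>j\<in>indices. polar Q (comb indices b x) (b j) = 0" for y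
    proof -
      obtain y' where "y = comb indices b y'" using bij unfolding bij_betw_def by blast
      then have "polar Q y (comb indices b x) = (\<Sum>i\<in>indices. y' i * polar Q (b i) (comb indices b x))"
        by (simp only: polar_comb_left)
      also have "\<dots> = 0"
        using z polar_sym[of "comb indices b x"] by (intro sum.neutral) simp
      finally show ?thesis using polar_sym by metis
    qed
    then show ?thesis using gr by (auto simp: polar_radical_def)
  qed
  have "bij_betw (comb indices b) {x \<in> vec_on indices. comb indices b x \<in> polar_radical} polar_radical"
    using bij unfolding bij_betw_def by (auto simp: inj_on_def)
  then show ?thesis
    unfolding rad null_on_def by (simp add: bij_betw_same_card)
qed

lemma dim_polar_radical:
  assumes b: "ordered_basis scale b"
  shows "dim polar_radical = dim (UNIV :: 'v set) - 2 * half_rank indices (gram b)"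
proof -
  have "CARD('a) ^ dim polar_radical = CARD('a) ^ (dim (UNIV :: 'v set) - 2 * half_rank indices (gram b))"
    using card_subspace[OF subspace_polar_radical] card_polar_radical[OF b]
      half_rank(2)[OF _ gram_alt_on, of b] by simp
  then show ?thesis
    using CARD_field_gt_1[where 'a = 'a] by (simp only: power_inject_exp)
qed

lemma qf_radical_eq: "qf_radical Q = {x \<in> polar_radical. Q x = 0}"
  by (auto simp: qf_radical_def polar_radical_def)

lemma subspace_qf_radical: "subspace (qf_radical Q)"
  unfolding qf_radical_eq using subspace_polar_radical
  by (auto simp: subspace_def Q_add Q_scale polar_radical_def)

text \<open>On the radical of the polar form, \<open>Q\<close> is additive and every value of the field is attained
  as soon as one nonzero value is, because all field elements are squares.\<close>

lemma dim_qf_radical: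
  assumes x0: "x0 \<in> polar_radical" "Q x0 \<noteq> 0"
  shows "dim polar_radical = Suc (dim (qf_radical Q))"
proof -
  obtain r :: "'a \<Rightarrow> 'a" where r: "\<And>a. (r a)\<^sup>2 = a" using square_surj by metis
  \<comment> \<open>The scalar is a square root of \<open>a / Q x0\<close>, chosen so that
    \<open>Q (u a) = a\<close>. Adding \<open>u (Q x)\<close> to \<open>x\<close> then cancels the
    value of \<open>Q\<close>, which splits the polar radical into a copy of the field and
    \<open>qf_radical Q\<close>.\<close>
  define u where "u a = scale (r (a / Q x0)) x0" for a
  have u: "u a \<in> polar_radical" "Q (u a) = a" for a
    using x0 subspace_polar_radical by (auto simp: u_def subspace_def Q_scale r)
  have add0: "Q (x + y) = Q x + Q y" if "x \<in> polar_radical" for x y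
    using that by (simp add: Q_add polar_radical_def)
  have "bij_betw (\<lambda>(a, x). u a + x) (UNIV \<times> qf_radical Q) polar_radical"
  proof (rule bij_betwI[where g = "\<lambda>x. (Q x, u (Q x) + x)"])
    show "(\<lambda>(a, x). u a + x) \<in> UNIV \<times> qf_radical Q \<rightarrow> polar_radical"
      using u(1) subspace_polar_radical by (auto simp: qf_radical_eq subspace_def)
    show "(\<lambda>x. (Q x, u (Q x) + x)) \<in> polar_radical \<rightarrow> UNIV \<times> qf_radical Q"
      using u subspace_polar_radical by (auto simp: qf_radical_eq subspace_def add0)
  qed (auto simp: u add0 qf_radical_eq add.assoc[symmetric])
  then have "card polar_radical = CARD('a) * card (qf_radical Q)"
    by (simp flip: bij_betw_same_card add: card_cartesian_product)
  then have "CARD('a) ^ dim polar_radical = CARD('a) ^ Suc (dim (qf_radical Q))"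
    by (simp add: card_subspace subspace_polar_radical subspace_qf_radical)
  then show ?thesis
    using CARD_field_gt_1[where 'a = 'a] by (simp only: power_inject_exp)
qed

text \<open>The radical of \<open>Q\<close> is either the whole polar radical or a hyperplane in it,
  so a polar form of half rank \<open>r\<close> admits just the ranks \<open>2 * r\<close> and
  \<open>2 * r + 1\<close>.\<close>

lemma qf_rank_eq:
  assumes b: "ordered_basis scale b"
  shows "qf_rank scale Q = 2 * half_rank indices (gram b) + (if \<forall>x\<in>polar_radical. Q x = 0 then 0 else 1)"
proof -
  have hr: "2 * half_rank indices (gram b) \<le> dim (UNIV :: 'v set)"
    using half_rank(1)[OF _ gram_alt_on, of b] by simp
  show ?thesis
  proof (cases "\<forall>x\<in>polar_radical. Q x = 0")
    case True
    then have "qf_radical Q = polar_radical" by (auto simp: qf_radical_eq)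
    then show ?thesis using True hr dim_polar_radical[OF b] by (simp add: qf_rank_def)
  next
    case False
    then obtain x0 where "x0 \<in> polar_radical" "Q x0 \<noteq> 0" by blast
    then have "dim polar_radical = Suc (dim (qf_radical Q))" by (rule dim_qf_radical)
    then have "dim (UNIV :: 'v set) - dim (qf_radical Q) = 2 * half_rank indices (gram b) + 1"
      using hr dim_polar_radical[OF b] by linarith
    then show ?thesis
      using False by (auto simp: qf_rank_def)
  qed
qed

end

section \<open>The two types of forms of even rank\<close>

lemma sum_pairs:
  fixes g :: "nat \<Rightarrow> 'b::comm_monoid_add"
  shows "(\<Sum>j=1..2 * s. g j) = (\<Sum>i=1..s. g (2 * i - 1) + g (2 * i))"
  by (induction s) (simp_all add: add.assoc)

context even_quadratic_space
begin

definition symplectic :: "nat \<Rightarrow> (nat \<Rightarrow> 'v) \<Rightarrow> (nat \<Rightarrow> 'v) \<Rightarrow> bool" where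
  "symplectic k e f \<longleftrightarrow> (\<forall>i\<in>{1..k}. \<forall>j\<in>{1..k}.
     polar Q (e i) (f j) = (if i = j then 1 else 0) \<and> polar Q (e i) (e j) = 0 \<and> polar Q (f i) (f j) = 0)"

definition perp :: "nat \<Rightarrow> (nat \<Rightarrow> 'v) \<Rightarrow> (nat \<Rightarrow> 'v) \<Rightarrow> 'v set" where
  "perp k e f = {x. \<forall>i\<in>{1..k}. polar Q x (e i) = 0 \<and> polar Q x (f i) = 0}"

definition pair_comb :: "nat \<Rightarrow> (nat \<Rightarrow> 'v) \<Rightarrow> (nat \<Rightarrow> 'v) \<Rightarrow> (nat \<Rightarrow> 'a) \<Rightarrow> (nat \<Rightarrow> 'a) \<Rightarrow> 'v" where
  "pair_comb k e f \<alpha> \<beta> = (\<Sum>i=1..k. scale (\<alpha> i) (e i) + scale (\<beta> i) (f i))"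

text \<open>Orthogonal projection onto the span of a symplectic system: each coefficient is the
  pairing with the partner vector. In characteristic 2 the complementary component is
  \<open>x + proj k e f x\<close>.\<close>

definition proj :: "nat \<Rightarrow> (nat \<Rightarrow> 'v) \<Rightarrow> (nat \<Rightarrow> 'v) \<Rightarrow> 'v \<Rightarrow> 'v" where
  "proj k e f x = pair_comb k e f (\<lambda>i. polar Q x (f i)) (\<lambda>i. polar Q x (e i))"

lemma symplecticD:
  assumes "symplectic k e f" "i \<in> {1..k}" "j \<in> {1..k}"
  shows "polar Q (e i) (f j) = (if i = j then 1 else 0)" "polar Q (f i) (e j) = (if i = j then 1 else 0)"
    and "polar Q (e i) (e j) = 0" "polar Q (f i) (f j) = 0"
  using assms polar_sym[of "f i" "e j"] by (auto simp: symplectic_def)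

lemma symplectic_mono: "symplectic k e f \<Longrightarrow> l \<le> k \<Longrightarrow> symplectic l e f"
  by (auto simp: symplectic_def)

lemma polar_pair_comb:
  "polar Q (pair_comb k e f \<alpha> \<beta>) z = (\<Sum>i=1..k. \<alpha> i * polar Q (e i) z + \<beta> i * polar Q (f i) z)"
  by (simp add: pair_comb_def polar_sum_left polar_add_left polar_scale_left)

lemma polar_pair_comb_symplectic:
  assumes "symplectic k e f" "j \<in> {1..k}"
  shows "polar Q (pair_comb k e f \<alpha> \<beta>) (f j) = \<alpha> j" "polar Q (pair_comb k e f \<alpha> \<beta>) (e j) = \<beta> j"
proof -
  have "polar Q (pair_comb k e f \<alpha> \<beta>) (f j) = (\<Sum>i=1..k. if i = j then \<alpha> i else 0)"
    unfolding polar_pair_comb using assms by (intro sum.cong refl) (simp add: symplecticD[OF assms(1)])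
  then show "polar Q (pair_comb k e f \<alpha> \<beta>) (f j) = \<alpha> j" using assms(2) by (simp add: sum.delta)
  have "polar Q (pair_comb k e f \<alpha> \<beta>) (e j) = (\<Sum>i=1..k. if i = j then \<beta> i else 0)"
    unfolding polar_pair_comb using assms by (intro sum.cong refl) (simp add: symplecticD[OF assms(1)])
  then show "polar Q (pair_comb k e f \<alpha> \<beta>) (e j) = \<beta> j" using assms(2) by (simp add: sum.delta)
qed

lemma polar_pair_comb_perp: "x \<in> perp k e f \<Longrightarrow> polar Q (pair_comb k e f \<alpha> \<beta>) x = 0"
  unfolding polar_pair_comb using polar_sym[of x] by (intro sum.neutral) (auto simp: perp_def)

lemma add_proj_perp:
  assumes "symplectic k e f"
  shows "x + proj k e f x \<in> perp k e f"
  using polar_pair_comb_symplectic[OF assms] by (simp add: perp_def proj_def polar_add_left)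

text \<open>A vector that pairs nontrivially with \<open>x\<close> can be replaced by its component
  in \<open>perp k e f\<close>, because its projection is orthogonal to \<open>x\<close>; rescaling
  makes the value 1.\<close>

lemma perp_nondegenerate:
  assumes "symplectic k e f" "x \<in> perp k e f" "x \<notin> polar_radical"
  shows "\<exists>y\<in>perp k e f. polar Q x y = 1"
proof -
  obtain z where z: "polar Q x z \<noteq> 0" using assms(3) by (auto simp: polar_radical_def)
  define y where "y = z + proj k e f z"
  have "polar Q x (proj k e f z) = 0"
    using polar_pair_comb_perp[OF assms(2)] polar_sym[of x] by (simp add: proj_def)
  then have "polar Q x y = polar Q x z" by (simp add: y_def polar_add_right)
  then have "polar Q x (scale (1 / polar Q x z) y) = 1" using z by (simp add: polar_scale_right)
  moreover have "scale (1 / polar Q x z) y \<in> perp k e f"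
    using add_proj_perp[OF assms(1), of z] by (simp add: y_def perp_def polar_scale_left)
  ultimately show ?thesis by blast
qed

lemma Q_pair_comb:
  assumes "symplectic k e f"
  shows "Q (pair_comb k e f \<alpha> \<beta>) = (\<Sum>i=1..k. (\<alpha> i)\<^sup>2 * Q (e i) + \<alpha> i * \<beta> i + (\<beta> i)\<^sup>2 * Q (f i))"
  using assms
proof (induction k)
  case 0
  then show ?case by (simp add: pair_comb_def)
next
  case (Suc k)
  let ?t = "scale (\<alpha> (Suc k)) (e (Suc k)) + scale (\<beta> (Suc k)) (f (Suc k))"
  have sy: "symplectic k e f" using Suc.prems by (rule symplectic_mono) simp
  have "?t \<in> perp k e f"
    using symplecticD[OF Suc.prems, of "Suc k"] by (auto simp: perp_def polar_add_left polar_scale_left)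
  then have "polar Q (pair_comb k e f \<alpha> \<beta>) ?t = 0" by (rule polar_pair_comb_perp)
  moreover have "pair_comb (Suc k) e f \<alpha> \<beta> = pair_comb k e f \<alpha> \<beta> + ?t"
    by (simp add: pair_comb_def)
  moreover have "Q ?t = (\<alpha> (Suc k))\<^sup>2 * Q (e (Suc k)) + \<alpha> (Suc k) * \<beta> (Suc k) + (\<beta> (Suc k))\<^sup>2 * Q (f (Suc k))"
    using symplecticD(1)[OF Suc.prems, of "Suc k" "Suc k"]
    by (simp add: Q_add[of "scale _ _"] Q_scale polar_scale_left polar_scale_right)
  ultimately show ?case
    using Suc.IH[OF sy] by (simp add: Q_add[of "pair_comb k e f \<alpha> \<beta>"])
qed

lemma symplectic_extend:
  assumes "symplectic k e f" "u \<in> perp k e f" "w \<in> perp k e f" "polar Q u w = 1"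
  shows "symplectic (Suc k) (e(Suc k := u)) (f(Suc k := w))"
proof -
  have orth: "polar Q (e i) u = 0" "polar Q (f i) u = 0" "polar Q (e i) w = 0" "polar Q (f i) w = 0"
    "polar Q u (e i) = 0" "polar Q u (f i) = 0" "polar Q w (e i) = 0" "polar Q w (f i) = 0"
    if "1 \<le> i" "i \<le> k" for i
    using assms(2,3) that polar_sym[of "e i"] polar_sym[of "f i"] by (simp_all add: perp_def)
  show ?thesis
    unfolding symplectic_def using symplecticD[OF assms(1)] assms(4)
    by (auto simp: le_Suc_eq orth)
qed

lemma perp_extend:
  "perp (Suc k) (e(Suc k := u)) (f(Suc k := w)) = {x \<in> perp k e f. polar Q x u = 0 \<and> polar Q x w = 0}"
  by (auto simp: perp_def atLeastAtMostSuc_conv)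

text \<open>A crude bound, which suffices for a hyperbolic system of maximal length to
  exist.\<close>

lemma symplectic_bound:
  assumes "symplectic k e f"
  shows "k \<le> card (UNIV :: 'v set)"
proof -
  have "inj_on e {1..k}"
    using symplecticD(1)[OF assms] by (intro inj_onI) (metis zero_neq_one)
  then show ?thesis
    using card_inj_on_le[of e "{1..k}" UNIV] finite_UNIV_v by simp
qed

definition hyperbolic_system :: "nat \<Rightarrow> (nat \<Rightarrow> 'v) \<Rightarrow> (nat \<Rightarrow> 'v) \<Rightarrow> bool" where
  "hyperbolic_system k e f \<longleftrightarrow> symplectic k e f \<and> (\<forall>i\<in>{1..k}. Q (e i) = 0 \<and> Q (f i) = 0)"

lemma hyperbolic_system_extend:
  assumes "hyperbolic_system k e f" "v \<in> perp k e f" "Q v = 0" "v \<notin> polar_radical"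
  shows "\<exists>e' f'. hyperbolic_system (Suc k) e' f'"
proof -
  have sy: "symplectic k e f" using assms(1) by (simp add: hyperbolic_system_def)
  obtain y where y: "y \<in> perp k e f" "polar Q v y = 1"
    using perp_nondegenerate[OF sy assms(2,4)] by blast
  \<comment> \<open>Since \<open>Q v = 0\<close> and \<open>polar Q v y = 1\<close>, adding
    \<open>c v\<close> changes \<open>Q y\<close> by \<open>c\<close>; the choice
    \<open>c = Q y\<close> gives a singular partner.\<close>
  let ?w = "y + scale (Q y) v"
  have w: "?w \<in> perp k e f" "polar Q v ?w = 1" "Q ?w = 0"
    using y assms(2,3) polar_sym[of y v]
    by (simp_all add: perp_def polar_add_left polar_scale_left polar_add_right polar_scale_right Q_add[of y] Q_scale)
  have "hyperbolic_system (Suc k) (e(Suc k := v)) (f(Suc k := ?w))"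
    unfolding hyperbolic_system_def using symplectic_extend[OF sy assms(2) w(1,2)] assms(1,3) w(3)
    by (auto simp: hyperbolic_system_def atLeastAtMostSuc_conv)
  then show ?thesis by blast
qed

definition elliptic_system :: "nat \<Rightarrow> (nat \<Rightarrow> 'v) \<Rightarrow> (nat \<Rightarrow> 'v) \<Rightarrow> bool" where
  "elliptic_system k e f \<longleftrightarrow> symplectic k e f \<and> 0 < k \<and> (\<forall>i\<in>{1..k - 1}. Q (e i) = 0 \<and> Q (f i) = 0)
     \<and> Q (e k) = 1 \<and> Q (f k) = lam"

text \<open>A maximal hyperbolic system either already exhausts the space modulo the radical, or its
  orthogonal complement is anisotropic modulo the radical. Two orthogonal vectors always span a
  singular one, so in the second case the complement is a single plane, normalised by
  \<open>artin_schreier\<close>.\<close>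

lemma normal_form:
  assumes rad0: "\<forall>x\<in>polar_radical. Q x = 0"
  shows "\<exists>s e f. perp s e f \<subseteq> polar_radical \<and> (hyperbolic_system s e f \<or> elliptic_system s e f)"
proof -
  let ?P = "\<lambda>k. \<exists>e f. hyperbolic_system k e f"
  have P0: "?P 0" by (simp add: hyperbolic_system_def symplectic_def)
  have bound: "\<forall>k. ?P k \<longrightarrow> k \<le> card (UNIV :: 'v set)"
    using symplectic_bound by (auto simp: hyperbolic_system_def)
  define k where "k = (GREATEST k. ?P k)"
  have Pk: "?P k" unfolding k_def using P0 bound by (intro GreatestI_nat[where P = ?P]) auto
  have max: "l \<le> k" if "?P l" for l
    unfolding k_def using that bound by (intro Greatest_le_nat[where P = ?P]) auto
  obtain e f where h: "hyperbolic_system k e f" using Pk by blast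
  then have sy: "symplectic k e f" by (simp add: hyperbolic_system_def)
  have aniso: "v \<in> polar_radical" if "v \<in> perp k e f" "Q v = 0" for v
  proof (rule ccontr)
    assume "v \<notin> polar_radical"
    then have "?P (Suc k)" using hyperbolic_system_extend[OF h that] by blast
    then show False using max by fastforce
  qed
  show ?thesis
  proof (cases "perp k e f \<subseteq> polar_radical")
    case True
    then show ?thesis using h by blast
  next
    case False
    then obtain g where g: "g \<in> perp k e f" "g \<notin> polar_radical" by blast
    then have "Q g \<noteq> 0" using aniso by blast
    \<comment> \<open>Rescaling by \<open>t\<close> normalises the first vector of the anisotropic
      plane to value 1.\<close>
    obtain t where t: "t\<^sup>2 = 1 / Q g" using square_surj by blast
    define u where "u = scale t g"
    have u: "u \<in> perp k e f" "Q u = 1"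
      using g(1) t \<open>Q g \<noteq> 0\<close> by (simp_all add: u_def perp_def polar_scale_left Q_scale)
    then have "u \<notin> polar_radical" using rad0 by fastforce
    then obtain w0 where w0: "w0 \<in> perp k e f" "polar Q u w0 = 1"
      using perp_nondegenerate[OF sy u(1)] by blast
    \<comment> \<open>Moving the partner along \<open>u\<close> changes its value by
      \<open>r^2 + r\<close>, that is, by any element of trace 0. Trace 0 of \<open>Q w0\<close>
      would produce a singular vector outside the radical; so the trace is 1, and the value can be
      moved to \<open>lam\<close>.\<close>
    have Qw: "Q (w0 + scale r u) = Q w0 + (r\<^sup>2 + r)" for r
      using u(2) w0(2) polar_sym[of w0 u] by (simp add: Q_add[of w0] Q_scale polar_scale_right add.assoc)
    have pw: "w0 + scale r u \<in> perp k e f" "polar Q u (w0 + scale r u) = 1" for r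
      using u(1) w0 by (simp_all add: perp_def polar_add_left polar_scale_left polar_add_right polar_scale_right)
    have "tr (Q w0) \<noteq> 0"
    proof
      assume "tr (Q w0) = 0"
      then obtain r where "Q w0 = r\<^sup>2 + r" using artin_schreier by blast
      then have "Q (w0 + scale r u) = 0" using Qw by simp
      then have "w0 + scale r u \<in> polar_radical" using aniso pw(1) by blast
      then have "polar Q u (w0 + scale r u) = 0" using polar_sym by (metis (mono_tags) mem_Collect_eq polar_radical_def)
      then show False using pw(2) by simp
    qed
    then have "tr (Q w0 + lam) = 0" using trace_values[of "Q w0"] by (auto simp: trace_add trace_lam)
    then obtain r where "Q w0 + lam = r\<^sup>2 + r" using artin_schreier by blast
    then have r: "Q (w0 + scale r u) = lam"
      using Qw[of r] by (simp flip: \<open>Q w0 + lam = r\<^sup>2 + r\<close> add: add.assoc[symmetric])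
    define w where "w = w0 + scale r u"
    have w: "w \<in> perp k e f" "polar Q u w = 1" "Q w = lam" using pw r by (simp_all add: w_def)
    let ?e = "e(Suc k := u)" and ?f = "f(Suc k := w)"
    have "elliptic_system (Suc k) ?e ?f"
      using symplectic_extend[OF sy u(1) w(1,2)] h u(2) w(3)
      by (simp add: elliptic_system_def hyperbolic_system_def)
    moreover have "perp (Suc k) ?e ?f \<subseteq> polar_radical"
    proof
      fix x assume "x \<in> perp (Suc k) ?e ?f"
      then have x: "x \<in> perp k e f" "polar Q x u = 0" "polar Q x w = 0" by (simp_all add: perp_extend)
      \<comment> \<open>As \<open>x\<close> is orthogonal to \<open>u\<close> and
        \<open>Q u = 1\<close>, the vector \<open>x + t u\<close> is singular and so lies in the
        radical. Pairing it with \<open>w\<close> gives \<open>t = 0\<close>, so \<open>x\<close>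
        itself is singular.\<close>
      obtain t where t: "t\<^sup>2 = Q x" using square_surj by blast
      have "Q (x + scale t u) = 0"
        using x(2) u(2) t by (simp add: Q_add[of x] Q_scale polar_scale_right)
      moreover have "x + scale t u \<in> perp k e f"
        using x(1) u(1) by (simp add: perp_def polar_add_left polar_scale_left)
      ultimately have "x + scale t u \<in> polar_radical" by (rule aniso[rotated])
      then have "polar Q (x + scale t u) w = 0" by (simp add: polar_radical_def)
      then have "t = 0" using x(3) w(2) by (simp add: polar_add_left polar_scale_left)
      then show "x \<in> polar_radical" using aniso[OF x(1)] t by simp
    qed
    ultimately show ?thesis by blast
  qed
qed

text \<open>The symplectic vectors, interleaved as \<open>e 1, f 1, e 2, f 2, ...\<close>, followed
  by a basis of the radical, form a basis. The radical part is invisible to the polar form, so the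
  coordinate of a symplectic vector is the pairing with its partner.\<close>

lemma symplectic_ordered_basis:
  assumes sy: "symplectic s e f" and perp: "perp s e f \<subseteq> polar_radical"
  shows "2 * s + dim polar_radical = dim (UNIV :: 'v set)"
    and "\<exists>b. ordered_basis scale b \<and> (\<forall>x. \<forall>i\<in>{1..s}.
      coord scale b (2 * i - 1) x = polar Q x (f i) \<and> coord scale b (2 * i) x = polar Q x (e i))"
proof -
  define r where "r = dim polar_radical"
  obtain C where C: "C \<subseteq> polar_radical" "independent C" "polar_radical \<subseteq> span C" "card C = dim polar_radical"
    by (rule basis_exists)
  have spanC: "span C = polar_radical" using C subspace_polar_radical span_minimal by blast
  have "finite C" by (rule finite_subset[OF subset_UNIV finite_UNIV_v])
  then obtain h where "bij_betw h {1..card C} C" using ex_bij_betw_nat_finite_1 by blast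
  then have h: "inj_on h {1..r}" "h ` {1..r} = C" by (simp_all add: bij_betw_def r_def C(4))
  have hbij: "bij_betw (comb {1..r} h) (vec_on {1..r}) polar_radical"
    using comb_bij_span[of "{1..r}" h] h C(2) spanC by simp
  define b where "b i = (if i \<le> 2 * s then if odd i then e (Suc i div 2) else f (i div 2) else h (i - 2 * s))" for i
  define K where "K = {1..2 * s + r}"
  have b_simps: "b (2 * i - 1) = e i" "b (2 * i) = f i" if "i \<in> {1..s}" for i
    using that by (auto simp: b_def)
  have split: "comb K b x = pair_comb s e f (\<lambda>i. x (2 * i - 1)) (\<lambda>i. x (2 * i)) + comb {1..r} h (\<lambda>i. x (2 * s + i))" for x
  proof -
    have "comb K b x = (\<Sum>j=1..2 * s. scale (x j) (b j)) + (\<Sum>j=2 * s + 1..2 * s + r. scale (x j) (b j))"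
      unfolding comb_def K_def by (rule sum.ub_add_nat) simp
    also have "(\<Sum>j=1..2 * s. scale (x j) (b j)) = pair_comb s e f (\<lambda>i. x (2 * i - 1)) (\<lambda>i. x (2 * i))"
      unfolding sum_pairs pair_comb_def by (intro sum.cong refl) (simp only: b_simps)
    also have "(\<Sum>j=2 * s + 1..2 * s + r. scale (x j) (b j)) = comb {1..r} h (\<lambda>i. x (2 * s + i))"
      unfolding comb_def by (rule sum.reindex_bij_witness[of _ "\<lambda>i. 2 * s + i" "\<lambda>j. j - 2 * s"]) (auto simp: b_def)
    finally show ?thesis .
  qed
  have rad: "polar Q (comb {1..r} h x) z = 0" for x z
  proof -
    have "h i \<in> polar_radical" if "i \<in> {1..r}" for i using that h(2) C(1) by blast
    then show ?thesis unfolding polar_comb_left by (intro sum.neutral) (simp add: polar_radical_def)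
  qed
  have coords: "polar Q (comb K b x) (f i) = x (2 * i - 1)" "polar Q (comb K b x) (e i) = x (2 * i)"
    if "i \<in> {1..s}" for x i
    using polar_pair_comb_symplectic[OF sy that] by (simp_all add: split polar_add_left rad del: One_nat_def)
  have index: "\<exists>i\<in>{1..s}. j = 2 * i - 1 \<or> j = 2 * i" if "j \<in> {1..2 * s}" for j
  proof (cases "even j")
    case True
    then obtain k where "j = 2 * k" by (rule evenE)
    then show ?thesis using that by (intro bexI[of _ k]) auto
  next
    case False
    then obtain k where "j = 2 * k + 1" by (rule oddE)
    then show ?thesis using that by (intro bexI[of _ "Suc k"]) auto
  qed
  have inj: "inj_on (comb K b) (vec_on K)"
  proof (rule inj_onI)
    fix x y assume x: "x \<in> vec_on K" and y: "y \<in> vec_on K" and eq: "comb K b x = comb K b y"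
    have low: "x (2 * i - 1) = y (2 * i - 1)" "x (2 * i) = y (2 * i)" if "i \<in> {1..s}" for i
      using coords[OF that, of x] coords[OF that, of y] eq by simp_all
    then have "pair_comb s e f (\<lambda>i. x (2 * i - 1)) (\<lambda>i. x (2 * i)) = pair_comb s e f (\<lambda>i. y (2 * i - 1)) (\<lambda>i. y (2 * i))"
      unfolding pair_comb_def by (intro sum.cong refl) simp
    then have "comb {1..r} h (\<lambda>i. x (2 * s + i)) = comb {1..r} h (\<lambda>i. y (2 * s + i))"
      using eq by (simp add: split)
    moreover have "comb {1..r} h z = comb {1..r} h (\<lambda>i. if i \<in> {1..r} then z i else 0)" for z
      unfolding comb_def by (intro sum.cong refl) simp
    ultimately have "(\<lambda>i. if i \<in> {1..r} then x (2 * s + i) else 0) = (\<lambda>i. if i \<in> {1..r} then y (2 * s + i) else 0)"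
      using hbij by (intro inj_onD[of "comb {1..r} h" "vec_on {1..r}"]) (auto simp: bij_betw_def vec_on_def)
    then have high: "x (2 * s + i) = y (2 * s + i)" if "i \<in> {1..r}" for i
      using that by (metis (no_types, lifting))
    show "x = y"
    proof
      fix j
      consider "j \<in> {1..2 * s}" | "j \<in> {2 * s + 1..2 * s + r}" | "j \<notin> K" unfolding K_def by fastforce
      then show "x j = y j"
      proof cases
        case 1
        then show ?thesis using index low by metis
      next
        case 2
        then have "j - 2 * s \<in> {1..r}" "2 * s + (j - 2 * s) = j" by auto
        then show ?thesis using high[of "j - 2 * s"] by (simp only:)
      next
        case 3
        then show ?thesis using x y by (simp add: vec_on_def)
      qed
    qed
  qed
  have surj: "v \<in> comb K b ` vec_on K" for v
  proof -
    have "v + proj s e f v \<in> polar_radical" using add_proj_perp[OF sy] perp by blast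
    then obtain c where c: "v + proj s e f v = comb {1..r} h c"
      using hbij unfolding bij_betw_def by (metis image_iff)
    \<comment> \<open>The first \<open>2 * s\<close> coordinates reproduce
      \<open>proj s e f v\<close> and the others \<open>v + proj s e f v\<close>; these two add up
      to \<open>v\<close> in characteristic 2.\<close>
    define x where "x j = (if j \<in> K then if j \<le> 2 * s then if odd j then polar Q v (f (Suc j div 2)) else polar Q v (e (j div 2))
      else c (j - 2 * s) else 0)" for j
    have "x (2 * i - 1) = polar Q v (f i)" "x (2 * i) = polar Q v (e i)" if "i \<in> {1..s}" for i
      using that by (auto simp: x_def K_def)
    then have "pair_comb s e f (\<lambda>i. x (2 * i - 1)) (\<lambda>i. x (2 * i)) = proj s e f v"
      unfolding pair_comb_def proj_def by (intro sum.cong refl) (simp only:)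
    moreover have "comb {1..r} h (\<lambda>i. x (2 * s + i)) = comb {1..r} h c"
      unfolding comb_def by (intro sum.cong refl) (auto simp: x_def K_def)
    ultimately have "comb K b x = proj s e f v + (v + proj s e f v)"
      by (simp only: split c)
    then have "comb K b x = v"
      by (simp add: add.left_commute)
    moreover have "x \<in> vec_on K" by (simp add: vec_on_def x_def)
    ultimately show ?thesis by blast
  qed
  have bij: "bij_betw (comb K b) (vec_on K) UNIV"
    using inj surj by (auto simp: bij_betw_def)
  \<comment> \<open>Counting both sides of the bijection gives the dimension. Only then is the index
    set \<open>K\<close> known to be \<open>indices\<close>, as an ordered basis requires.\<close>
  have "CARD('a) ^ dim (UNIV :: 'v set) = CARD('a) ^ (2 * s + r)"
    using bij_betw_same_card[OF bij] card_subspace[of UNIV] by (simp add: card_vec_on K_def subspace_UNIV)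
  then show dim: "2 * s + dim polar_radical = dim (UNIV :: 'v set)"
    using CARD_field_gt_1[where 'a = 'a] by (simp only: power_inject_exp r_def)
  then have K: "K = indices" by (simp add: K_def indices_def r_def)
  then have ob: "ordered_basis scale b" using bij by (intro ordered_basisI) simp
  have "coord scale b (2 * i - 1) x = polar Q x (f i)" "coord scale b (2 * i) x = polar Q x (e i)"
    if "i \<in> {1..s}" for i x
    using coords[OF that, of "\<lambda>j. coord scale b j x"] comb_coord[OF ob, of x] by (simp_all add: K)
  then show "\<exists>b. ordered_basis scale b \<and> (\<forall>x. \<forall>i\<in>{1..s}.
      coord scale b (2 * i - 1) x = polar Q x (f i) \<and> coord scale b (2 * i) x = polar Q x (e i))"
    using ob by blast
qed

text \<open>A vector and its projection differ by an element of the radical, where \<open>Q\<close>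
  vanishes; \<open>Q_pair_comb\<close> evaluates the projection.\<close>

lemma Q_symplectic:
  assumes sy: "symplectic s e f" and perp: "perp s e f \<subseteq> polar_radical" and rad0: "\<forall>x\<in>polar_radical. Q x = 0"
  shows "Q x = (\<Sum>i=1..s. (polar Q x (f i))\<^sup>2 * Q (e i) + polar Q x (f i) * polar Q x (e i) + (polar Q x (e i))\<^sup>2 * Q (f i))"
proof -
  define z where "z = x + proj s e f x"
  have z: "z \<in> polar_radical" using add_proj_perp[OF sy] perp by (auto simp: z_def)
  have "x = z + proj s e f x" by (simp add: z_def add.assoc)
  then have "Q x = Q (z + proj s e f x)" by (rule arg_cong)
  also have "\<dots> = Q (proj s e f x)" using z rad0 by (simp add: Q_add polar_radical_def)
  finally show ?thesis by (simp only: proj_def Q_pair_comb[OF sy])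
qed

lemma qf_equivalent_refl: "qf_equivalent scale Q Q'" if "\<And>x. Q' x = Q x"
  unfolding qf_equivalent_def using that linear_id
  by (intro exI[of _ 1] exI[of _ id]) simp

text \<open>In the coordinates of a symplectic basis adapted to \<open>normal_form\<close>,
  \<open>Q\<close> is literally one of the two standard forms, so the equivalence holds with scalar
  1 and the identity map.\<close>

lemma has_type_exists:
  assumes rank: "qf_rank scale Q = 2 * s" and s: "0 < s"
  shows "has_type scale lam s 1 Q \<or> has_type scale lam s (-1) Q"
proof -
  obtain b0 where b0: "ordered_basis scale b0" using ordered_basis_exists by blast
  have parity: "2 * half_rank indices (gram b0) + (if \<forall>x\<in>polar_radical. Q x = 0 then 0 else 1) = 2 * s"
    using qf_rank_eq[OF b0] rank by simp
  \<comment> \<open>A nonzero value on the polar radical would make the rank odd.\<close>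
  have rad0: "\<forall>x\<in>polar_radical. Q x = 0"
  proof (rule ccontr)
    assume "\<not> ?thesis"
    then have "2 * half_rank indices (gram b0) + 1 = 2 * s" using parity by (simp only: if_False)
    then show False by presburger
  qed
  then have hr: "half_rank indices (gram b0) = s" using parity by simp
  obtain k e f where perp: "perp k e f \<subseteq> polar_radical" and sys: "hyperbolic_system k e f \<or> elliptic_system k e f"
    using normal_form[OF rad0] by blast
  then have sy: "symplectic k e f" by (auto simp: hyperbolic_system_def elliptic_system_def)
  have "2 * k + dim polar_radical = dim (UNIV :: 'v set)" by (rule symplectic_ordered_basis(1)[OF sy perp])
  moreover have "dim polar_radical = dim (UNIV :: 'v set) - 2 * s" using dim_polar_radical[OF b0] hr by simp
  moreover have "2 * s \<le> dim (UNIV :: 'v set)" using half_rank(1)[OF _ gram_alt_on, of b0] hr by simp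
  ultimately have k: "k = s" by linarith
  obtain b where b: "ordered_basis scale b" and coord: "\<And>x i. i \<in> {1..s} \<Longrightarrow> coord scale b (2 * i - 1) x = polar Q x (f i)"
    "\<And>x i. i \<in> {1..s} \<Longrightarrow> coord scale b (2 * i) x = polar Q x (e i)"
    using symplectic_ordered_basis(2)[OF sy perp] unfolding k by blast
  note Qx = Q_symplectic[OF sy perp rad0, unfolded k]
  from sys show ?thesis
  proof
    assume "hyperbolic_system k e f"
    then have E: "Q (e i) = 0" "Q (f i) = 0" if "i \<in> {1..s}" for i
      using that by (simp_all add: hyperbolic_system_def k)
    have "hyperbolic_form scale b s x = Q x" for x
      unfolding hyperbolic_form_def by (subst Qx, intro sum.cong refl) (simp add: coord E del: One_nat_def)
    then have "qf_equivalent scale Q (hyperbolic_form scale b s)" by (rule qf_equivalent_refl)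
    then show ?thesis using b s by (auto simp: has_type_def)
  next
    assume "elliptic_system k e f"
    then have E: "\<And>i. i \<in> {1..s - 1} \<Longrightarrow> Q (e i) = 0 \<and> Q (f i) = 0" "Q (e s) = 1" "Q (f s) = lam"
      by (simp_all add: elliptic_system_def k)
    have "elliptic_form scale lam b s x = Q x" for x
    proof -
      have "{1..s} = insert s {1..s - 1}" using s by auto
      then have "Q x = (polar Q x (f s))\<^sup>2 + polar Q x (f s) * polar Q x (e s) + (polar Q x (e s))\<^sup>2 * lam
          + (\<Sum>i=1..s - 1. (polar Q x (f i))\<^sup>2 * Q (e i) + polar Q x (f i) * polar Q x (e i) + (polar Q x (e i))\<^sup>2 * Q (f i))"
        using s E(2,3) by (subst Qx) simp
      also have "(\<Sum>i=1..s - 1. (polar Q x (f i))\<^sup>2 * Q (e i) + polar Q x (f i) * polar Q x (e i) + (polar Q x (e i))\<^sup>2 * Q (f i))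
          = (\<Sum>i=1..s - 1. coord scale b (2 * i - 1) x * coord scale b (2 * i) x)"
      proof (intro sum.cong refl)
        fix i assume i: "i \<in> {1..s - 1}"
        then have "i \<in> {1..s}" by auto
        then show "(polar Q x (f i))\<^sup>2 * Q (e i) + polar Q x (f i) * polar Q x (e i) + (polar Q x (e i))\<^sup>2 * Q (f i)
            = coord scale b (2 * i - 1) x * coord scale b (2 * i) x"
          using E(1)[OF i] coord by simp
      qed
      finally show ?thesis
        using coord[of s x] s unfolding elliptic_form_def by (simp add: ac_simps)
    qed
    then have "qf_equivalent scale Q (elliptic_form scale lam b s)" by (rule qf_equivalent_refl)
    then show ?thesis using b s by (auto simp: has_type_def)
  qed
qed

lemma sum_binary_forms:
  assumes b: "ordered_basis scale b" and s: "2 * s \<le> dim (UNIV :: 'v set)"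
  shows "(\<Sum>x\<in>UNIV. sgn_tr (\<Sum>i=1..s. \<phi> i (coord scale b (2 * i - 1) x) (coord scale b (2 * i) x)))
    = (\<Prod>i=1..s. \<Sum>u\<in>UNIV. \<Sum>w\<in>UNIV. sgn_tr (\<phi> i u w)) * real CARD('a) ^ (dim (UNIV :: 'v set) - 2 * s)"
proof -
  have "(\<Sum>x\<in>UNIV. sgn_tr (\<Sum>i=1..s. \<phi> i (coord scale b (2 * i - 1) x) (coord scale b (2 * i) x)))
      = (\<Sum>y\<in>vec_on indices. sgn_tr (\<Sum>i=1..s. \<phi> i (coord scale b (2 * i - 1) (comb indices b y)) (coord scale b (2 * i) (comb indices b y))))"
    by (rule sum.reindex_bij_betw[OF ordered_basisD(4)[OF b], symmetric])
  also have "\<dots> = (\<Sum>y\<in>vec_on indices. sgn_tr (\<Sum>i=1..s. \<phi> i (y (2 * i - 1)) (y (2 * i))))"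
  proof (intro sum.cong refl arg_cong[where f = sgn_tr])
    fix y i assume "i \<in> {1..s}"
    then have "2 * i - 1 \<in> indices" "2 * i \<in> indices" using s by (auto simp: indices_def)
    then show "\<phi> i (coord scale b (2 * i - 1) (comb indices b y)) (coord scale b (2 * i) (comb indices b y))
        = \<phi> i (y (2 * i - 1)) (y (2 * i))"
      by (simp only: coord_comb[OF b])
  qed
  also have "\<dots> = (\<Prod>i=1..s. \<Sum>u\<in>UNIV. \<Sum>w\<in>UNIV. sgn_tr (\<phi> i u w)) * real CARD('a) ^ (card indices - 2 * s)"
    using s by (intro sum_vec_on_binary_forms) (auto simp: indices_def)
  finally show ?thesis by simp
qed

text \<open>The two types are told apart by the sign of the character sum over the form.\<close>

lemma has_type_unique:
  assumes s: "0 < s" "2 * s \<le> dim (UNIV :: 'v set)"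
  shows "\<not> (has_type scale lam s 1 Q \<and> has_type scale lam s (-1) Q)"
proof
  assume "has_type scale lam s 1 Q \<and> has_type scale lam s (-1) Q"
  then obtain b b' where b: "ordered_basis scale b" "qf_equivalent scale Q (hyperbolic_form scale b s)"
    and b': "ordered_basis scale b'" "qf_equivalent scale Q (elliptic_form scale lam b' s)"
    using s by (auto simp: has_type_def)
  obtain a L where a: "a \<noteq> 0" "bij L" "\<And>x. hyperbolic_form scale b s x = a * Q (L x)"
    using b(2) by (auto simp: qf_equivalent_def)
  obtain a' L' where a': "a' \<noteq> 0" "bij L'" "\<And>x. elliptic_form scale lam b' s x = a' * Q (L' x)"
    using b'(2) by (auto simp: qf_equivalent_def)
  have q: "real CARD('a) > 0" using CARD_field_gt_1[where 'a = 'a] by simp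
  \<comment> \<open>The scalar \<open>a'\<close> is the one that turns \<open>Q\<close> into the
    elliptic form. The hyperbolic sum is positive for every nonzero scalar, so the leftover factor
    \<open>a' / a\<close> does no harm.\<close>
  have hyp: "(\<Sum>x\<in>UNIV. sgn_tr (a' * Q x)) > 0"
  proof -
    have "(\<Sum>x\<in>UNIV. sgn_tr (a' * Q x)) = (\<Sum>x\<in>UNIV. sgn_tr (a' * Q (L x)))"
      by (rule sum.reindex_bij_betw[OF a(2), symmetric])
    also have "\<dots> = (\<Sum>x\<in>UNIV. sgn_tr (\<Sum>i=1..s. a' / a * (coord scale b (2 * i - 1) x * coord scale b (2 * i) x)))"
    proof (intro sum.cong refl arg_cong[where f = sgn_tr])
      fix x
      have "a' * Q (L x) = a' / a * hyperbolic_form scale b s x" using a by simp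
      then show "a' * Q (L x) = (\<Sum>i=1..s. a' / a * (coord scale b (2 * i - 1) x * coord scale b (2 * i) x))"
        by (simp only: hyperbolic_form_def sum_distrib_left)
    qed
    also have "\<dots> = (\<Prod>i=1..s. \<Sum>u\<in>UNIV. \<Sum>w\<in>UNIV. sgn_tr (a' / a * (u * w))) * real CARD('a) ^ (dim (UNIV :: 'v set) - 2 * s)"
      by (rule sum_binary_forms[OF b(1) s(2), where \<phi> = "\<lambda>i u w. a' / a * (u * w)"])
    also have "\<dots> > 0"
      using q a(1) a'(1) sum_hyperbolic[of "a' / a"] by simp
    finally show ?thesis .
  qed
  have ell: "(\<Sum>x\<in>UNIV. sgn_tr (a' * Q x)) < 0"
  proof -
    \<comment> \<open>One elliptic plane at position \<open>s\<close> and hyperbolic planes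
      elsewhere, so exactly one negative factor occurs. The factor 1 matches
      \<open>sum_hyperbolic\<close> for \<open>t = 1\<close>.\<close>
    define \<phi> where "\<phi> i u w = (if i = s then u\<^sup>2 + u * w + lam * w\<^sup>2 else 1 * (u * w))" for i u w
    have ins: "{1..s} = insert s {1..s - 1}" "s \<notin> {1..s - 1}" using s by auto
    have "(\<Sum>x\<in>UNIV. sgn_tr (a' * Q x)) = (\<Sum>x\<in>UNIV. sgn_tr (a' * Q (L' x)))"
      by (rule sum.reindex_bij_betw[OF a'(2), symmetric])
    also have "\<dots> = (\<Sum>x\<in>UNIV. sgn_tr (\<Sum>i=1..s. \<phi> i (coord scale b' (2 * i - 1) x) (coord scale b' (2 * i) x)))"
    proof (intro sum.cong refl arg_cong[where f = sgn_tr])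
      fix x
      have "(\<Sum>i=1..s - 1. \<phi> i (coord scale b' (2 * i - 1) x) (coord scale b' (2 * i) x))
          = (\<Sum>i=1..s - 1. coord scale b' (2 * i - 1) x * coord scale b' (2 * i) x)"
        using s by (intro sum.cong refl) (auto simp: \<phi>_def)
      then show "a' * Q (L' x) = (\<Sum>i=1..s. \<phi> i (coord scale b' (2 * i - 1) x) (coord scale b' (2 * i) x))"
        unfolding a'(3)[symmetric] elliptic_form_def ins(1) using ins(2)
        by (simp add: \<phi>_def[of s] ac_simps)
    qed
    also have "\<dots> = (\<Prod>i=1..s. \<Sum>u\<in>UNIV. \<Sum>w\<in>UNIV. sgn_tr (\<phi> i u w)) * real CARD('a) ^ (dim (UNIV :: 'v set) - 2 * s)"
      by (rule sum_binary_forms[OF b'(1) s(2)])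
    also have "(\<Prod>i=1..s. \<Sum>u\<in>UNIV. \<Sum>w\<in>UNIV. sgn_tr (\<phi> i u w)) = - real CARD('a) * real CARD('a) ^ (s - 1)"
    proof -
      have "(\<Prod>i=1..s - 1. \<Sum>u\<in>UNIV. \<Sum>w\<in>UNIV. sgn_tr (\<phi> i u w)) = (\<Prod>i=1..s - 1. real CARD('a))"
      proof (intro prod.cong refl)
        fix i assume "i \<in> {1..s - 1}"
        then have "i \<noteq> s" using s by auto
        then show "(\<Sum>u\<in>UNIV. \<Sum>w\<in>UNIV. sgn_tr (\<phi> i u w)) = real CARD('a)"
          using sum_hyperbolic[of 1] by (simp add: \<phi>_def)
      qed
      then show ?thesis
        unfolding ins(1) using ins(2) sum_elliptic by (simp add: \<phi>_def[of s])
    qed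
    finally show ?thesis using q by (simp add: mult_neg_pos)
  qed
  show False using hyp ell by simp
qed

end

section \<open>From classes of quadratic forms to half ranks of Gram matrices\<close>

context even_quadratic_space
begin

lemma qf_rank_cases:
  assumes "ordered_basis scale b"
  shows "qf_rank scale Q = 2 * s \<or> qf_rank scale Q = 2 * s + 1 \<longleftrightarrow> half_rank indices (gram b) = s"
proof -
  have "2 * h + d = 2 * s \<or> 2 * h + d = 2 * s + 1 \<longleftrightarrow> h = s" if "d = 0 \<or> d = 1" for h d :: nat
    using that by presburger
  then show ?thesis unfolding qf_rank_eq[OF assms] by simp
qed

lemma qf_rank_le: "ordered_basis scale b \<Longrightarrow> qf_rank scale Q \<le> 2 * half_rank indices (gram b) + 1"
  by (simp add: qf_rank_eq)

text \<open>Half rank \<open>s\<close> means rank \<open>2 * s\<close> or \<open>2 * s + 1\<close>,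
  and in the first case \<open>has_type_exists\<close> supplies a type.\<close>

lemma form_class_union:
  assumes b: "ordered_basis scale b" and s: "0 < s"
  shows "Q \<in> form_class scale lam (EvenRank s 1) \<union> form_class scale lam (EvenRank s (-1)) \<union> form_class scale lam (OddRank s)
    \<longleftrightarrow> half_rank indices (gram b) = s"
  using qf_rank_cases[OF b, of s] has_type_exists[OF _ s] form by auto

text \<open>Disjointness is what allows the three entries of the inner distribution to be added:
  without \<open>has_type_unique\<close> some differences could be counted twice.\<close>

lemma form_class_disjoint:
  assumes s: "0 < s"
  shows "Q \<notin> form_class scale lam (EvenRank s 1) \<inter> form_class scale lam (EvenRank s (-1))"
    and "Q \<notin> (form_class scale lam (EvenRank s 1) \<union> form_class scale lam (EvenRank s (-1))) \<inter> form_class scale lam (OddRank s)"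
proof -
  have "2 * s \<le> dim (UNIV :: 'v set)" if "qf_rank scale Q = 2 * s"
    using that by (simp add: qf_rank_def)
  then show "Q \<notin> form_class scale lam (EvenRank s 1) \<inter> form_class scale lam (EvenRank s (-1))"
    using has_type_unique[OF s] by auto
  show "Q \<notin> (form_class scale lam (EvenRank s 1) \<union> form_class scale lam (EvenRank s (-1))) \<inter> form_class scale lam (OddRank s)"
    by auto
qed

end

lemma quadratic_form_diff:
  assumes "quadratic_form scale Q" "quadratic_form scale Q'"
  shows "quadratic_form scale (\<lambda>x. Q x - Q' x)"
proof -
  have polar: "polar (\<lambda>x. Q x - Q' x) x y = polar Q x y - polar Q' x y" for x y
    by (simp add: polar_def)
  show ?thesis
    using assms unfolding quadratic_form_def Vector_Spaces.linear_iff polar by (simp add: algebra_simps)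
qed

theorem theorem4p8:
  fixes scale :: "'a::{field,finite} \<Rightarrow> 'v::ab_group_add \<Rightarrow> 'v"
    and lam :: 'a
    and q m \<delta> n :: nat
    and c :: real
    and Y :: "('v \<Rightarrow> 'a) set"
  assumes q: "primepow q" "even q" "CARD('a) = q"
    and V: "vector_space scale" "vector_space.dim scale (UNIV :: 'v set) = m"
    and lam: "absolute_trace lam = 1"
    and m: "m \<ge> 2"
    and \<delta>: "\<delta> \<ge> 1" "2 * \<delta> \<le> m"
    and code: "quadratic_code scale (2 * \<delta>) Y"
    and size_even: "even m \<Longrightarrow> card Y = q ^ (((m - 1) * (m - 2 * \<delta> + 2)) div 2)"
    and size_odd: "odd m \<Longrightarrow> card Y = q ^ ((m * (m - 2 * \<delta> + 1)) div 2)"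
    and n: "n = m div 2"
    and c: "c = real q powr (real (m * (m - 1)) / real (2 * n))"
  shows "\<forall>s>0.
    inner_distribution scale lam Y (EvenRank s 1)
      + inner_distribution scale lam Y (EvenRank s (-1))
      + inner_distribution scale lam Y (OddRank s)
    = gauss_binomial q (int n) s *
      (\<Sum>j | j + \<delta> \<le> s. (-1) ^ j * real q ^ (j * (j - 1)) * gauss_binomial q (int s) j
         * (c ^ (s - \<delta> - j + 1) - 1))"
proof (intro allI impI)
  fix s :: nat assume s: "s > 0"
  interpret finite_vector_space scale
    using V m by (intro finite_vector_space.intro finite_vector_space_axioms.intro) simp_all
  interpret F: even_field lam
    using q lam by unfold_locales simp_all
  have quad: "even_quadratic_space lam scale Q" if "quadratic_form scale Q" for Q
    using that by unfold_locales
  obtain b where b: "ordered_basis scale b" using ordered_basis_exists by blast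
  have q1: "q > 1" using CARD_field_gt_1[where 'a = 'a] q(3) by simp
  \<comment> \<open>This is \<open>m * (m - 1) / (2 * n)\<close> in both parities, namely
    \<open>m - 1\<close> for even \<open>m\<close> and \<open>m\<close> for odd \<open>m\<close>, so
    the real power \<open>c\<close> is an ordinary power of \<open>q\<close>.\<close>
  define e where "e = 2 * m - 2 * n - 1"
  have parity: "e = m - 1 \<and> m = 2 * n \<or> e = m \<and> m = 2 * n + 1"
    using m by (auto simp: e_def n)
  have n1: "n \<ge> 1" "\<delta> \<le> n" using m \<delta> by (auto simp: n)
  have c_eq: "c = real q ^ e"
  proof -
    have "real (m * (m - 1)) = real e * real (2 * n)"
      using parity by (auto simp flip: of_nat_mult)
    then have "real (m * (m - 1)) / real (2 * n) = real e" using n1 by simp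
    then show ?thesis using q1 by (simp add: c powr_realpow)
  qed
  \<comment> \<open>The last factor of the exponent, \<open>m - 2 * \<delta> + 2\<close> or
    \<open>m - 2 * \<delta> + 1\<close>, equals \<open>2 * (n - \<delta> + 1)\<close> in its parity,
    so the two size formulas become one.\<close>
  have size: "real (card Y) = c ^ (n - \<delta> + 1)"
    using parity
  proof
    assume p: "e = m - 1 \<and> m = 2 * n"
    then have "m - 2 * \<delta> + 2 = 2 * (n - \<delta> + 1)" using n1 by simp
    then have "((m - 1) * (m - 2 * \<delta> + 2)) div 2 = e * (n - \<delta> + 1)" using p by simp
    then show ?thesis using size_even p by (simp only: c_eq power_mult of_nat_power dvd_triv_left)
  next
    assume p: "e = m \<and> m = 2 * n + 1"
    then have "m - 2 * \<delta> + 1 = 2 * (n - \<delta> + 1)" using n1 by simp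
    then have "(m * (m - 2 * \<delta> + 1)) div 2 = e * (n - \<delta> + 1)" using p by simp
    moreover have "odd m" using p by simp
    ultimately show ?thesis using size_odd[OF \<open>odd m\<close>] by (simp only: c_eq power_mult of_nat_power)
  qed
  have "real (card Y) > 0" unfolding size c_eq using q1 by simp
  then have finY: "finite Y" by (simp add: card_ge_0_finite)
  have Yform: "quadratic_form scale Q" if "Q \<in> Y" for Q
    using code that by (simp add: quadratic_code_def)
  define f where "f Q = even_quadratic_space.gram scale Q b" for Q :: "'v \<Rightarrow> 'a"
  define D where "D Q Q' = half_rank indices (\<lambda>i j. f Q i j - f Q' i j)" for Q Q' :: "'v \<Rightarrow> 'a"
  \<comment> \<open>The polar form depends additively on the quadratic form, so distances between
    Gram matrices are half ranks of differences of codewords.\<close>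
  have diff: "(\<lambda>i j. f Q i j - f Q' i j) = even_quadratic_space.gram scale (\<lambda>x. Q x - Q' x) b"
    if "Q \<in> Y" "Q' \<in> Y" for Q Q'
    using quad[OF Yform[OF that(1)]] quad[OF Yform[OF that(2)]]
      quad[OF quadratic_form_diff[OF Yform[OF that(1)] Yform[OF that(2)]]]
    by (simp add: f_def even_quadratic_space.gram_def polar_def fun_eq_iff)
  have qd: "even_quadratic_space lam scale (\<lambda>x. Q x - Q' x)" if "Q \<in> Y" "Q' \<in> Y" for Q Q'
    using that by (intro quad quadratic_form_diff Yform)
  have classes: "(\<lambda>x. Q x - Q' x) \<in> form_class scale lam (EvenRank s 1) \<union> form_class scale lam (EvenRank s (-1))
      \<union> form_class scale lam (OddRank s) \<longleftrightarrow> D Q Q' = s" if "Q \<in> Y" "Q' \<in> Y" for Q Q'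
    unfolding D_def diff[OF that] by (rule even_quadratic_space.form_class_union[OF qd[OF that] b s])
  define P where "P i = {(Q, Q'). Q \<in> Y \<and> Q' \<in> Y \<and> (\<lambda>x. Q x - Q' x) \<in> form_class scale lam i}" for i
  have finP: "finite (P i)" for i
    by (rule finite_subset[of _ "Y \<times> Y"]) (use finY in \<open>auto simp: P_def\<close>)
  have "{(Q, Q'). Q \<in> Y \<and> Q' \<in> Y \<and> D Q Q' = s} = P (EvenRank s 1) \<union> P (EvenRank s (-1)) \<union> P (OddRank s)"
    using classes by (auto simp: P_def)
  moreover have "card (P (EvenRank s 1) \<union> P (EvenRank s (-1)) \<union> P (OddRank s))
      = card (P (EvenRank s 1)) + card (P (EvenRank s (-1))) + card (P (OddRank s))"
  proof -
    have "P (EvenRank s 1) \<inter> P (EvenRank s (-1)) = {}"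
      "(P (EvenRank s 1) \<union> P (EvenRank s (-1))) \<inter> P (OddRank s) = {}"
      using even_quadratic_space.form_class_disjoint[OF qd s] unfolding P_def by blast+
    then show ?thesis by (simp add: card_Un_disjoint finP)
  qed
  ultimately have lhs: "inner_distribution scale lam Y (EvenRank s 1) + inner_distribution scale lam Y (EvenRank s (-1))
      + inner_distribution scale lam Y (OddRank s)
      = real (card {(Q, Q'). Q \<in> Y \<and> Q' \<in> Y \<and> D Q Q' = s}) / real (card Y)"
    by (simp add: inner_distribution_def P_def[symmetric] add_divide_distrib del: form_class.simps)
  have "real (card {(Q, Q'). Q \<in> Y \<and> Q' \<in> Y \<and> D Q Q' = s}) / real (card Y)
      = qbinom ((real q)\<^sup>2) n s * (\<Sum>j | j + \<delta> \<le> s. (-1) ^ j * real q ^ (j * (j - 1)) * qbinom ((real q)\<^sup>2) s j * (c ^ (s - \<delta> - j + 1) - 1))"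
  proof -
    have card_ind: "card indices div 2 = n" "2 * card indices - 2 * n - 1 = e"
      by (simp_all add: V(2) n e_def)
    have fY: "f Q \<in> alt_on indices" if "Q \<in> Y" for Q
      unfolding f_def by (rule even_quadratic_space.gram_alt_on[OF quad[OF Yform[OF that]]])
    \<comment> \<open>The rank is at most twice the half rank plus 1; as \<open>2 * \<delta>\<close>
      is even, the extra 1 costs nothing. In particular distinct codewords have distinct Gram
      matrices.\<close>
    have dist: "\<delta> \<le> half_rank indices (\<lambda>i j. f Q i j - f Q' i j)" if "Q \<in> Y" "Q' \<in> Y" "Q \<noteq> Q'" for Q Q'
    proof -
      have "2 * \<delta> \<le> qf_rank scale (\<lambda>x. Q x - Q' x)" using code that by (simp add: quadratic_code_def)
      also have "\<dots> \<le> 2 * half_rank indices (\<lambda>i j. f Q i j - f Q' i j) + 1"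
        unfolding diff[OF that(1,2)] by (rule even_quadratic_space.qf_rank_le[OF qd[OF that(1,2)] b])
      finally show ?thesis by simp
    qed
    show ?thesis
      unfolding D_def
      by (rule F.optimal_code_distance_distribution[where I = indices, unfolded card_ind q(3), folded c_eq])
        (use fY \<delta>(1) n1(2) dist size s in auto)
  qed
  then show "inner_distribution scale lam Y (EvenRank s 1) + inner_distribution scale lam Y (EvenRank s (-1))
      + inner_distribution scale lam Y (OddRank s)
    = gauss_binomial q (int n) s *
      (\<Sum>j | j + \<delta> \<le> s. (-1) ^ j * real q ^ (j * (j - 1)) * gauss_binomial q (int s) j
         * (c ^ (s - \<delta> - j + 1) - 1))"
    unfolding lhs gauss_binomial_eq_qbinom[OF q1] .
qed

end
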